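(* Let $z>0$ and $(a,b,c)\in V_z^{gen}$. The spectrum $\sigma(L)$ of the self-adjoint operator $(L,\mathcal D)$ on $\mathcal H$ is $$\sigma(L)=[-(1+a)^2,-(1-a)^2]\cup\mu(S),$$ where $\sigma_c(L)=[-(1+a)^2,-(1-a)^2]$ is the continuous spectrum and $\sigma_p(L)=\mu(S)$ is the point spectrum.
   Context: Fix $0<q<1$ and $z>0$. Notation: $(x;q)_\infty=\prod_{i\ge 0}(1-xq^i)$, $(x_1,\dots,x_r;q)_\infty=\prod_j(x_j;q)_\infty$; $\mathbb Z_+=\{0,1,2,\dots\}$. $V=\{(a,b,c): a,b,c>0,\ ab,ac,bc<1\}$ and $V_z^{gen}=\{(a,b,c)\in V: a^2,b^2,c^2,ab,ac,bc,a/b,a/c,a^2b^2c^2z^2\notin\{q^k\}_{k\in\mathbb Z}\}$. $I=\{-q^k: k\in\mathbb Z_+\}\cup\{zq^k: k\in\mathbb Z\}$. For $f:I\to\mathbb C$ and $x\in I\setminus\{-1\}$, $(Lf)(x)=A(x)(f(qx)-f(x))+B(x)(f(q^{-1}x)-f(x))$, with $A(x)=a^2\left(1+\frac1{abx}\right)\left(1+\frac1{acx}\right)$ and $B(x)=\left(1+\frac{q}{bcx}\right)\left(1+\frac1x\right)$; $(Lf)(-1)=A(-1)(f(-q)-f(-1))$. $p(x)=\frac{(-abx,-acx;q)_\infty}{(-bcx,-qx;q)_\infty}>0$ on $I$. $\mathcal H$ is the Hilbert space of $f:I\to\mathbb C$ with $\langle f,f\rangle<\infty$, where $$\langle f,g\rangle=\sum_{k\ge0}f(-q^k)\overline{g(-q^k)}\frac{(1-q)q^k}{p(-q^k)}+\sum_{k\in\mathbb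 Z}f(zq^k)\overline{g(zq^k)}\frac{(1-q)zq^k}{p(zq^k)}.$$ $(D_qf)(x)=\frac{f(x)-f(qx)}{(1-q)x}$. $\mathcal D$ is the space of $f\in\mathcal H$ with $Lf\in\mathcal H$ such that $\lim_{k\to\infty}f(zq^k)=\lim_{k\to\infty}f(-q^k)$ and $\lim_{k\to\infty}(D_qf)(zq^k)=\lim_{k\to\infty}(D_qf)(-q^k)$ (all limits existing). The operator $(L,\mathcal D)$ on $\mathcal H$ is self-adjoint. $\mu(\gamma)=-1-a^2+a(\gamma+\gamma^{-1})$ for $\gamma\in\mathbb C^*$, and $$S=\left\{\tfrac1{q^ke}: e\in\{a,b,c\},\ k\in\mathbb Z_+,\ \tfrac1{q^ke}<1\right\}\cup\left\{-\tfrac{abcz}{q^{k+1}}: k\in\mathbb Z,\ \tfrac{abcz}{q^{k+1}}<1\right\}.$$ Point spectrum: the set of eigenvalues. Continuous spectrum: the set of $\lambda$ for which $L-\lambda$ is injective with dense, proper range. *)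

theory Defs
  imports "HOL-Analysis.Analysis"
begin

section \<open>Spectra of unbounded operators on spaces of complex-valued functions\<close>

text \<open>
  An operator is a map \<open>T\<close> with a domain \<open>D\<close> inside a carrier \<open>H\<close> of complex-valued functions,
  with scalars acting pointwise; \<open>nrm\<close> is the norm of \<open>H\<close>.
\<close>

definition shift_op :: "(('i \<Rightarrow> complex) \<Rightarrow> 'i \<Rightarrow> complex) \<Rightarrow> complex \<Rightarrow> ('i \<Rightarrow> complex) \<Rightarrow> 'i \<Rightarrow> complex"
  where "shift_op T lam f = (\<lambda>x. T f x - lam * f x)"

definition resolvent_set ::
  "('i \<Rightarrow> complex) set \<Rightarrow> (('i \<Rightarrow> complex) \<Rightarrow> real) \<Rightarrow> ('i \<Rightarrow> complex) set \<Rightarrow>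
   (('i \<Rightarrow> complex) \<Rightarrow> 'i \<Rightarrow> complex) \<Rightarrow> complex set"
  where "resolvent_set H nrm D T =
    {lam. bij_betw (shift_op T lam) D H \<and> (\<exists>M. \<forall>f\<in>D. nrm f \<le> M * nrm (shift_op T lam f))}"

definition spectrum ::
  "('i \<Rightarrow> complex) set \<Rightarrow> (('i \<Rightarrow> complex) \<Rightarrow> real) \<Rightarrow> ('i \<Rightarrow> complex) set \<Rightarrow>
   (('i \<Rightarrow> complex) \<Rightarrow> 'i \<Rightarrow> complex) \<Rightarrow> complex set"
  where "spectrum H nrm D T = - resolvent_set H nrm D T"

definition point_spectrum ::
  "('i \<Rightarrow> complex) set \<Rightarrow> (('i \<Rightarrow> complex) \<Rightarrow> 'i \<Rightarrow> complex) \<Rightarrow> complex set"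
  where "point_spectrum D T = {lam. \<exists>f\<in>D. f \<noteq> (\<lambda>x. 0) \<and> T f = (\<lambda>x. lam * f x)}"

definition dense_in ::
  "('i \<Rightarrow> complex) set \<Rightarrow> (('i \<Rightarrow> complex) \<Rightarrow> real) \<Rightarrow> ('i \<Rightarrow> complex) set \<Rightarrow> bool"
  where "dense_in H nrm R \<longleftrightarrow>
    R \<subseteq> H \<and> (\<forall>g\<in>H. \<forall>e>0. \<exists>h\<in>R. nrm (\<lambda>x. g x - h x) < e)"

definition continuous_spectrum ::
  "('i \<Rightarrow> complex) set \<Rightarrow> (('i \<Rightarrow> complex) \<Rightarrow> real) \<Rightarrow> ('i \<Rightarrow> complex) set \<Rightarrow>
   (('i \<Rightarrow> complex) \<Rightarrow> 'i \<Rightarrow> complex) \<Rightarrow> complex set"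
  where "continuous_spectrum H nrm D T =
    {lam. inj_on (shift_op T lam) D \<and>
          dense_in H nrm (shift_op T lam ` D) \<and> shift_op T lam ` D \<noteq> H}"

section \<open>The second-order q-difference operator\<close>

definition qpoch_inf :: "real \<Rightarrow> real \<Rightarrow> real"
  where "qpoch_inf x q = (\<Prod>i. 1 - x * q ^ i)"

definition Vset :: "(real \<times> real \<times> real) set"
  where "Vset = {(a, b, c). a > 0 \<and> b > 0 \<and> c > 0 \<and> a * b < 1 \<and> a * c < 1 \<and> b * c < 1}"

definition Vgen :: "real \<Rightarrow> real \<Rightarrow> (real \<times> real \<times> real) set"
  where "Vgen q z = {(a, b, c). (a, b, c) \<in> Vset \<and>
    {a\<^sup>2, b\<^sup>2, c\<^sup>2, a * b, a * c, b * c, a / b, a / c, a\<^sup>2 * b\<^sup>2 * c\<^sup>2 * z\<^sup>2}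
      \<inter> {q powi k |k :: int. True} = {}}"

definition Iset :: "real \<Rightarrow> real \<Rightarrow> real set"
  where "Iset q z = {- (q ^ k) |k :: nat. True} \<union> {z * q powi k |k :: int. True}"

definition Acoeff :: "real \<Rightarrow> real \<Rightarrow> real \<Rightarrow> real \<Rightarrow> real"
  where "Acoeff a b c x = a\<^sup>2 * (1 + 1 / (a * b * x)) * (1 + 1 / (a * c * x))"

definition Bcoeff :: "real \<Rightarrow> real \<Rightarrow> real \<Rightarrow> real \<Rightarrow> real"
  where "Bcoeff q b c x = (1 + q / (b * c * x)) * (1 + 1 / x)"

text \<open>
  Functions on \<^term>\<open>Iset q z\<close> are represented by functions on the reals that vanish off this set;
  this makes extensional equality the equality of functions on \<^term>\<open>Iset q z\<close>.
\<close>

definition Lop :: "real \<Rightarrow> real \<Rightarrow> real \<Rightarrow> real \<Rightarrow> real \<Rightarrow> (real \<Rightarrow> complex) \<Rightarrow> real \<Rightarrow> complex"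
  where "Lop q z a b c f x =
    (if x \<notin> Iset q z then 0
     else if x = -1 then of_real (Acoeff a b c (-1)) * (f (- q) - f (-1))
     else of_real (Acoeff a b c x) * (f (q * x) - f x)
        + of_real (Bcoeff q b c x) * (f (x / q) - f x))"

definition pfun :: "real \<Rightarrow> real \<Rightarrow> real \<Rightarrow> real \<Rightarrow> real \<Rightarrow> real"
  where "pfun q a b c x =
    (qpoch_inf (- a * b * x) q * qpoch_inf (- a * c * x) q) /
    (qpoch_inf (- b * c * x) q * qpoch_inf (- q * x) q)"

definition wminus :: "real \<Rightarrow> real \<Rightarrow> real \<Rightarrow> real \<Rightarrow> nat \<Rightarrow> real"
  where "wminus q a b c k = (1 - q) * q ^ k / pfun q a b c (- (q ^ k))"

definition wplus :: "real \<Rightarrow> real \<Rightarrow> real \<Rightarrow> real \<Rightarrow> real \<Rightarrow> int \<Rightarrow> real"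
  where "wplus q z a b c k = (1 - q) * z * q powi k / pfun q a b c (z * q powi k)"

definition Hinner ::
  "real \<Rightarrow> real \<Rightarrow> real \<Rightarrow> real \<Rightarrow> real \<Rightarrow> (real \<Rightarrow> complex) \<Rightarrow> (real \<Rightarrow> complex) \<Rightarrow> complex"
  where "Hinner q z a b c f g =
    (\<Sum>k. f (- (q ^ k)) * cnj (g (- (q ^ k))) * of_real (wminus q a b c k)) +
    (\<Sum>\<^sub>\<infinity>k\<in>(UNIV :: int set).
       f (z * q powi k) * cnj (g (z * q powi k)) * of_real (wplus q z a b c k))"

definition Hspace :: "real \<Rightarrow> real \<Rightarrow> real \<Rightarrow> real \<Rightarrow> real \<Rightarrow> (real \<Rightarrow> complex) set"
  where "Hspace q z a b c =
    {f. (\<forall>x. x \<notin> Iset q z \<longrightarrow> f x = 0) \<and>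
        summable (\<lambda>k. (cmod (f (- (q ^ k))))\<^sup>2 * wminus q a b c k) \<and>
        (\<lambda>k. (cmod (f (z * q powi k)))\<^sup>2 * wplus q z a b c k) summable_on (UNIV :: int set)}"

definition Hnorm :: "real \<Rightarrow> real \<Rightarrow> real \<Rightarrow> real \<Rightarrow> real \<Rightarrow> (real \<Rightarrow> complex) \<Rightarrow> real"
  where "Hnorm q z a b c f = sqrt (Re (Hinner q z a b c f f))"

definition Dq :: "real \<Rightarrow> (real \<Rightarrow> complex) \<Rightarrow> real \<Rightarrow> complex"
  where "Dq q f x = (f x - f (q * x)) / of_real ((1 - q) * x)"

definition Ddom :: "real \<Rightarrow> real \<Rightarrow> real \<Rightarrow> real \<Rightarrow> real \<Rightarrow> (real \<Rightarrow> complex) set"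
  where "Ddom q z a b c =
    {f \<in> Hspace q z a b c. Lop q z a b c f \<in> Hspace q z a b c \<and>
       (\<exists>l. (\<lambda>k. f (z * q ^ k)) \<longlonglongrightarrow> l \<and> (\<lambda>k. f (- (q ^ k))) \<longlonglongrightarrow> l) \<and>
       (\<exists>l. (\<lambda>k. Dq q f (z * q ^ k)) \<longlonglongrightarrow> l \<and> (\<lambda>k. Dq q f (- (q ^ k))) \<longlonglongrightarrow> l)}"

definition mu :: "real \<Rightarrow> complex \<Rightarrow> complex"
  where "mu a \<gamma> = - 1 - (of_real a)\<^sup>2 + of_real a * (\<gamma> + inverse \<gamma>)"

definition Sset :: "real \<Rightarrow> real \<Rightarrow> real \<Rightarrow> real \<Rightarrow> real \<Rightarrow> real set"
  where "Sset q z a b c =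
    {1 / (q ^ k * e) |(e :: real) (k :: nat). e \<in> {a, b, c} \<and> 1 / (q ^ k * e) < 1} \<union>
    {- (a * b * c * z / q powi (k + 1)) |k :: int. a * b * c * z / q powi (k + 1) < 1}"

end

(* The operator is a doubly infinite Jacobi operator with a limit circle singularity at 0: near 0 all
   solutions of L f = mu(g) f are power series, so the conditions defining the domain glue the two
   half-lines together, and up to a factor there is one solution phi satisfying the equation at -1.
   For |g| < 1 it is a nonterminating 3phi2 series in x, regular at the origin, whose behaviour
   (a/g)^k d(g) at z q^(-k) follows from the q-Gauss sum; d is a product of theta functions and
   q-shifted factorials with zero set S. (The series needs b < 1, but b and c play symmetric roles
   and b c < 1.) A second solution Phi ~ (a g)^k is obtained by Frobenius'
   method at infinity. If d(g) = 0 the two are proportional and phi is an eigenfunction; otherwise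
   their Casoratian does not vanish and the Green kernel is a bounded resolvent by the Schur test.
   For |g| = 1 no solution is square summable: the finitely supported functions orthogonal to phi are
   then dense and in the range, while Phi(z q^(-k)) / sqrt k is mapped into the space without
   belonging to it. *)
theory Submission
  imports Defs "HOL-Complex_Analysis.Cauchy_Integral_Formula"
begin

section \<open>The q-Gauss sum\<close>

text \<open>The limits (l, m) of value and q-derivative at the origin serve as coordinates on the
  two-dimensional space of solutions. On both half-lines the Casoratian of two solutions is one
  fixed constant times the determinant of their pairs; computed at infinity, for the two solutions
  belonging to |g| < 1, it is a nonzero multiple of d(g). So dependence of solutions, normalisation
  of the Green kernel and the condition d(g) = 0 are all read off from one 2x2 determinant. The
  delicate point is the limit of the 3phi2 series at z q^(-k): the usual terms have poles, and
  exchanging limit and sum needs a majorant uniform in k. Writing (e;q)_inf / (e;q)_n as a single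
  product makes every term entire in x, and replacing g by |g| leads to positive terms whose
  consecutive ratios are at most max b |g|. Finally, mu maps the punctured closed unit disc onto the
  plane, and point spectrum, continuous spectrum and resolvent set are disjoint. Hence it suffices
  to find for each g one of the three that contains mu(g); the equalities follow.\<close>

locale q_base =
  fixes q :: real
  assumes q_pos: "0 < q" and q_less_1: "q < 1"
begin

section \<open>Finite and infinite q-shifted factorials at complex arguments\<close>

definition qn :: "complex \<Rightarrow> nat \<Rightarrow> complex"
  where "qn x n = (\<Prod>i<n. 1 - x * of_real q ^ i)"

definition qp :: "complex \<Rightarrow> complex"
  where "qp x = (\<Prod>i. 1 - x * of_real q ^ i)"

lemma qn_0 [simp]: "qn x 0 = 1"
  by (simp add: qn_def)

lemma qn_Suc: "qn x (Suc n) = qn x n * (1 - x * of_real q ^ n)"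
  by (simp add: qn_def)

lemma qn_Suc_left: "qn x (Suc n) = (1 - x) * qn (of_real q * x) n"
  unfolding qn_def by (subst prod.lessThan_Suc_shift) (simp add: mult_ac)

lemma summable_qpow: "summable (\<lambda>i. R * q ^ i)" for R :: real
  using q_pos q_less_1 by (intro summable_mult summable_geometric) auto

lemma norm_q_power: "norm (of_real q ^ i :: complex) = q ^ i"
  using q_pos by (simp add: norm_power)

lemma abs_convergent_prod_qp: "abs_convergent_prod (\<lambda>i. 1 - x * of_real q ^ i)" for x :: complex
proof -
  have "summable (\<lambda>i. norm ((1 - x * of_real q ^ i) - 1))"
    using summable_qpow[of "norm x"] by (simp add: norm_mult norm_q_power)
  then show ?thesis by (rule summable_imp_abs_convergent_prod)
qed

lemma convergent_prod_qp: "convergent_prod (\<lambda>i. 1 - x * of_real q ^ i)" for x :: complex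
  by (rule abs_convergent_prod_imp_convergent_prod[OF abs_convergent_prod_qp])

lemma qn_LIMSEQ: "qn x \<longlonglongrightarrow> qp x"
proof -
  have "(\<lambda>n. \<Prod>i\<le>n. 1 - x * of_real q ^ i) \<longlonglongrightarrow> qp x"
    unfolding qp_def by (rule convergent_prod_LIMSEQ[OF convergent_prod_qp])
  then have "(\<lambda>n. qn x (Suc n)) \<longlonglongrightarrow> qp x"
    unfolding qn_def lessThan_Suc_atMost .
  then show ?thesis by (rule LIMSEQ_imp_Suc)
qed

lemma qp_step: "qp x = (1 - x) * qp (of_real q * x)"
proof -
  have "(\<lambda>n. qn x (Suc n)) \<longlonglongrightarrow> (1 - x) * qp (of_real q * x)"
    unfolding qn_Suc_left by (intro tendsto_mult_left qn_LIMSEQ)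
  moreover have "(\<lambda>n. qn x (Suc n)) \<longlonglongrightarrow> qp x"
    using qn_LIMSEQ by (rule LIMSEQ_Suc)
  ultimately show ?thesis using LIMSEQ_unique by blast
qed

lemma qp_0 [simp]: "qp 0 = 1"
  by (simp add: qp_def)

lemma qp_split: "qp x = qn x n * qp (x * of_real q ^ n)"
proof (induction n)
  case (Suc n)
  have "qp (x * of_real q ^ n) = (1 - x * of_real q ^ n) * qp (x * of_real q ^ Suc n)"
    using qp_step[of "x * of_real q ^ n"] by (simp add: mult_ac)
  then show ?case by (simp add: Suc.IH qn_Suc)
qed simp

text \<open>A convergent product in the sense of \<open>has_prod\<close> vanishes only through one
  of its factors. The explicit points of \<open>Sset\<close> come from this.\<close>

lemma qp_eq_0_iff: "qp x = 0 \<longleftrightarrow> (\<exists>i. x * of_real q ^ i = 1)"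
proof -
  have "qp x = 0 \<longleftrightarrow> (\<exists>i. 1 - x * of_real q ^ i = 0)"
    unfolding qp_def using has_prod_eq_0_iff[OF convergent_prod_has_prod[OF convergent_prod_qp]]
    by (auto simp: image_iff)
  then show ?thesis by auto
qed

lemma qp_nonzero_small: "norm x < 1 \<Longrightarrow> qp x \<noteq> 0"
proof
  assume "norm x < 1" "qp x = 0"
  then obtain i where i: "x * of_real q ^ i = 1" by (auto simp: qp_eq_0_iff)
  have "norm x * q ^ i = 1" using arg_cong[OF i, of norm] by (simp add: norm_mult norm_q_power)
  moreover have "q ^ i \<le> 1" using q_pos q_less_1 by (intro power_le_one) auto
  moreover have "norm x * q ^ i \<le> norm x * 1" using calculation(2) by (intro mult_left_mono) auto
  ultimately show False using \<open>norm x < 1\<close> by simp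
qed

text \<open>Each factor satisfies |1 - x q^i| \<le> 1 + |x| q^i, with equality at the negative real
  point of the same modulus. The resulting bound for \<open>qp\<close> lets \<open>Rk_bound\<close>
  pass from complex to positive \<open>g\<close>.\<close>

lemma qn_norm_le: "norm (qn x n) \<le> norm (qn (- of_real (norm x)) n)"
proof -
  have "norm (1 - x * of_real q ^ i) \<le> 1 + norm x * q ^ i" for i
    using norm_triangle_ineq4[of 1 "x * of_real q ^ i"] by (simp add: norm_mult norm_q_power)
  moreover have "norm (1 - (- of_real (norm x)) * of_real q ^ i :: complex) = 1 + norm x * q ^ i" for i
  proof -
    have "1 - (- of_real (norm x)) * of_real q ^ i = (of_real (1 + norm x * q ^ i) :: complex)" by simp
    then show ?thesis using q_pos by (simp only: norm_of_real) simp
  qed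
  ultimately show ?thesis unfolding qn_def prod_norm[symmetric] by (intro prod_mono) auto
qed

lemma qp_norm_le: "norm (qp x) \<le> norm (qp (- of_real (norm x)))"
  by (rule LIMSEQ_le[OF tendsto_norm[OF qn_LIMSEQ] tendsto_norm[OF qn_LIMSEQ]])
    (use qn_norm_le in auto)

text \<open>From 1 + t \<le> e^t and the geometric series. The bound does not depend on
  \<open>n\<close>, as the majorants for series in \<open>n\<close> require.\<close>

lemma qn_bound: "norm (qn x n) \<le> exp (norm x / (1 - q))"
proof -
  have "norm (1 - x * of_real q ^ i) \<le> exp (norm x * q ^ i)" for i
  proof -
    have "norm (1 - x * of_real q ^ i) \<le> 1 + norm x * q ^ i"
      using norm_triangle_ineq4[of 1 "x * of_real q ^ i"] by (simp add: norm_mult norm_q_power)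
    then show ?thesis using exp_ge_add_one_self order_trans by blast
  qed
  then have "norm (qn x n) \<le> (\<Prod>i<n. exp (norm x * q ^ i))"
    unfolding qn_def prod_norm[symmetric] by (intro prod_mono) auto
  also have "\<dots> = exp (\<Sum>i<n. norm x * q ^ i)" by (simp add: exp_sum)
  also have "(\<Sum>i<n. norm x * q ^ i) \<le> (\<Sum>i. norm x * q ^ i)"
    using q_pos by (intro sum_le_suminf summable_qpow) auto
  also have "\<dots> = norm x / (1 - q)"
    using q_pos q_less_1 by (subst suminf_mult) (auto simp: suminf_geometric)
  finally show ?thesis by simp
qed

lemma qp_bound: "norm (qp x) \<le> exp (norm x / (1 - q))"
  by (rule LIMSEQ_le_const2[OF tendsto_norm[OF qn_LIMSEQ]]) (use qn_bound in auto)

lemma qp_holomorphic: "qp holomorphic_on UNIV"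
proof (rule holomorphic_uniform_sequence[of _ "\<lambda>n x. \<Prod>i<n. 1 - x * of_real q ^ i"])
  fix x :: complex
  have "uniformly_convergent_on (cball x 1) (\<lambda>N x. \<Prod>i<N. 1 - x * of_real q ^ i)"
  proof (rule uniformly_convergent_on_prod')
    show "uniformly_convergent_on (cball x 1) (\<lambda>N x. \<Sum>n<N. norm (1 - x * of_real q ^ n - 1))"
    proof (rule Weierstrass_m_test')
      fix n y assume "y \<in> cball x 1"
      then have "norm y \<le> norm x + 1"
        using norm_triangle_ineq2[of y x] by (simp add: dist_norm norm_minus_commute)
      then show "norm (norm (1 - y * of_real q ^ n - 1)) \<le> (norm x + 1) * q ^ n"
        using q_pos by (simp add: norm_mult norm_q_power mult_right_mono)
    qed (rule summable_qpow)
  qed (auto intro!: continuous_intros)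
  then obtain l where l: "uniform_limit (cball x 1) (\<lambda>N x. \<Prod>i<N. 1 - x * of_real q ^ i) l sequentially"
    by (auto simp: uniformly_convergent_on_def)
  have "l y = qp y" if "y \<in> cball x 1" for y
    using tendsto_uniform_limitI[OF l that] qn_LIMSEQ[of y] LIMSEQ_unique unfolding qn_def by blast
  then have "uniform_limit (cball x 1) (\<lambda>N x. \<Prod>i<N. 1 - x * of_real q ^ i) qp sequentially"
    using l by (subst uniform_limit_cong'[of _ _ "\<lambda>N x. \<Prod>i<N. 1 - x * of_real q ^ i" _ l]) auto
  then show "\<exists>d>0. cball x d \<subseteq> UNIV \<and>
     uniform_limit (cball x d) (\<lambda>n x. \<Prod>i<n. 1 - x * of_real q ^ i) qp sequentially"
    by (intro exI[of _ 1]) auto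
qed (simp_all add: holomorphic_intros)

lemma qp_holomorphic_comp: "f holomorphic_on A \<Longrightarrow> (\<lambda>x. qp (f x)) holomorphic_on A"
  using holomorphic_on_compose_gen[of f A qp UNIV] qp_holomorphic by (simp add: o_def)

lemma isCont_qp: "isCont qp x"
  using qp_holomorphic holomorphic_on_imp_continuous_on continuous_on_eq_continuous_at open_UNIV
  by blast

lemma tendsto_qp: "(f \<longlongrightarrow> x) F \<Longrightarrow> ((\<lambda>t. qp (f t)) \<longlongrightarrow> qp x) F"
  by (rule isCont_tendsto_compose[OF isCont_qp])

lemma qp_of_real: "qp (of_real x) = of_real (qpoch_inf x q)"
proof -
  have "(\<lambda>i. complex_of_real (1 - x * q ^ i)) has_prod qp (of_real x)"
    using convergent_prod_has_prod[OF convergent_prod_qp[of "of_real x"]] by (simp add: qp_def)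
  moreover have "convergent_prod (\<lambda>i. 1 - x * q ^ i)"
    using convergent_prod_of_real_iff[of "\<lambda>i. 1 - x * q ^ i"] convergent_prod_qp[of "of_real x"]
    by (simp add: o_def)
  then have "(\<lambda>i. 1 - x * q ^ i) has_prod qpoch_inf x q"
    unfolding qpoch_inf_def by (rule convergent_prod_has_prod)
  then have "(\<lambda>i. complex_of_real (1 - x * q ^ i)) has_prod of_real (qpoch_inf x q)"
    by (subst has_prod_of_real_iff)
  ultimately show ?thesis using has_prod_unique2 by blast
qed

lemma qpoch_inf_pos: "x < 1 \<Longrightarrow> 0 < qpoch_inf x q"
proof -
  assume x: "x < 1"
  have conv: "convergent_prod (\<lambda>i. 1 - x * q ^ i)"
    using convergent_prod_of_real_iff[of "\<lambda>i. 1 - x * q ^ i"] convergent_prod_qp[of "of_real x"]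
    by (simp add: o_def)
  have "0 < 1 - x * q ^ i" for i
  proof (cases "x \<le> 0")
    case True
    then show ?thesis using q_pos mult_nonpos_nonneg[of x "q ^ i"] by (simp add: less_le_trans[of 0 1])
  next
    case False
    have "x * q ^ i \<le> x * 1"
      using False q_pos q_less_1 by (intro mult_left_mono power_le_one) auto
    then show ?thesis using x by simp
  qed
  then show ?thesis unfolding qpoch_inf_def by (intro less_0_prodinf conv)
qed

section \<open>Infinite products at y / q^k\<close>

definition qtri :: "nat \<Rightarrow> complex"
  where "qtri k = (\<Prod>j<k. 1 / of_real q ^ Suc j)"

lemma qtri_nonzero [simp]: "qtri k \<noteq> 0"
  using q_pos by (simp add: qtri_def)

text \<open>The k factors in front of \<open>qp y\<close> are 1 - y / q^j = (-y) q^(-j) (1 - q^j /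
  y) for 1 \<le> j \<le> k. Apart from elementary powers only \<open>qn (q / y) k\<close> depends on
  k, and it tends to the other half of a theta function. \<open>qtri k\<close> is q^(-k(k+1)/2); it
  is never evaluated because it cancels in quotients.\<close>

lemma qp_theta:
  assumes "y \<noteq> 0"
  shows "qp (y / of_real q ^ k) = (- y) ^ k * qtri k * qn (of_real q / y) k * qp y"
proof (induction k)
  case 0
  show ?case by (simp add: qtri_def)
next
  case (Suc k)
  have "qp (y / of_real q ^ Suc k) = (1 - y / of_real q ^ Suc k) * qp (y / of_real q ^ k)"
    using qp_step[of "y / of_real q ^ Suc k"] q_pos by simp
  also have "1 - y / of_real q ^ Suc k = (- y) * (1 / of_real q ^ Suc k) * (1 - of_real q / y * of_real q ^ k)"
    using assms q_pos by (simp add: field_simps)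
  finally show ?case by (simp add: Suc.IH qtri_def qn_Suc mult_ac)
qed

text \<open>The ratio recursion \<open>(1 - u) G(u) = (1 - A u)(1 - B u) G(q u)\<close> telescopes.\<close>
theorem q_Gauss:
  assumes u: "norm u < 1"
  shows "summable (\<lambda>n. qn A n * qn B n / qn (of_real q) n * qp (A * B * u * of_real q ^ n) * u ^ n)"
    and "(\<Sum>n. qn A n * qn B n / qn (of_real q) n * qp (A * B * u * of_real q ^ n) * u ^ n)
          = qp (A * u) * qp (B * u) / qp u"
proof -
  let ?q = "of_real q :: complex"
  define r where "r n = qn A n * qn B n / qn ?q n" for n
  \<comment> \<open>With C = A B u, the quotient (C;q)_inf / (C;q)_n is the single product at C q^n.
    Absorbing it multiplies the usual 2phi1(A, B; C; q, u) by (C;q)_inf and leaves no pole in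
    C.\<close>
  define t where "t u n = r n * qp (A * B * u * ?q ^ n) * u ^ n" for u n
  have qq0: "qp ?q \<noteq> 0" using q_pos q_less_1 by (intro qp_nonzero_small) auto
  have qnq0: "qn ?q n \<noteq> 0" for n using qq0 qp_split[of ?q n] by auto
  have "r \<longlonglongrightarrow> qp A * qp B / qp ?q"
    unfolding r_def using qq0 by (intro tendsto_intros qn_LIMSEQ) auto
  then have "Bseq r" using convergent_imp_Bseq convergentI by blast
  then obtain K where K: "K > 0" "norm (r n) \<le> K" for n
    by (auto simp: Bseq_def)
  define C where "C = K * exp (norm (A * B) / (1 - q))"
  have t_bound: "norm (t v n) \<le> C * norm v ^ n" if "norm v \<le> 1" for v n
  proof -
    have qi: "q ^ n \<le> 1" using q_pos q_less_1 by (intro power_le_one) auto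
    have "norm (A * B * v * ?q ^ n) \<le> norm (A * B) * 1 * 1"
      unfolding norm_mult[of _ "?q ^ n"] norm_mult[of "A * B"] norm_q_power
      using that qi q_pos by (intro mult_mono) auto
    then have "norm (A * B * v * ?q ^ n) / (1 - q) \<le> norm (A * B) / (1 - q)"
      using q_less_1 by (intro divide_right_mono) auto
    then have "norm (qp (A * B * v * ?q ^ n)) \<le> exp (norm (A * B) / (1 - q))"
      using qp_bound[of "A * B * v * ?q ^ n"] by (meson exp_le_cancel_iff order_trans)
    then have "norm (r n) * norm (qp (A * B * v * ?q ^ n)) \<le> C"
      unfolding C_def using K by (intro mult_mono) (auto simp: less_imp_le)
    then show ?thesis
      unfolding t_def by (simp add: norm_mult norm_power mult_right_mono)
  qed
  have summ: "summable (t v)" if "norm v < 1" for v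
    by (rule summable_comparison_test'[of "\<lambda>n. C * norm v ^ n" 0])
      (use t_bound[of v] that in \<open>auto intro!: summable_mult summable_geometric\<close>)
  define G where "G v = (\<Sum>n. t v n)" for v
  have step: "(1 - v) * G v = (1 - A * v) * (1 - B * v) * G (?q * v)" if v: "norm v < 1" for v
  proof -
    have qv: "norm (?q * v) < 1" using v q_pos q_less_1
      by (simp add: norm_mult) (smt (verit) mult_le_cancel_right2 norm_ge_zero)
    \<comment> \<open>Certificate of the recursion: \<open>\<tau> 0\<close> is 0 because 1 - q^0 =
      0, and \<open>\<tau>\<close> tends to 0 with the summands, so the telescoping sum
      vanishes.\<close>
    define \<tau> where "\<tau> n = - (1 - ?q ^ n) * r n * qp (A * B * v * ?q ^ n) * v ^ n" for n
    have tele: "(1 - v) * t v n - (1 - A * v) * (1 - B * v) * t (?q * v) n = \<tau> (Suc n) - \<tau> n" for n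
    proof -
      have r_Suc: "r (Suc n) * (1 - ?q ^ Suc n) = r n * (1 - A * ?q ^ n) * (1 - B * ?q ^ n)"
        using qnq0[of "Suc n"] qnq0[of n] by (simp add: r_def qn_Suc field_simps)
      have p: "qp (A * B * v * ?q ^ n) = (1 - A * B * v * ?q ^ n) * qp (A * B * v * ?q ^ Suc n)"
        using qp_step[of "A * B * v * ?q ^ n"] by (simp add: mult_ac)
      have p': "qp (A * B * (?q * v) * ?q ^ n) = qp (A * B * v * ?q ^ Suc n)"
        by (simp add: mult_ac)
      define P where "P = qp (A * B * v * ?q ^ Suc n)"
      have "\<tau> (Suc n) = - (r (Suc n) * (1 - ?q ^ Suc n)) * P * v ^ Suc n"
        by (simp add: \<tau>_def P_def algebra_simps)
      then have "\<tau> (Suc n) = - (r n * (1 - A * ?q ^ n) * (1 - B * ?q ^ n)) * P * v ^ Suc n"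
        by (simp only: r_Suc)
      then show ?thesis
        unfolding t_def \<tau>_def p p' P_def[symmetric] by (simp add: algebra_simps power_mult_distrib)
    qed
    have "(\<lambda>n. (1 - v) * t v n - (1 - A * v) * (1 - B * v) * t (?q * v) n)
            sums ((1 - v) * G v - (1 - A * v) * (1 - B * v) * G (?q * v))"
      unfolding G_def by (intro sums_diff sums_mult summable_sums summ v qv)
    moreover have "\<tau> \<longlonglongrightarrow> 0"
    proof -
      have "\<tau> = (\<lambda>n. - (1 - ?q ^ n) * t v n)" by (auto simp: \<tau>_def t_def)
      moreover have "(\<lambda>n. - (1 - ?q ^ n) * t v n) \<longlonglongrightarrow> - (1 - 0) * 0"
        using q_pos q_less_1
        by (intro tendsto_intros summable_LIMSEQ_zero summ v LIMSEQ_power_zero) auto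
      ultimately show ?thesis by simp
    qed
    then have "(\<lambda>n. \<tau> (Suc n) - \<tau> n) sums (0 - \<tau> 0)"
      by (rule telescope_sums)
    moreover have "\<tau> 0 = 0" by (simp add: \<tau>_def)
    ultimately show ?thesis using tele sums_unique2 by fastforce
  qed
  have qv: "norm (?q ^ n * u) < 1" for n
  proof -
    have "q ^ n \<le> 1" using q_pos q_less_1 by (intro power_le_one) auto
    then have "q ^ n * norm u \<le> 1 * norm u" by (intro mult_right_mono) auto
    then show ?thesis using u by (simp add: norm_mult norm_q_power)
  qed
  have iter: "qn u n * G u = qn (A * u) n * qn (B * u) n * G (?q ^ n * u)" for n
  proof (induction n)
    case (Suc n)
    have "qn u (Suc n) * G u = (1 - ?q ^ n * u) * (qn u n * G u)"
      by (simp add: qn_Suc mult_ac)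
    also have "\<dots> = qn (A * u) n * qn (B * u) n * ((1 - ?q ^ n * u) * G (?q ^ n * u))"
      by (simp add: Suc.IH)
    also have "\<dots> = qn (A * u) (Suc n) * qn (B * u) (Suc n) * G (?q ^ Suc n * u)"
      unfolding step[OF qv] by (simp add: qn_Suc mult_ac)
    finally show ?case .
  qed simp
  \<comment> \<open>Tannery's theorem along q^n u: in the limit only the summand of index 0
    survives, with value 1, which fixes the constant of the iteration.\<close>
  have "(\<lambda>n. G (?q ^ n * u)) \<longlonglongrightarrow> (\<Sum>n. if n = 0 then 1 else 0)"
  proof -
    have lim: "((\<lambda>m. t (?q ^ m * u) k) \<longlongrightarrow> (if k = 0 then 1 else 0)) sequentially" for k
    proof -
      have a: "(\<lambda>m. ?q ^ m * u) \<longlonglongrightarrow> 0 * u"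
        using q_pos q_less_1 by (intro tendsto_intros LIMSEQ_power_zero) auto
      have "(\<lambda>m. t (?q ^ m * u) k) \<longlonglongrightarrow> r k * qp (A * B * (0 * u) * ?q ^ k) * (0 * u) ^ k"
        unfolding t_def by (intro tendsto_intros tendsto_qp a)
      then show ?thesis by (cases k) (auto simp: r_def)
    qed
    have "norm (t (?q ^ m * u) k) \<le> C * norm u ^ k" for m k
    proof -
      have "norm (t (?q ^ m * u) k) \<le> C * norm (?q ^ m * u) ^ k"
        using qv[of m] by (intro t_bound) auto
      also have "\<dots> \<le> C * norm u ^ k"
      proof -
        have "q ^ m * norm u \<le> 1 * norm u" using q_pos q_less_1 by (intro mult_right_mono power_le_one) auto
        then have "norm (?q ^ m * u) ^ k \<le> norm u ^ k"
          by (intro power_mono) (use q_pos in \<open>auto simp: norm_mult norm_q_power\<close>)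
        then show ?thesis using K by (intro mult_left_mono) (auto simp: C_def)
      qed
      finally show ?thesis .
    qed
    then have "eventually (\<lambda>(k, m). norm (t (?q ^ m * u) k) \<le> C * norm u ^ k) (at_top \<times>\<^sub>F sequentially)"
      by (intro always_eventually) auto
    from tannerys_theorem[OF lim this] u show ?thesis
      unfolding G_def by (auto intro!: summable_mult summable_geometric)
  qed
  also have "(\<Sum>n. if n = 0 then 1 else 0 :: complex) = 1"
    using suminf_finite[of "{0}" "\<lambda>n. if n = 0 then 1 else 0 :: complex"] by auto
  finally have Glim: "(\<lambda>n. G (?q ^ n * u)) \<longlonglongrightarrow> 1" .
  have "(\<lambda>n. qn u n * G u) \<longlonglongrightarrow> qp u * G u"
    by (intro tendsto_intros qn_LIMSEQ)
  moreover have "(\<lambda>n. qn u n * G u) \<longlonglongrightarrow> qp (A * u) * qp (B * u) * 1"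
    unfolding iter by (intro tendsto_intros qn_LIMSEQ Glim)
  ultimately have "qp u * G u = qp (A * u) * qp (B * u)"
    using LIMSEQ_unique by fastforce
  then show "(\<Sum>n. qn A n * qn B n / qn (of_real q) n * qp (A * B * u * of_real q ^ n) * u ^ n)
          = qp (A * u) * qp (B * u) / qp u"
    using qp_nonzero_small[OF u] unfolding G_def t_def r_def by (simp add: field_simps)
  show "summable (\<lambda>n. qn A n * qn B n / qn (of_real q) n * qp (A * B * u * of_real q ^ n) * u ^ n)"
    using summ[OF u] unfolding t_def r_def .
qed

end

section \<open>The solution regular at the origin and its asymptotics\<close>

locale big_q_Jacobi = q_base q for q :: real +
  fixes z a b c :: real
  assumes z_pos: "0 < z" and a_pos: "0 < a" and b_pos: "0 < b" and c_pos: "0 < c"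
    and ab: "a * b < 1" and ac: "a * c < 1" and bc: "b * c < 1"
begin

definition cf :: "complex \<Rightarrow> nat \<Rightarrow> complex"
  where "cf g n = qn (of_real a / g) n * qn (of_real c / g) n / (qn (of_real (a * c)) n * qn (of_real q) n)"

text \<open>With e = abc/g, the last factor is (-ex;q)_inf / (-ex;q)_n. So \<open>Nsum g x\<close>
  is (-ex;q)_inf times 3phi2(a/g, c/g, -acx; ac, -ex; q, bg), in a form whose terms are entire in
  x.\<close>

definition tm :: "complex \<Rightarrow> nat \<Rightarrow> complex \<Rightarrow> complex"
  where "tm g n x = cf g n * (of_real b * g) ^ n * qn (- of_real (a * c) * x) n
    * qp (- (of_real (a * b * c) / g * x * of_real q ^ n))"

definition Nsum :: "complex \<Rightarrow> complex \<Rightarrow> complex"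
  where "Nsum g x = (\<Sum>n. tm g n x)"

text \<open>The zeros of the denominator are the points -1/(b c q^i), which lie to the left of -1
  because b c < 1. So this function is regular on all of \<open>II\<close> and near the
  origin.\<close>

definition Fn :: "complex \<Rightarrow> complex \<Rightarrow> complex"
  where "Fn g x = Nsum g x / qp (- of_real (b * c) * x)"

lemma qn_nonzero: "qp x \<noteq> 0 \<Longrightarrow> qn x n \<noteq> 0"
  using qp_split[of x n] by auto

lemma qp_q_nonzero: "qp (of_real q) \<noteq> 0"
  using q_pos q_less_1 by (intro qp_nonzero_small) auto

lemma qp_ac_nonzero: "qp (of_real (a * c)) \<noteq> 0"
  using a_pos c_pos ac by (intro qp_nonzero_small) (auto simp: norm_mult)

lemma cf_Suc:
  "cf g (Suc n) * (1 - of_real (a * c) * of_real q ^ n) * (1 - of_real q * of_real q ^ n)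
    = cf g n * (1 - of_real a / g * of_real q ^ n) * (1 - of_real c / g * of_real q ^ n)"
  using qn_nonzero[OF qp_q_nonzero, of "Suc n"] qn_nonzero[OF qp_ac_nonzero, of "Suc n"]
  by (simp add: cf_def qn_Suc)

lemma cf_bounded: obtains K where "K > 0" "\<And>n. norm (cf g n) \<le> K"
proof -
  have "cf g \<longlonglongrightarrow> qp (of_real a / g) * qp (of_real c / g) / (qp (of_real (a * c)) * qp (of_real q))"
    unfolding cf_def[abs_def] using qp_q_nonzero qp_ac_nonzero
    by (intro tendsto_intros qn_LIMSEQ) auto
  then have "Bseq (cf g)" using convergent_imp_Bseq convergentI by blast
  then show ?thesis using that by (auto simp: Bseq_def)
qed

lemma norm_mult_qpow_le: "norm (x * of_real q ^ n) \<le> norm x" for x :: complex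
proof -
  have "norm x * q ^ n \<le> norm x * 1"
    using q_pos q_less_1 by (intro mult_left_mono power_le_one) auto
  then show ?thesis by (simp add: norm_mult norm_q_power)
qed

lemma tm_bound:
  assumes "norm x \<le> R"
  shows "norm (tm g n x) \<le> norm (cf g n) * norm (of_real b * g) ^ n
    * (exp (norm (of_real (a * c) :: complex) * R / (1 - q)) * exp (norm (of_real (a * b * c) / g) * R / (1 - q)))"
proof -
  let ?e = "of_real (a * b * c) / g"
  have "norm (qn (- of_real (a * c) * x) n) \<le> exp (norm (of_real (a * c) :: complex) * R / (1 - q))"
  proof -
    have "norm (- of_real (a * c) * x) / (1 - q) \<le> norm (of_real (a * c) :: complex) * R / (1 - q)"
      using assms q_less_1 unfolding norm_mult norm_minus_cancel
      by (intro divide_right_mono mult_left_mono) auto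
    then show ?thesis using qn_bound exp_le_cancel_iff order_trans by blast
  qed
  moreover have "norm (qp (- (?e * x * of_real q ^ n))) \<le> exp (norm ?e * R / (1 - q))"
  proof -
    have "norm (- (?e * x * of_real q ^ n)) \<le> norm (?e * x)"
      unfolding norm_minus_cancel by (rule norm_mult_qpow_le)
    also have "\<dots> \<le> norm ?e * R"
      using assms unfolding norm_mult by (intro mult_left_mono) auto
    finally have "norm (- (?e * x * of_real q ^ n)) / (1 - q) \<le> norm ?e * R / (1 - q)"
      using q_less_1 by (intro divide_right_mono) auto
    then show ?thesis using qp_bound exp_le_cancel_iff order_trans by blast
  qed
  ultimately have "norm (qn (- of_real (a * c) * x) n) * norm (qp (- (?e * x * of_real q ^ n)))
      \<le> exp (norm (of_real (a * c) :: complex) * R / (1 - q)) * exp (norm ?e * R / (1 - q))"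
    by (intro mult_mono) auto
  then have "norm (cf g n * (of_real b * g) ^ n) *
      (norm (qn (- of_real (a * c) * x) n) * norm (qp (- (?e * x * of_real q ^ n))))
    \<le> norm (cf g n * (of_real b * g) ^ n) *
      (exp (norm (of_real (a * c) :: complex) * R / (1 - q)) * exp (norm ?e * R / (1 - q)))"
    by (intro mult_left_mono) auto
  then show ?thesis unfolding tm_def norm_mult norm_power by (simp only: mult.assoc)
qed

text \<open>For |x| \<le> R all factors except (b g)^n are bounded uniformly in n, so a geometric
  series dominates. It serves both for convergence and for the M-test in
  \<open>Nsum_holomorphic\<close>.\<close>

lemma tm_majorant:
  assumes "norm (of_real b * g) < 1"
  obtains M where "summable M" "\<And>n x. norm x \<le> R \<Longrightarrow> norm (tm g n x) \<le> M n"
proof -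
  obtain K where K: "K > 0" "\<And>n. norm (cf g n) \<le> K" using cf_bounded by blast
  define E where "E = exp (norm (of_real (a * c) :: complex) * R / (1 - q)) * exp (norm (of_real (a * b * c) / g) * R / (1 - q))"
  show ?thesis
  proof
    show "summable (\<lambda>n. K * norm (of_real b * g) ^ n * E)"
      using assms by (intro summable_mult summable_mult2 summable_geometric) auto
    fix n x assume "norm (x :: complex) \<le> R"
    then have "norm (tm g n x) \<le> norm (cf g n) * norm (of_real b * g) ^ n * E"
      unfolding E_def by (rule tm_bound)
    also have "\<dots> \<le> K * norm (of_real b * g) ^ n * E"
      using K by (intro mult_right_mono) (auto simp: E_def)
    finally show "norm (tm g n x) \<le> K * norm (of_real b * g) ^ n * E" .
  qed
qed

lemma tm_summable: "norm (of_real b * g) < 1 \<Longrightarrow> summable (\<lambda>n. tm g n x)"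
  by (metis tm_majorant[of g "norm x"] summable_comparison_test' order_refl)

lemma Nsum_holomorphic:
  assumes "norm (of_real b * g) < 1"
  shows "Nsum g holomorphic_on UNIV"
proof (rule holomorphic_uniform_sequence[of _ "\<lambda>N x. \<Sum>n<N. tm g n x"])
  show "(\<lambda>x. \<Sum>n<N. tm g n x) holomorphic_on UNIV" for N
    unfolding tm_def qn_def by (intro holomorphic_intros qp_holomorphic_comp)
  fix x :: complex
  obtain M where M: "summable M" "\<And>n y. norm y \<le> norm x + 1 \<Longrightarrow> norm (tm g n y) \<le> M n"
    using tm_majorant[OF assms] by blast
  have "uniform_limit (cball x 1) (\<lambda>N x. \<Sum>n<N. tm g n x) (\<lambda>x. \<Sum>n. tm g n x) sequentially"
  proof (rule Weierstrass_m_test[OF _ M(1)])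
    fix n y assume "y \<in> cball x 1"
    then have "norm y \<le> norm x + 1"
      using norm_triangle_ineq2[of y x] by (simp add: dist_norm norm_minus_commute)
    then show "norm (tm g n y) \<le> M n" by (rule M)
  qed
  then show "\<exists>d>0. cball x d \<subseteq> UNIV \<and> uniform_limit (cball x d) (\<lambda>n x. \<Sum>i<n. tm g i x) (Nsum g) sequentially"
    unfolding Nsum_def[abs_def] by (intro exI[of _ 1]) auto
qed simp_all

lemma Fn_deriv_0:
  assumes "norm (of_real b * g) < 1"
  shows "\<exists>D. (Fn g has_field_derivative D) (at 0)"
proof -
  have "Nsum g holomorphic_on ball 0 1"
    using Nsum_holomorphic[OF assms] by (rule holomorphic_on_subset) simp
  moreover have "qp (- of_real (b * c) * x) \<noteq> 0" if "x \<in> ball 0 1" for x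
  proof (rule qp_nonzero_small)
    have "b * c * norm x \<le> b * c * 1"
      using that b_pos c_pos by (intro mult_left_mono) auto
    then have "b * c * norm x < 1" using bc by linarith
    then show "norm (- of_real (b * c) * x) < 1"
      using b_pos c_pos by (simp add: norm_mult)
  qed
  ultimately have "Fn g holomorphic_on ball 0 1"
    unfolding Fn_def[abs_def] by (intro holomorphic_intros qp_holomorphic_comp) auto
  then show ?thesis
    using holomorphic_on_imp_differentiable_at[of "Fn g" "ball 0 1" 0]
    by (auto simp: field_differentiable_def)
qed

text \<open>The equation holds termwise up to a telescoping sum with certificate \<open>\<sigma>\<close>, as found by the
  q-Zeilberger algorithm.\<close>
lemma Nsum_equation:
  fixes x g :: complex
  assumes g: "g \<noteq> 0" "norm (of_real b * g) < 1"
  defines "lam \<equiv> mu a g"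
  shows "(1 + of_real (a * b) * x) * (1 + of_real (a * c) * x) *
           ((1 + of_real (b * c) * x) * Nsum g (of_real q * x) - Nsum g x)
       + (1 + x) * (of_real q * Nsum g (x / of_real q) - (of_real q + of_real (b * c) * x) * Nsum g x)
       = lam * of_real (b * c) * x\<^sup>2 * Nsum g x"
proof -
  define A B C p where "A = complex_of_real a" and "B = complex_of_real b" and "C = complex_of_real c"
    and "p = complex_of_real q"
  have p0: "p \<noteq> 0" using q_pos by (simp add: p_def)
  have lam: "lam = - 1 - A\<^sup>2 + A * (g + inverse g)" by (simp add: lam_def mu_def A_def)
  define r where "r = - A * C * x\<^sup>2 * (1 - B / g)"
  define T where "T n = (1 + A * B * x) * (1 + A * C * x) *
           ((1 + B * C * x) * tm g n (p * x) - tm g n x)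
       + (1 + x) * (p * tm g n (x / p) - (p + B * C * x) * tm g n x)
       - lam * (B * C) * x\<^sup>2 * tm g n x" for n
  define e where "e = A * B * C / g"
  \<comment> \<open>By \<open>cf_Suc\<close> this can also be written with
    \<open>cf g (Suc n)\<close> and the factors (1 - a c q^n)(1 - q^(n+1)). In that form the value
    at n = -1 would be 0, which is why \<open>T 0 = \<sigma> 0\<close> has no preceding
    term.\<close>
  define \<sigma> where "\<sigma> n = r * (B * g) * (1 - A / g * p ^ n) * (1 - C / g * p ^ n) * cf g n * (B * g) ^ n
     * qn (- (A * C) * x) n * qp (- (e * x * p ^ Suc n))" for n
  have tm': "tm g n y = cf g n * (B * g) ^ n * qn (- (A * C) * y) n * qp (- (e * y * p ^ n))" for n y
    by (simp add: tm_def A_def B_def C_def p_def e_def)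
  have T0: "T 0 = \<sigma> 0"
  proof -
    define P where "P = qp (- (e * x * p ^ 1))"
    have 1: "qp (- (e * x * p ^ 0)) = (1 + e * x) * P"
      using qp_step[of "- (e * x)"] by (simp add: P_def p_def mult_ac)
    have 2: "qp (- (e * (x / p) * p ^ 0)) = (1 + e * (x / p)) * ((1 + e * x) * P)"
      using qp_step[of "- (e * (x / p))"] p0 unfolding 1[symmetric] by (simp add: p_def mult_ac)
    have 3: "qp (- (e * (p * x) * p ^ 0)) = P" by (simp add: P_def mult_ac)
    have cf0: "cf g 0 = 1" by (simp add: cf_def)
    have "T 0 = P * ((1 + A * B * x) * (1 + A * C * x) * ((1 + B * C * x) - (1 + e * x))
       + (1 + x) * (p * (1 + e * (x / p)) * (1 + e * x) - (p + B * C * x) * (1 + e * x))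
       - lam * (B * C) * x\<^sup>2 * (1 + e * x))"
      unfolding T_def tm' 1 2 3 unfolding cf0 qn_0 power_0 by algebra
    also have "(1 + A * B * x) * (1 + A * C * x) * ((1 + B * C * x) - (1 + e * x))
       + (1 + x) * (p * (1 + e * (x / p)) * (1 + e * x) - (p + B * C * x) * (1 + e * x))
       - lam * (B * C) * x\<^sup>2 * (1 + e * x) = r * (B * g) * (1 - A / g) * (1 - C / g)"
      unfolding lam r_def e_def using g p0 by (simp add: field_simps power2_eq_square)
    also have "P * \<dots> = \<sigma> 0" by (simp add: \<sigma>_def P_def cf0)
    finally show ?thesis .
  qed
  have TS: "T (Suc n) = \<sigma> (Suc n) - \<sigma> n" for n
  proof -
    \<comment> \<open>All shifted products are reduced to \<open>M\<close> and \<open>P\<close>.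
      Once the common factor \<open>\<kappa> * M * P\<close> is taken out, a rational identity in Q
      = q^n remains.\<close>
    define Q where "Q = p ^ n"
    define \<kappa> where "\<kappa> = cf g (Suc n) * (B * g) ^ Suc n"
    define M where "M = qn (- (A * C) * x) n"
    define P where "P = qp (- (e * x * p ^ Suc (Suc n)))"
    have P1: "qp (- (e * x * p ^ Suc n)) = (1 + e * x * p * Q) * P"
      using qp_step[of "- (e * x * p ^ Suc n)"] by (simp add: P_def p_def Q_def mult_ac)
    have P2: "qp (- (e * (x / p) * p ^ Suc n)) = (1 + e * x * Q) * ((1 + e * x * p * Q) * P)"
      using qp_step[of "- (e * x * p ^ n)"] p0 unfolding P1[symmetric] by (simp add: p_def Q_def mult_ac)
    have P3: "qp (- (e * (p * x) * p ^ Suc n)) = P" by (simp add: P_def mult_ac)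
    have M1: "qn (- (A * C) * x) (Suc n) = M * (1 + A * C * x * Q)"
      by (simp add: M_def qn_Suc Q_def p_def)
    have M2: "(1 + A * C * x) * qn (- (A * C) * (p * x)) (Suc n) = M * (1 + A * C * x * Q) * (1 + A * C * x * p * Q)"
    proof -
      have "(1 + A * C * x) * qn (- (A * C) * (p * x)) (Suc n) = qn (- (A * C) * x) (Suc (Suc n))"
        unfolding qn_Suc_left[of "- (A * C) * x" "Suc n"] by (simp add: p_def mult_ac)
      then show ?thesis unfolding qn_Suc[of _ "Suc n"] M1 by (simp add: Q_def p_def mult_ac)
    qed
    have M3: "qn (- (A * C) * (x / p)) (Suc n) = (1 + A * C * (x / p)) * M"
      using p0 by (simp add: qn_Suc_left M_def flip: p_def)
    have \<sigma>n: "\<sigma> n = \<kappa> * M * P * (r * (1 - A * C * Q) * (1 - p * Q) * (1 + e * x * p * Q))"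
    proof -
      have "\<sigma> n = r * (cf g n * (1 - of_real a / g * of_real q ^ n) * (1 - of_real c / g * of_real q ^ n))
         * (B * g) ^ Suc n * M * qp (- (e * x * p ^ Suc n))"
        by (simp add: \<sigma>_def A_def C_def p_def M_def mult_ac)
      also have "\<dots> = r * (cf g (Suc n) * (1 - A * C * Q) * (1 - p * Q)) * (B * g) ^ Suc n * M * ((1 + e * x * p * Q) * P)"
        unfolding cf_Suc[symmetric] P1 by (simp add: A_def C_def p_def Q_def)
      finally show ?thesis by (simp add: \<kappa>_def mult_ac)
    qed
    have \<sigma>S: "\<sigma> (Suc n) = \<kappa> * M * P * (r * (B * g) * (1 - A / g * (p * Q)) * (1 - C / g * (p * Q)) * (1 + A * C * x * Q))"
      unfolding \<sigma>_def M1 by (simp add: \<kappa>_def P_def Q_def mult_ac)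
    have "T (Suc n) = (1 + A * B * x) * ((1 + B * C * x) * \<kappa> * ((1 + A * C * x) * qn (- (A * C) * (p * x)) (Suc n)) * P
          - (1 + A * C * x) * (\<kappa> * (M * (1 + A * C * x * Q)) * ((1 + e * x * p * Q) * P)))
       + (1 + x) * (p * (\<kappa> * ((1 + A * C * (x / p)) * M) * ((1 + e * x * Q) * ((1 + e * x * p * Q) * P)))
          - (p + B * C * x) * (\<kappa> * (M * (1 + A * C * x * Q)) * ((1 + e * x * p * Q) * P)))
       - lam * (B * C) * x\<^sup>2 * (\<kappa> * (M * (1 + A * C * x * Q)) * ((1 + e * x * p * Q) * P))"
      unfolding T_def tm' P1 P2 P3 M1 M3 \<kappa>_def[symmetric] by (simp add: algebra_simps)
    also have "\<dots> = \<kappa> * M * P * ((1 + A * B * x) * (1 + A * C * x * Q) * ((1 + B * C * x) * (1 + A * C * x * p * Q)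
          - (1 + A * C * x) * (1 + e * x * p * Q))
       + (1 + x) * (p * (1 + A * C * (x / p)) * (1 + e * x * Q) * (1 + e * x * p * Q)
          - (p + B * C * x) * (1 + A * C * x * Q) * (1 + e * x * p * Q))
       - lam * (B * C) * x\<^sup>2 * (1 + A * C * x * Q) * (1 + e * x * p * Q))"
      unfolding M2 by (simp add: algebra_simps)
    also have "(1 + A * B * x) * (1 + A * C * x * Q) * ((1 + B * C * x) * (1 + A * C * x * p * Q)
          - (1 + A * C * x) * (1 + e * x * p * Q))
       + (1 + x) * (p * (1 + A * C * (x / p)) * (1 + e * x * Q) * (1 + e * x * p * Q)
          - (p + B * C * x) * (1 + A * C * x * Q) * (1 + e * x * p * Q))
       - lam * (B * C) * x\<^sup>2 * (1 + A * C * x * Q) * (1 + e * x * p * Q)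
      = r * (B * g) * (1 - A / g * (p * Q)) * (1 - C / g * (p * Q)) * (1 + A * C * x * Q)
        - r * (1 - A * C * Q) * (1 - p * Q) * (1 + e * x * p * Q)"
      unfolding lam r_def e_def using g p0 by (simp add: field_simps power2_eq_square)
    finally show ?thesis unfolding \<sigma>n \<sigma>S by (simp add: algebra_simps)
  qed
  have partial: "(\<Sum>n<Suc N. T n) = \<sigma> N" for N
    by (induction N) (simp_all add: T0 TS)
  \<comment> \<open>The factor (B g)^n tends to 0 and all others converge.\<close>
  have "\<sigma> \<longlonglongrightarrow> r * (B * g) * (1 - A / g * 0) * (1 - C / g * 0)
      * (qp (of_real a / g) * qp (of_real c / g) / (qp (of_real (a * c)) * qp (of_real q)))
      * 0 * qp (- (A * C) * x) * qp (- (e * x * 0))"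
    unfolding \<sigma>_def cf_def
    using qp_q_nonzero qp_ac_nonzero q_pos q_less_1 g
    by (intro tendsto_intros qn_LIMSEQ tendsto_qp LIMSEQ_Suc[of "\<lambda>n. p ^ n"] LIMSEQ_power_zero)
      (auto simp: p_def B_def)
  then have "(\<lambda>N. \<Sum>n<Suc N. T n) \<longlonglongrightarrow> 0" unfolding partial by simp
  then have "T sums 0" unfolding sums_def by (rule LIMSEQ_imp_Suc)
  moreover have "T sums ((1 + A * B * x) * (1 + A * C * x) *
           ((1 + B * C * x) * Nsum g (p * x) - Nsum g x)
       + (1 + x) * (p * Nsum g (x / p) - (p + B * C * x) * Nsum g x)
       - lam * (B * C) * x\<^sup>2 * Nsum g x)"
    unfolding T_def Nsum_def
    by (intro sums_diff sums_add sums_mult summable_sums tm_summable g)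
  ultimately show ?thesis
    using sums_unique2 by (fastforce simp: A_def B_def C_def p_def)
qed


text \<open>At x = -1 the factor \<open>qn (- a c x) n\<close> cancels the one in the denominator of
  \<open>cf\<close>, and the 3phi2 collapses to the q-Gauss sum with argument b g. The resulting
  product is nonzero since a b, b c and |b g| are below 1.\<close>

lemma Fn_minus_1:
  assumes "g \<noteq> 0" "norm (of_real b * g) < 1"
  shows "Fn g (- 1) \<noteq> 0"
proof -
  have "Nsum g (- 1) = (\<Sum>n. qn (of_real a / g) n * qn (of_real c / g) n / qn (of_real q) n
      * qp (of_real a / g * (of_real c / g) * (of_real b * g) * of_real q ^ n) * (of_real b * g) ^ n)"
    unfolding Nsum_def
  proof (rule suminf_cong)
    fix n
    have "of_real a / g * (of_real c / g) * (of_real b * g) = of_real (a * b * c) / g"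
      using assms by (simp add: field_simps)
    then show "tm g n (- 1) = qn (of_real a / g) n * qn (of_real c / g) n / qn (of_real q) n
      * qp (of_real a / g * (of_real c / g) * (of_real b * g) * of_real q ^ n) * (of_real b * g) ^ n"
      using qn_nonzero[OF qp_ac_nonzero, of n] by (simp add: tm_def cf_def)
  qed
  also have "\<dots> = qp (of_real a / g * (of_real b * g)) * qp (of_real c / g * (of_real b * g)) / qp (of_real b * g)"
    by (rule q_Gauss(2)[OF assms(2)])
  also have "\<dots> = qp (of_real (a * b)) * qp (of_real (b * c)) / qp (of_real b * g)"
    using assms by (simp add: mult_ac)
  finally have N: "Nsum g (- 1) = qp (of_real (a * b)) * qp (of_real (b * c)) / qp (of_real b * g)" .
  have "qp (of_real (a * b)) \<noteq> 0" "qp (of_real (b * c)) \<noteq> 0" "qp (of_real b * g) \<noteq> 0"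
    using assms(2) ab bc a_pos b_pos c_pos by (auto intro!: qp_nonzero_small simp: norm_mult)
  then show ?thesis unfolding Fn_def N by simp
qed

text \<open>In the quotient of two instances of \<open>qp_theta\<close> the factors
  \<open>qtri\<close> cancel and the powers combine to (y/y')^k. What is left converges to theta(y)
  / theta(y') with theta(y) = (y, q/y;q)_inf.\<close>

lemma theta_ratio_limit:
  assumes "y \<noteq> 0" "y' \<noteq> 0" "qp (of_real q / y') \<noteq> 0"
  shows "(\<lambda>k. (y' / y) ^ k * (qp (y / of_real q ^ k) / qp (y' / of_real q ^ k)))
    \<longlonglongrightarrow> qp (of_real q / y) * qp y / (qp (of_real q / y') * qp y')"
proof -
  have "(y' / y) ^ k * (qp (y / of_real q ^ k) / qp (y' / of_real q ^ k))
      = qn (of_real q / y) k * qp y / (qn (of_real q / y') k * qp y')" for k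
  proof -
    have "(y' / y) ^ k * (qp (y / of_real q ^ k) / qp (y' / of_real q ^ k))
      = ((y' / y) ^ k * ((- y) ^ k / (- y') ^ k)) * (qtri k / qtri k)
        * (qn (of_real q / y) k * qp y / (qn (of_real q / y') k * qp y'))"
      unfolding qp_theta[OF assms(1)] qp_theta[OF assms(2)] by simp
    also have "(y' / y) ^ k * ((- y) ^ k / (- y') ^ k) = 1"
      using assms by (simp add: power_mult_distrib[symmetric] power_divide[symmetric])
    finally show ?thesis by simp
  qed
  moreover have "(\<lambda>k. qn (of_real q / y) k * qp y / (qn (of_real q / y') k * qp y'))
    \<longlonglongrightarrow> qp (of_real q / y) * qp y / (qp (of_real q / y') * qp y')"
  \<comment> \<open>If \<open>qp y'\<close> vanishes, division by zero makes both sides 0.\<close>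
  proof (cases "qp y' = 0")
    case False
    then show ?thesis using assms by (intro tendsto_intros qn_LIMSEQ) auto
  qed simp
  ultimately show ?thesis by simp
qed

section \<open>Limits and uniform bounds of the single terms at z / q^k\<close>

lemma qp_neg_nonzero: "0 \<le> t \<Longrightarrow> qp (- of_real t) \<noteq> 0"
proof
  assume t: "0 \<le> t" "qp (- of_real t) = 0"
  then obtain i where "- of_real t * of_real q ^ i = (1 :: complex)" by (auto simp: qp_eq_0_iff)
  then have "complex_of_real (- t * q ^ i) = of_real 1" by simp
  then have "- t * q ^ i = 1" by (simp only: of_real_eq_iff)
  moreover have "t * q ^ i \<ge> 0" using t q_pos by simp
  ultimately show False by linarith
qed

text \<open>The term of index n in (g/a)^k \<open>Fn g (z / q^k)\<close> without
  \<open>cf g n\<close>, the part that does not depend on k.\<close>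

definition Rk :: "complex \<Rightarrow> nat \<Rightarrow> nat \<Rightarrow> complex"
  where "Rk g n k = (g / of_real a) ^ k * (of_real b * g) ^ n * qn (- of_real (a * c * z / q ^ k)) n
    * qp (- (of_real (a * b * c) / g * of_real (z / q ^ k) * of_real q ^ n)) / qp (- of_real (b * c * z / q ^ k))"

text \<open>With theta(y) = (y, q/y;q)_inf this is theta(-abcz/g) / theta(-bcz). Its zeros in the
  unit disc form the negative part of \<open>Sset\<close>.\<close>

definition thetaq :: "complex \<Rightarrow> complex"
  where "thetaq g = qp (- (of_real q * g / of_real (a * b * c * z))) * qp (- (of_real (a * b * c * z) / g))
    / (qp (- of_real (q / (b * c * z))) * qp (- of_real (b * c * z)))"

lemma Rk_0_limit:
  assumes "g \<noteq> 0"
  shows "Rk g 0 \<longlonglongrightarrow> thetaq g"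
proof -
  let ?y = "- (of_real (a * b * c * z) / g)" and ?y' = "- complex_of_real (b * c * z)"
  have "(\<lambda>k. (?y' / ?y) ^ k * (qp (?y / of_real q ^ k) / qp (?y' / of_real q ^ k)))
    \<longlonglongrightarrow> qp (of_real q / ?y) * qp ?y / (qp (of_real q / ?y') * qp ?y')"
  proof (rule theta_ratio_limit)
    have "qp (- of_real (q / (b * c * z))) \<noteq> 0"
      using q_pos b_pos c_pos z_pos by (intro qp_neg_nonzero) auto
    then show "qp (of_real q / ?y') \<noteq> 0" by simp
  qed (use assms a_pos b_pos c_pos z_pos in auto)
  moreover have "?y' / ?y = g / of_real a"
    using assms a_pos b_pos c_pos z_pos by (simp add: field_simps)
  ultimately show ?thesis
    unfolding Rk_def[abs_def] thetaq_def by (simp add: field_simps)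
qed

text \<open>The ratio of consecutive terms is b g (1 + a c X) / (1 + a b c X / g) with X = z
  q^(n-k), which tends to g^2 as X grows. Denominators are cleared because for complex g the factor
  on the left may vanish.\<close>

lemma Rk_Suc:
  "Rk g (Suc n) k * (1 + of_real (a * b * c) / g * of_real (z / q ^ k) * of_real q ^ n)
    = Rk g n k * (of_real b * g * (1 + of_real (a * c * z / q ^ k) * of_real q ^ n))"
proof -
  let ?x = "of_real (a * b * c) / g * of_real (z / q ^ k) * of_real q ^ n"
  have "qp (- ?x) = (1 + ?x) * qp (- (of_real (a * b * c) / g * of_real (z / q ^ k) * of_real q ^ Suc n))"
    using qp_step[of "- ?x"] by (simp add: mult_ac)
  then show ?thesis unfolding Rk_def qn_Suc by (simp add: mult_ac)
qed

lemma Rk_limit: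
  assumes g: "g \<noteq> 0"
  shows "Rk g n \<longlonglongrightarrow> thetaq g * (g\<^sup>2) ^ n"
proof (induction n)
  case 0
  show ?case using Rk_0_limit[OF g] by simp
next
  case (Suc n)
  define e where "e = of_real (a * b * c) / g"
  have e0: "e \<noteq> 0" using g a_pos b_pos c_pos by (simp add: e_def)
  have qk: "(\<lambda>k. complex_of_real (q ^ k)) \<longlonglongrightarrow> of_real 0"
    using q_pos q_less_1 by (intro tendsto_of_real LIMSEQ_power_zero) auto
  have den: "(\<lambda>k. of_real (q ^ k) + e * of_real z * of_real q ^ n) \<longlonglongrightarrow> of_real 0 + e * of_real z * of_real q ^ n"
    by (intro tendsto_intros qk)
  have den0: "of_real 0 + e * of_real z * of_real q ^ n \<noteq> 0"
    using e0 z_pos q_pos by simp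
  have "(\<lambda>k. Rk g n k * (of_real b * g * (of_real (q ^ k) + of_real (a * c * z) * of_real q ^ n))
      / (of_real (q ^ k) + e * of_real z * of_real q ^ n))
    \<longlonglongrightarrow> thetaq g * (g\<^sup>2) ^ n * (of_real b * g * (of_real 0 + of_real (a * c * z) * of_real q ^ n))
      / (of_real 0 + e * of_real z * of_real q ^ n)"
    by (intro tendsto_intros Suc.IH qk den0)
  also have "thetaq g * (g\<^sup>2) ^ n * (of_real b * g * (of_real 0 + of_real (a * c * z) * of_real q ^ n))
      / (of_real 0 + e * of_real z * of_real q ^ n) = thetaq g * (g\<^sup>2) ^ Suc n"
    using g a_pos b_pos c_pos z_pos q_pos by (simp add: e_def field_simps power2_eq_square)
  finally have lim: "(\<lambda>k. Rk g n k * (of_real b * g * (of_real (q ^ k) + of_real (a * c * z) * of_real q ^ n))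
      / (of_real (q ^ k) + e * of_real z * of_real q ^ n)) \<longlonglongrightarrow> thetaq g * (g\<^sup>2) ^ Suc n" .
  \<comment> \<open>For finitely many k the denominator may be 0, so that the ratio says nothing
    about the next term; the limit ignores these k.\<close>
  have "eventually (\<lambda>k. of_real (q ^ k) + e * of_real z * of_real q ^ n \<noteq> 0) sequentially"
    using tendsto_imp_eventually_ne[OF den den0] .
  then have "eventually (\<lambda>k. Rk g n k * (of_real b * g * (of_real (q ^ k) + of_real (a * c * z) * of_real q ^ n))
      / (of_real (q ^ k) + e * of_real z * of_real q ^ n) = Rk g (Suc n) k) sequentially"
  proof eventually_elim
    case (elim k)
    have *: "of_real (q ^ k) * (1 + e * of_real (z / q ^ k) * of_real q ^ n) = of_real (q ^ k) + e * of_real z * of_real q ^ n"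
      "of_real (q ^ k) * (1 + of_real (a * c * z / q ^ k) * of_real q ^ n) = of_real (q ^ k) + complex_of_real (a * c * z) * of_real q ^ n"
      using q_pos by (simp_all add: field_simps)
    have "Rk g (Suc n) k * (of_real (q ^ k) * (1 + e * of_real (z / q ^ k) * of_real q ^ n))
        = Rk g n k * (of_real b * g * (of_real (q ^ k) * (1 + of_real (a * c * z / q ^ k) * of_real q ^ n)))"
      using arg_cong[OF Rk_Suc[of g n k], of "\<lambda>t. of_real (q ^ k) * t"] unfolding e_def by (simp only: mult_ac)
    then show ?case unfolding * using elim by (simp add: field_simps)
  qed
  then show ?case using lim by (rule Lim_transform_eventually[rotated])
qed

text \<open>Replacing g by its modulus can only enlarge a term: apart from powers only one product
  contains g, and \<open>qp_norm_le\<close> applies to it. For positive g the ratio of consecutive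
  terms lies between b g and g^2, hence is at most max b g, whatever k is.\<close>

lemma Rk_bound:
  assumes g: "g \<noteq> 0" "norm g < 1" and b1: "b < 1"
  obtains C where "0 < C" "\<And>n k. norm (Rk g n k) \<le> C * max b (norm g) ^ n"
proof -
  let ?r = "of_real (norm g) :: complex"
  have r0: "norm g > 0" using g by simp
  let ?\<rho> = "max b (norm g)"
  have le1: "norm (Rk g n k) \<le> norm (Rk ?r n k)" for n k
  proof -
    have "norm (qp (- (of_real (a * b * c) / g * of_real (z / q ^ k) * of_real q ^ n)))
        \<le> norm (qp (- of_real (norm (- (of_real (a * b * c) / g * of_real (z / q ^ k) * of_real q ^ n)))))"
      by (rule qp_norm_le)
    also have "norm (- (of_real (a * b * c) / g * of_real (z / q ^ k) * of_real q ^ n))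
        = a * b * c / norm g * (z / q ^ k) * q ^ n"
      using a_pos b_pos c_pos z_pos q_pos
      by (simp add: norm_mult norm_divide norm_power)
    finally show ?thesis
      unfolding Rk_def using a_pos b_pos
      by (simp add: norm_mult norm_divide norm_power mult_left_mono divide_right_mono)
  qed
  have step: "norm (Rk ?r (Suc n) k) \<le> ?\<rho> * norm (Rk ?r n k)" for n k
  proof -
    define Y where "Y = a * c * z / q ^ k * q ^ n"
    have Y: "Y \<ge> 0" using a_pos c_pos z_pos q_pos by (simp add: Y_def)
    have "Rk ?r (Suc n) k * of_real (1 + b / norm g * Y) = Rk ?r n k * of_real (b * norm g * (1 + Y))"
      using Rk_Suc[of ?r n k] r0 by (simp add: Y_def field_simps)
    then have "norm (Rk ?r (Suc n) k * of_real (1 + b / norm g * Y)) = norm (Rk ?r n k * of_real (b * norm g * (1 + Y)))"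
      by simp
    then have eq: "norm (Rk ?r (Suc n) k) * (1 + b / norm g * Y) = norm (Rk ?r n k) * (b * norm g * (1 + Y))"
      using Y b_pos r0 unfolding norm_mult norm_of_real by simp
    have "b * norm g \<le> ?\<rho> * 1"
      using mult_left_le[of "norm g" b] g b_pos by (simp add: max_def)
    moreover have "b * norm g * Y \<le> ?\<rho> * (b / norm g * Y)"
    proof -
      have "norm g * norm g \<le> norm g * 1" using g by (intro mult_left_mono) auto
      then have "norm g * norm g \<le> ?\<rho>" by simp
      then have "b * Y / norm g * (norm g * norm g) \<le> b * Y / norm g * ?\<rho>"
        using b_pos Y by (intro mult_left_mono) auto
      then show ?thesis using r0 by (simp add: field_simps)
    qed
    ultimately have "b * norm g * (1 + Y) \<le> ?\<rho> * (1 + b / norm g * Y)"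
      by (simp add: distrib_left)
    then have "norm (Rk ?r n k) * (b * norm g * (1 + Y)) \<le> norm (Rk ?r n k) * (?\<rho> * (1 + b / norm g * Y))"
      by (intro mult_left_mono) auto
    then have "norm (Rk ?r (Suc n) k) * (1 + b / norm g * Y) \<le> (?\<rho> * norm (Rk ?r n k)) * (1 + b / norm g * Y)"
      unfolding eq by (simp add: mult_ac)
    moreover have "1 + b / norm g * Y > 0" using Y b_pos r0 by (intro add_pos_nonneg) auto
    ultimately show ?thesis by (rule mult_right_le_imp_le)
  qed
  have "Bseq (Rk ?r 0)"
    using Rk_0_limit[of ?r] g convergent_imp_Bseq convergentI by fastforce
  then obtain C where C: "C > 0" "norm (Rk ?r 0 k) \<le> C" for k
    by (auto simp: Bseq_def)
  have "norm (Rk ?r n k) \<le> C * ?\<rho> ^ n" for n k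
  proof (induction n)
    case 0
    show ?case using C by simp
  next
    case (Suc n)
    have "norm (Rk ?r (Suc n) k) \<le> ?\<rho> * norm (Rk ?r n k)" by (rule step)
    also have "\<dots> \<le> ?\<rho> * (C * ?\<rho> ^ n)"
      using Suc.IH b_pos by (intro mult_left_mono) auto
    finally show ?case by (simp add: mult_ac)
  qed
  then show ?thesis using le1 C(1) that[of C] order_trans by blast
qed

text \<open>Tannery's theorem reduces the behaviour at infinity to the q-Gauss sum with argument \<open>g\<^sup>2\<close>.\<close>
lemma Fn_asymptotics:
  assumes g: "g \<noteq> 0" "norm g < 1" and b1: "b < 1"
  shows "(\<lambda>k. (g / of_real a) ^ k * Fn g (of_real (z / q ^ k)))
    \<longlonglongrightarrow> thetaq g * (qp (of_real a * g) * qp (of_real c * g) / (qp (g\<^sup>2) * qp (of_real (a * c))))"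
proof -
  have bg: "norm (of_real b * g) < 1"
    using g b1 b_pos mult_strict_mono[of b 1 "norm g" 1] by (simp add: norm_mult)
  have g2: "norm (g\<^sup>2) < 1" using g by (simp add: norm_power power_less_one_iff)
  obtain C where C: "0 < C" "\<And>n k. norm (Rk g n k) \<le> C * max b (norm g) ^ n"
    using Rk_bound[OF g b1] by blast
  obtain K where K: "K > 0" "\<And>n. norm (cf g n) \<le> K" using cf_bounded by blast
  have eq: "(g / of_real a) ^ k * Fn g (of_real (z / q ^ k)) = (\<Sum>n. cf g n * Rk g n k)" for k
  proof -
    have "(\<lambda>n. (g / of_real a) ^ k / qp (- of_real (b * c * z / q ^ k)) * tm g n (of_real (z / q ^ k)))
        sums ((g / of_real a) ^ k / qp (- of_real (b * c * z / q ^ k)) * Nsum g (of_real (z / q ^ k)))"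
      unfolding Nsum_def by (intro sums_mult summable_sums tm_summable bg)
    moreover have "(g / of_real a) ^ k / qp (- of_real (b * c * z / q ^ k)) * tm g n (of_real (z / q ^ k)) = cf g n * Rk g n k" for n
      by (simp add: tm_def Rk_def mult_ac)
    moreover have "(g / of_real a) ^ k / qp (- of_real (b * c * z / q ^ k)) * Nsum g (of_real (z / q ^ k))
        = (g / of_real a) ^ k * Fn g (of_real (z / q ^ k))"
      by (simp add: Fn_def mult_ac)
    ultimately show ?thesis by (simp add: sums_iff)
  qed
  have "(\<lambda>k. \<Sum>n. cf g n * Rk g n k) \<longlonglongrightarrow> (\<Sum>n. cf g n * (thetaq g * (g\<^sup>2) ^ n))"
  proof -
    have lim: "((\<lambda>k. cf g n * Rk g n k) \<longlongrightarrow> cf g n * (thetaq g * (g\<^sup>2) ^ n)) sequentially" for n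
      by (intro tendsto_intros Rk_limit g)
    have "norm (cf g n * Rk g n k) \<le> K * (C * max b (norm g) ^ n)" for n k
      unfolding norm_mult using K C by (intro mult_mono) (auto simp: less_imp_le)
    then have "eventually (\<lambda>(n, k). norm (cf g n * Rk g n k) \<le> K * (C * max b (norm g) ^ n)) (at_top \<times>\<^sub>F sequentially)"
      by (intro always_eventually) auto
    from tannerys_theorem[OF lim this] g b1 b_pos show ?thesis
      by (auto intro!: summable_mult summable_geometric)
  qed
  also have "(\<Sum>n. cf g n * (thetaq g * (g\<^sup>2) ^ n))
     = thetaq g * (qp (of_real a * g) * qp (of_real c * g) / (qp (g\<^sup>2) * qp (of_real (a * c))))"
  proof -
    \<comment> \<open>With A = a/g, B = c/g and argument g^2, the parameter A B u of the q-Gauss sum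
      is a c, so its infinite product supplies the denominators (a c;q)_n of
      \<open>cf\<close>.\<close>
    have ac': "of_real a / g * (of_real c / g) * g\<^sup>2 = (of_real (a * c) :: complex)"
      using g by (simp add: field_simps power2_eq_square)
    have "(\<lambda>n. qn (of_real a / g) n * qn (of_real c / g) n / qn (of_real q) n * qp (of_real (a * c) * of_real q ^ n) * (g\<^sup>2) ^ n)
        sums (qp (of_real a / g * g\<^sup>2) * qp (of_real c / g * g\<^sup>2) / qp (g\<^sup>2))"
      using q_Gauss[OF g2, of "of_real a / g" "of_real c / g"] unfolding ac' sums_iff by blast
    from sums_mult[OF this, of "thetaq g / qp (of_real (a * c))"]
    have "(\<lambda>n. thetaq g / qp (of_real (a * c)) * (qn (of_real a / g) n * qn (of_real c / g) n / qn (of_real q) n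
         * qp (of_real (a * c) * of_real q ^ n) * (g\<^sup>2) ^ n))
        sums (thetaq g / qp (of_real (a * c)) * (qp (of_real a * g) * qp (of_real c * g) / qp (g\<^sup>2)))"
      using g by (simp add: power2_eq_square)
    moreover have "thetaq g / qp (of_real (a * c)) * (qn (of_real a / g) n * qn (of_real c / g) n / qn (of_real q) n
         * qp (of_real (a * c) * of_real q ^ n) * (g\<^sup>2) ^ n) = cf g n * (thetaq g * (g\<^sup>2) ^ n)" for n
    proof -
      define P N where "P = qp (of_real (a * c) * of_real q ^ n)" and "N = qn (of_real (a * c)) n"
      have "qp (of_real (a * c)) = N * P" unfolding P_def N_def by (rule qp_split)
      moreover from this have "N \<noteq> 0" "P \<noteq> 0" using qp_ac_nonzero by auto
      ultimately show ?thesis unfolding cf_def P_def[symmetric] N_def[symmetric] by simp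
    qed
    ultimately show ?thesis by (simp add: sums_iff mult_ac)
  qed
  finally show ?thesis unfolding eq .
qed

text \<open>\<open>qp (a g)\<close> and \<open>qp (c g)\<close> vanish at the points 1/(q^k a) and
  1/(q^k c), the theta function at -abcz / q^(k+1) for all integers k. The family belonging to b is
  empty since 1/(q^k b) > 1, and |g| < 1 accounts for the inequalities in
  \<open>Sset\<close>.\<close>

lemma asymptotic_coefficient_eq_0_iff:
  assumes g: "g \<noteq> 0" "norm g < 1" and b1: "b < 1"
  shows "thetaq g * (qp (of_real a * g) * qp (of_real c * g) / (qp (g\<^sup>2) * qp (of_real (a * c)))) = 0
    \<longleftrightarrow> g \<in> of_real ` Sset q z a b c"
proof -
  have g2: "qp (g\<^sup>2) \<noteq> 0" using g by (intro qp_nonzero_small) (simp add: norm_power power_less_one_iff)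
  have q0: "q \<noteq> 0" using q_pos by simp
  define t where "t = a * b * c * z"
  have t: "t > 0" using a_pos b_pos c_pos z_pos by (simp add: t_def)
  have e_zero: "qp (of_real e * g) = 0 \<longleftrightarrow> (\<exists>k. g = of_real (1 / (q ^ k * e)))" if "e > 0" for e
    unfolding qp_eq_0_iff using that g q0 by (auto simp: field_simps)
  \<comment> \<open>One half of the theta product covers k \<ge> 0 with i = k, the other covers k <
    0 with i = -k-1.\<close>
  have "(\<exists>i. - (of_real q * g / of_real t) * of_real q ^ i = 1) \<or> (\<exists>i. - (of_real t / g) * of_real q ^ i = 1)
    \<longleftrightarrow> (\<exists>k::int. g = of_real (- (t / q powi (k + 1))))" (is "?L1 \<or> ?L2 \<longleftrightarrow> ?R")
  proof
    assume "?L1 \<or> ?L2"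
    then show ?R
    proof
      assume ?L1
      then obtain i where i: "- (of_real q * g / of_real t) * of_real q ^ i = 1" by blast
      then have "- (g * of_real q ^ Suc i) = of_real t" using t by (simp add: field_simps)
      then have "g * of_real q ^ Suc i = - of_real t" by (metis minus_minus)
      then have "g = of_real (- (t / q ^ Suc i))"
        using q0 by (simp add: field_simps)
      then have "g = of_real (- (t / q powi (int i + 1)))"
        by (simp add: power_int_add q0)
      then show ?R by blast
    next
      assume ?L2
      then obtain i where i: "- (of_real t / g) * of_real q ^ i = 1" by blast
      then have "g = of_real (- (t * q ^ i))"
        using g by (simp add: field_simps)
      moreover have "q powi ((- int i - 1) + 1) = 1 / q ^ i"
        by (simp add: power_int_minus divide_inverse)
      ultimately have "g = of_real (- (t / q powi ((- int i - 1) + 1)))" by simp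
      then show ?R by blast
    qed
  next
    assume ?R
    then obtain k :: int where k: "g = of_real (- (t / q powi (k + 1)))" by blast
    show "?L1 \<or> ?L2"
    proof (cases "k \<ge> 0")
      case True
      then obtain i where i: "k = int i" using nonneg_int_cases by blast
      have "q powi (k + 1) = q * q ^ i" using i q0 by (simp add: power_int_add)
      then have "- (of_real q * g / of_real t) * of_real q ^ i = 1"
        using k t q0 by simp
      then show ?thesis by blast
    next
      case False
      define i where "i = nat (- k - 1)"
      have "k + 1 = - int i" using False by (simp add: i_def)
      then have "q powi (k + 1) = 1 / q ^ i" by (simp add: power_int_minus divide_inverse)
      then have "- (of_real t / g) * of_real q ^ i = 1" using k t q0 by simp
      then show ?thesis by blast
    qed
  qed
  moreover have "qp (- of_real (q / (b * c * z))) \<noteq> 0" "qp (- of_real (b * c * z)) \<noteq> 0"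
    using q_pos b_pos c_pos z_pos by (intro qp_neg_nonzero; simp)+
  then have "thetaq g = 0 \<longleftrightarrow> qp (- (of_real q * g / of_real t)) = 0 \<or> qp (- (of_real t / g)) = 0"
    unfolding thetaq_def t_def[symmetric] by simp
  ultimately have th: "thetaq g = 0 \<longleftrightarrow> (\<exists>k::int. g = of_real (- (t / q powi (k + 1))))"
    unfolding qp_eq_0_iff by simp
  have "thetaq g * (qp (of_real a * g) * qp (of_real c * g) / (qp (g\<^sup>2) * qp (of_real (a * c)))) = 0
     \<longleftrightarrow> (\<exists>k. g = of_real (1 / (q ^ k * a))) \<or> (\<exists>k. g = of_real (1 / (q ^ k * c)))
       \<or> (\<exists>k::int. g = of_real (- (t / q powi (k + 1))))"
    using g2 qp_ac_nonzero e_zero[OF a_pos] e_zero[OF c_pos] th by auto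
  also have "\<dots> \<longleftrightarrow> g \<in> of_real ` Sset q z a b c"
  proof -
    have nb: "\<not> 1 / (q ^ k * b) < 1" for k
    proof -
      have "q ^ k * b \<le> 1 * 1" using b1 b_pos q_pos q_less_1 by (intro mult_mono power_le_one) auto
      then show ?thesis using b_pos q_pos by (simp add: divide_simps)
    qed
    have pos: "of_real (1 / (q ^ k * e)) = g \<Longrightarrow> e > 0 \<Longrightarrow> 1 / (q ^ k * e) < 1" for k e
    proof -
      assume *: "of_real (1 / (q ^ k * e)) = g" "e > 0"
      have "norm g = 1 / (q ^ k * e)" using * q_pos by (simp add: norm_divide norm_mult norm_power flip: *(1))
      then show ?thesis using g by simp
    qed
    have neg: "of_real (- (t / q powi (k + 1))) = g \<Longrightarrow> t / q powi (k + 1) < 1" for k :: int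
    proof -
      assume *: "of_real (- (t / q powi (k + 1))) = g"
      have "norm g = \<bar>- (t / q powi (k + 1))\<bar>" unfolding *[symmetric] by (rule norm_of_real)
      also have "\<dots> = t / q powi (k + 1)" using t q_pos by simp
      finally show ?thesis using g by simp
    qed
    show ?thesis
      unfolding Sset_def t_def[symmetric] image_Un Un_iff
      using nb pos neg a_pos c_pos by (auto simp: image_iff simp del: of_real_divide of_real_minus) blast+
  qed
  finally show ?thesis .
qed

end

section \<open>The difference equation and the Casoratian\<close>

context q_base
begin

lemma qpoch_inf_eq_Re: "qpoch_inf x q = Re (qp (of_real x))"
  by (simp add: qp_of_real)

lemma qpoch_inf_step: "qpoch_inf x q = (1 - x) * qpoch_inf (q * x) q"
proof -
  have "complex_of_real (qpoch_inf x q) = of_real ((1 - x) * qpoch_inf (q * x) q)"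
    using qp_step[of "of_real x"] by (simp flip: qp_of_real)
  then show ?thesis by (simp only: of_real_eq_iff)
qed

lemma tendsto_qpoch_inf: "(f \<longlongrightarrow> x) F \<Longrightarrow> ((\<lambda>t. qpoch_inf (f t) q) \<longlongrightarrow> qpoch_inf x q) F"
  unfolding qpoch_inf_eq_Re by (intro tendsto_intros tendsto_qp)

end

context big_q_Jacobi
begin

abbreviation "II \<equiv> Iset q z"
abbreviation "Ac \<equiv> Acoeff a b c"
abbreviation "Bc \<equiv> Bcoeff q b c"
abbreviation "pf \<equiv> pfun q a b c"

text \<open>With |x| in place of x one formula covers both weight sequences of the inner product,
  see \<open>wminus_wt\<close> and \<open>wplus_wt\<close>.\<close>

definition wt :: "real \<Rightarrow> real"
  where "wt x = (1 - q) * \<bar>x\<bar> / pf x"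

lemma q_powi_pos [simp]: "0 < q powi k"
  using q_pos by simp

lemma neg_in_I [simp, intro]: "- (q ^ k) \<in> II"
  by (auto simp: Iset_def)

lemma pos_in_I [simp, intro]: "z * q powi k \<in> II"
  by (auto simp: Iset_def)

lemma pos_in_I_power [simp, intro]: "z * q ^ k \<in> II" "z / q ^ k \<in> II"
  using pos_in_I[of "int k"] pos_in_I[of "- int k"]
  by (auto simp: power_int_minus divide_inverse simp del: pos_in_I)

lemma minus_1_in_I [simp]: "- 1 \<in> II"
  using neg_in_I[of 0] by simp

lemma minus_q_in_I [simp]: "- q \<in> II"
  using neg_in_I[of 1] by simp

lemma I_cases:
  assumes "x \<in> II"
  obtains (neg) k :: nat where "x = - (q ^ k)" | (pos) k :: int where "x = z * q powi k"
  using assms by (auto simp: Iset_def)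

lemma I_nonzero: "x \<in> II \<Longrightarrow> x \<noteq> 0"
  using q_pos z_pos by (auto elim!: I_cases)

lemma I_ge: "x \<in> II \<Longrightarrow> - 1 \<le> x"
proof (elim I_cases)
  fix k assume "x = - (q ^ k)"
  then show ?thesis using q_pos q_less_1 power_le_one[of q k] by simp
next
  fix k assume "x = z * q powi k"
  moreover have "0 < z * q powi k" using z_pos by simp
  ultimately show ?thesis by linarith
qed

lemma I_ge': "x \<in> II \<Longrightarrow> x \<noteq> - 1 \<Longrightarrow> - q \<le> x"
proof (elim I_cases)
  fix k assume *: "x = - (q ^ k)" "x \<noteq> - 1"
  then obtain j where "k = Suc j" by (cases k) auto
  then show ?thesis using * q_pos q_less_1 power_le_one[of q j] by simp
next
  fix k assume "x = z * q powi k"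
  moreover have "0 < z * q powi k" using z_pos by simp
  ultimately show ?thesis using q_pos by linarith
qed

lemma I_mult_q: "x \<in> II \<Longrightarrow> q * x \<in> II"
proof (elim I_cases)
  fix k assume "x = - (q ^ k)"
  then show ?thesis using neg_in_I[of "Suc k"] by simp
next
  fix k assume "x = z * q powi k"
  then have "q * x = z * q powi (k + 1)" using q_pos by (simp add: power_int_add)
  then show ?thesis by simp
qed

lemma I_div_q: "x \<in> II \<Longrightarrow> x \<noteq> - 1 \<Longrightarrow> x / q \<in> II"
proof (elim I_cases)
  fix k assume *: "x = - (q ^ k)" "x \<noteq> - 1"
  then obtain j where "k = Suc j" by (cases k) auto
  then have "x / q = - (q ^ j)" using * q_pos by simp
  then show ?thesis by simp
next
  fix k assume "x = z * q powi k"
  then have "x / q = z * q powi (k - 1)" using q_pos by (simp add: power_int_diff)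
  then show ?thesis by simp
qed

lemma arg_lt:
  fixes x s :: real
  assumes "- 1 \<le> x" "0 < s" "s < 1"
  shows "- s * x < 1"
  using mult_left_mono[of "- x" 1 s] assms by simp

lemma pf_pos: assumes "- 1 \<le> x" shows "0 < pf x"
proof -
  have "0 < qpoch_inf (- a * b * x) q" "0 < qpoch_inf (- a * c * x) q"
    "0 < qpoch_inf (- b * c * x) q" "0 < qpoch_inf (- q * x) q"
    using arg_lt[OF assms, of "a * b"] arg_lt[OF assms, of "a * c"] arg_lt[OF assms, of "b * c"]
      arg_lt[OF assms, of q] ab ac bc a_pos b_pos c_pos q_pos q_less_1
    by (simp_all add: qpoch_inf_pos)
  then show ?thesis by (simp add: pfun_def)
qed

lemma wt_pos: "x \<in> II \<Longrightarrow> 0 < wt x"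
  using pf_pos[OF I_ge] I_nonzero q_less_1 by (simp add: wt_def)

lemma one_plus_pos: "- 1 \<le> x \<Longrightarrow> 0 < 1 + a * b * x" "- 1 \<le> x \<Longrightarrow> 0 < 1 + a * c * x"
  "- 1 \<le> x \<Longrightarrow> 0 < 1 + b * c * x" "- 1 \<le> x \<Longrightarrow> 0 < 1 + q * x"
  using arg_lt[of x "a * b"] arg_lt[of x "a * c"] arg_lt[of x "b * c"] arg_lt[of x q]
    ab ac bc a_pos b_pos c_pos q_pos q_less_1 by auto

lemma Ac_eq: "x \<noteq> 0 \<Longrightarrow> Ac x = (1 + a * b * x) * (1 + a * c * x) / (b * c * x\<^sup>2)"
  using a_pos b_pos c_pos by (simp add: Acoeff_def field_simps power2_eq_square)

lemma Bc_eq: "x \<noteq> 0 \<Longrightarrow> Bc x = (q + b * c * x) * (1 + x) / (b * c * x\<^sup>2)"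
  using b_pos c_pos by (simp add: Bcoeff_def field_simps power2_eq_square)

lemma Ac_pos: "x \<in> II \<Longrightarrow> 0 < Ac x"
  using one_plus_pos[OF I_ge] I_nonzero b_pos c_pos by (simp add: Ac_eq)

text \<open>At x = -1 the factor 1 + x vanishes: there the recursion away from the origin stops and
  an equation of its own takes over.\<close>

lemma Bc_pos: "x \<in> II \<Longrightarrow> x \<noteq> - 1 \<Longrightarrow> 0 < Bc x"
proof -
  assume x: "x \<in> II" "x \<noteq> - 1"
  have "- q * (b * c) \<le> x * (b * c)"
    using I_ge'[OF x] b_pos c_pos by (intro mult_right_mono) auto
  moreover have "q * (b * c) < q * 1" using bc q_pos by (intro mult_strict_left_mono) auto
  ultimately have "0 < q + b * c * x" by (simp add: mult_ac)
  moreover have "0 < 1 + x" using I_ge[OF x(1)] x(2) by simp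
  ultimately show ?thesis using I_nonzero[OF x(1)] b_pos c_pos by (simp add: Bc_eq)
qed

lemma pf_q: "- 1 \<le> x \<Longrightarrow> pf (q * x) * ((1 + a * b * x) * (1 + a * c * x)) = pf x * ((1 + b * c * x) * (1 + q * x))"
proof -
  assume x: "- 1 \<le> x"
  have qx: "- 1 \<le> q * x" using x q_pos q_less_1 mult_left_mono[of "- 1" x q] by simp
  have *: "qpoch_inf (- s * t * x) q = (1 + s * t * x) * qpoch_inf (- s * t * (q * x)) q" for s t
    using qpoch_inf_step[of "- s * t * x"] by (simp add: mult_ac)
  have "qpoch_inf (- q * x) q = (1 + q * x) * qpoch_inf (- q * (q * x)) q"
    using *[of q 1] by simp
  have "0 < qpoch_inf (- b * c * (q * x)) q" "0 < qpoch_inf (- q * (q * x)) q"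
    using arg_lt[OF qx, of "b * c"] arg_lt[OF qx, of q] bc b_pos c_pos q_pos q_less_1
    by (simp_all add: qpoch_inf_pos)
  show ?thesis
  proof -
    have gen: "R * S / (T * U) * (u * v) = (u * R) * (v * S) / ((t * T) * (w * U)) * (t * w)"
      if "T \<noteq> 0" "U \<noteq> 0" "t \<noteq> 0" "w \<noteq> 0" for R S T U u v t w :: real
      using that by (simp add: field_simps)
    show ?thesis
      unfolding pfun_def *[of a b] *[of a c] *[of b c] \<open>qpoch_inf (- q * x) q = _\<close>
      using one_plus_pos[OF x] \<open>0 < qpoch_inf (- b * c * (q * x)) q\<close> \<open>0 < qpoch_inf (- q * (q * x)) q\<close>
      by (intro gen) auto
  qed
qed

text \<open>This identity makes the operator symmetric.\<close>
lemma Ac_wt: "x \<in> II \<Longrightarrow> Ac x * wt x = Bc (q * x) * wt (q * x)"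
proof -
  assume x: "x \<in> II"
  note x0 = I_nonzero[OF x] and xm = I_ge[OF x]
  note qx0 = I_nonzero[OF I_mult_q[OF x]] and qxm = I_ge[OF I_mult_q[OF x]]
  have B: "Bc (q * x) = (1 + b * c * x) * (1 + q * x) / (q * (b * c * x\<^sup>2))"
    unfolding Bc_eq[OF qx0] using q_pos b_pos c_pos x0 by (simp add: field_simps power2_eq_square)
  have W: "wt (q * x) = q * ((1 - q) * \<bar>x\<bar>) * ((1 + a * b * x) * (1 + a * c * x)) / (pf x * ((1 + b * c * x) * (1 + q * x)))"
  proof -
    have "wt (q * x) = q * ((1 - q) * \<bar>x\<bar>) / pf (q * x)" using q_pos by (simp add: wt_def abs_mult mult_ac)
    also have "\<dots> = q * ((1 - q) * \<bar>x\<bar>) * ((1 + a * b * x) * (1 + a * c * x)) / (pf (q * x) * ((1 + a * b * x) * (1 + a * c * x)))"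
      using one_plus_pos(1,2)[OF xm] by simp
    finally show ?thesis unfolding pf_q[OF xm] .
  qed
  have gen: "u * v / d * (X / P) = w * y / (q * d) * (q * X * (u * v) / (P * (w * y)))"
    if "w \<noteq> 0" "y \<noteq> 0" for u v d X P w y :: real
    using that q_pos by (simp add: field_simps)
  show ?thesis
    unfolding Ac_eq[OF x0] wt_def[of x] B W using one_plus_pos(3,4)[OF xm] by (intro gen) auto
qed

lemma pf_tendsto_1: "(s \<longlongrightarrow> 0) F \<Longrightarrow> ((\<lambda>k. pf (s k)) \<longlongrightarrow> 1) F"
proof -
  assume s: "(s \<longlongrightarrow> 0) F"
  have q0: "qpoch_inf 0 q = 1" by (simp add: qpoch_inf_eq_Re)
  have "((\<lambda>k. pf (s k)) \<longlongrightarrow> qpoch_inf (- a * b * 0) q * qpoch_inf (- a * c * 0) q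
      / (qpoch_inf (- b * c * 0) q * qpoch_inf (- q * 0) q)) F"
    unfolding pfun_def by (intro tendsto_intros tendsto_qpoch_inf s) (simp add: q0)
  then show ?thesis by (simp add: q0)
qed

section \<open>The eigenvalue equation, Cauchy data at the origin and the Casoratian\<close>

definition eqn :: "complex \<Rightarrow> (real \<Rightarrow> complex) \<Rightarrow> real \<Rightarrow> bool"
  where "eqn lam f x \<longleftrightarrow> of_real (Ac x) * (f (q * x) - f x) + of_real (Bc x) * (f (x / q) - f x) = lam * f x"

definition solves :: "complex \<Rightarrow> (real \<Rightarrow> complex) \<Rightarrow> bool"
  where "solves lam f \<longleftrightarrow> (\<forall>x\<in>II - {- 1}. eqn lam f x)"

definition bdry :: "complex \<Rightarrow> (real \<Rightarrow> complex) \<Rightarrow> bool"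
  where "bdry lam f \<longleftrightarrow> of_real (Ac (- 1)) * (f (- q) - f (- 1)) = lam * f (- 1)"

text \<open>The pair (l, m) acts as Cauchy data at the origin. That both half-lines share it is
  exactly the gluing condition of \<open>Ddom\<close>.\<close>

definition data :: "(real \<Rightarrow> complex) \<Rightarrow> complex \<Rightarrow> complex \<Rightarrow> bool"
  where "data f l m \<longleftrightarrow> (\<lambda>k. f (z * q ^ k)) \<longlonglongrightarrow> l \<and> (\<lambda>k. f (- (q ^ k))) \<longlonglongrightarrow> l
    \<and> (\<lambda>k. Dq q f (z * q ^ k)) \<longlonglongrightarrow> m \<and> (\<lambda>k. Dq q f (- (q ^ k))) \<longlonglongrightarrow> m"

text \<open>The factor \<open>Ac x * wt x\<close> makes this constant on each half-line for two
  solutions. The sign makes the two constants agree: near 0 the difference is (1-q) x times a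
  determinant of values and q-derivatives, whereas \<open>wt x\<close> carries |x|.\<close>

definition Cas :: "(real \<Rightarrow> complex) \<Rightarrow> (real \<Rightarrow> complex) \<Rightarrow> real \<Rightarrow> complex"
  where "Cas f g x = of_real (sgn x * (Ac x * wt x)) * (f (q * x) * g x - f x * g (q * x))"

lemma Dq_lin: "Dq q (\<lambda>x. s * f x + t * g x) x = s * Dq q f x + t * Dq q g x"
  by (simp add: Dq_def add_divide_distrib diff_divide_distrib algebra_simps)

lemma solves_lin: "solves lam f \<Longrightarrow> solves lam g \<Longrightarrow> solves lam (\<lambda>x. s * f x + t * g x)"
  unfolding solves_def eqn_def
proof
  fix x
  let ?E = "\<lambda>f. of_real (Ac x) * (f (q * x) - f x) + of_real (Bc x) * (f (x / q) - f x)"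
  assume "\<forall>x\<in>II - {- 1}. of_real (Ac x) * (f (q * x) - f x) + of_real (Bc x) * (f (x / q) - f x) = lam * f x"
    "\<forall>x\<in>II - {- 1}. of_real (Ac x) * (g (q * x) - g x) + of_real (Bc x) * (g (x / q) - g x) = lam * g x"
    "x \<in> II - {- 1}"
  then have "?E f = lam * f x" "?E g = lam * g x" by blast+
  then have "s * ?E f + t * ?E g = s * (lam * f x) + t * (lam * g x)" by simp
  then show "of_real (Ac x) * ((s * f (q * x) + t * g (q * x)) - (s * f x + t * g x))
      + of_real (Bc x) * ((s * f (x / q) + t * g (x / q)) - (s * f x + t * g x)) = lam * (s * f x + t * g x)"
    by (simp add: algebra_simps)
qed

lemma data_lin: "data f l m \<Longrightarrow> data g l' m' \<Longrightarrow> data (\<lambda>x. s * f x + t * g x) (s * l + t * l') (s * m + t * m')"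
  unfolding data_def Dq_lin by (auto intro!: tendsto_intros)

lemma data_unique: "data f l m \<Longrightarrow> data f l' m' \<Longrightarrow> l = l' \<and> m = m'"
  unfolding data_def by (meson LIMSEQ_unique)

text \<open>Eliminating \<open>lam\<close> from the two equations relates A times the pair (q x, x)
  to B times the pair (x, x/q), and \<open>Ac_wt\<close> identifies B times the weight at x with A
  times the weight at x/q.\<close>

lemma Cas_step:
  assumes "solves lam f" "solves lam g" "x \<in> II" "x \<noteq> - 1"
  shows "Cas f g (x / q) = Cas f g x"
proof -
  have "of_real (Ac x) * (f (q * x) - f x) + of_real (Bc x) * (f (x / q) - f x) = lam * f x"
    "of_real (Ac x) * (g (q * x) - g x) + of_real (Bc x) * (g (x / q) - g x) = lam * g x"
    using assms by (auto simp: solves_def eqn_def)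
  then have E: "of_real (Ac x) * (f (q * x) * g x - f x * g (q * x)) = of_real (Bc x) * (f x * g (x / q) - f (x / q) * g x)"
    by algebra
  have *: "of_real (sgn x * (Ac x * wt x)) * (f (q * x) * g x - f x * g (q * x))
      = of_real (sgn x * (Bc x * wt x)) * (f x * g (x / q) - f (x / q) * g x)"
    using arg_cong[OF E, of "\<lambda>t. of_real (sgn x * wt x) * t"] by (simp only: of_real_mult mult_ac)
  have "Ac (x / q) * wt (x / q) = Bc x * wt x"
    using Ac_wt[OF I_div_q[OF assms(3,4)]] q_pos by simp
  moreover have "sgn (x / q) = sgn x" using q_pos by (simp add: sgn_divide)
  moreover have "q * (x / q) = x" using q_pos by simp
  ultimately show ?thesis unfolding Cas_def * by simp
qed

lemma Cas_const_neg:
  assumes "solves lam f" "solves lam g"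
  shows "Cas f g (- (q ^ k)) = Cas f g (- 1)"
proof (induction k)
  case (Suc k)
  have "- (q ^ Suc k) \<noteq> - 1"
    using q_pos q_less_1 power_Suc_less_one[of q k] by simp
  from Cas_step[OF assms neg_in_I this] have "Cas f g (- (q ^ Suc k)) = Cas f g (- (q ^ k))"
    using q_pos by simp
  then show ?case using Suc by simp
qed simp

lemma pos_ne_minus_1: "z * q powi k \<noteq> - 1"
proof -
  have "0 < z * q powi k" using z_pos by simp
  then show ?thesis by linarith
qed

lemma powi_step: "z * q powi k / q = z * q powi (k - 1)" "q * (z * q powi k) = z * q powi (k + 1)"
  using q_pos by (simp_all add: power_int_diff power_int_add)

lemma Cas_const_pos:
  assumes "solves lam f" "solves lam g"
  shows "Cas f g (z * q powi k) = Cas f g z"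
proof (induction k rule: int_induct[where k = 0])
  case (step1 i)
  have "Cas f g (z * q powi (i + 1)) = Cas f g (z * q powi i)"
    using Cas_step[OF assms pos_in_I pos_ne_minus_1, of "i + 1"] by (simp add: powi_step)
  then show ?case using step1 by simp
next
  case (step2 i)
  have "Cas f g (z * q powi i) = Cas f g (z * q powi (i - 1))"
    using Cas_step[OF assms pos_in_I pos_ne_minus_1, of i] by (simp add: powi_step)
  then show ?case using step2 by simp
qed simp

text \<open>The limit at the origin of sgn x Ac(x) wt(x) (1-q) x, the factor between Casoratian and
  determinant of the data.\<close>

definition \<kappa>0 :: complex
  where "\<kappa>0 = of_real ((1 - q)\<^sup>2 / (b * c))"

lemma \<kappa>0_nonzero [simp]: "\<kappa>0 \<noteq> 0"
  using q_less_1 b_pos c_pos by (simp add: \<kappa>0_def)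

lemma Cas_Dq:
  assumes "x \<in> II"
  shows "Cas f g x = \<kappa>0 * of_real ((1 + a * b * x) * (1 + a * c * x) / pf x) * (f x * Dq q g x - g x * Dq q f x)"
proof -
  note x0 = I_nonzero[OF assms]
  have x1: "complex_of_real ((1 - q) * x) \<noteq> 0" using x0 q_less_1 by simp
  have D: "h (q * x) = h x - of_real ((1 - q) * x) * Dq q h x" for h
    using x1 unfolding Dq_def by (simp del: of_real_mult)
  have "f (q * x) * g x - f x * g (q * x) = of_real ((1 - q) * x) * (f x * Dq q g x - g x * Dq q f x)"
    unfolding D[of f] D[of g] by (simp add: algebra_simps)
  then have "Cas f g x = of_real (sgn x * (Ac x * wt x) * ((1 - q) * x)) * (f x * Dq q g x - g x * Dq q f x)"
    unfolding Cas_def by (simp only: of_real_mult mult.assoc)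
  also have "sgn x * (Ac x * wt x) * ((1 - q) * x) = (1 - q)\<^sup>2 / (b * c) * ((1 + a * b * x) * (1 + a * c * x) / pf x)"
    unfolding Ac_eq[OF x0] wt_def using x0 b_pos c_pos pf_pos[OF I_ge[OF assms]]
    by (cases "x > 0") (simp_all add: field_simps power2_eq_square)
  finally show ?thesis unfolding \<kappa>0_def by (simp only: of_real_mult)
qed

lemma Cas_tendsto:
  assumes s: "s \<longlonglongrightarrow> 0" "\<And>k. s k \<in> II"
    and "(\<lambda>k. f (s k)) \<longlonglongrightarrow> l" "(\<lambda>k. Dq q f (s k)) \<longlonglongrightarrow> m"
    and "(\<lambda>k. g (s k)) \<longlonglongrightarrow> l'" "(\<lambda>k. Dq q g (s k)) \<longlonglongrightarrow> m'"
  shows "(\<lambda>k. Cas f g (s k)) \<longlonglongrightarrow> \<kappa>0 * (l * m' - m * l')"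
proof -
  have "(\<lambda>k. \<kappa>0 * of_real ((1 + a * b * s k) * (1 + a * c * s k) / pf (s k)) * (f (s k) * Dq q g (s k) - g (s k) * Dq q f (s k)))
    \<longlonglongrightarrow> \<kappa>0 * of_real ((1 + a * b * 0) * (1 + a * c * 0) / 1) * (l * m' - l' * m)"
    by (intro tendsto_intros pf_tendsto_1 assms) simp
  then show ?thesis unfolding Cas_Dq[OF s(2)] by (simp add: mult_ac)
qed

lemma q_power_tendsto_0: "(\<lambda>k. z * q ^ k) \<longlonglongrightarrow> 0" "(\<lambda>k. - (q ^ k)) \<longlonglongrightarrow> 0"
proof -
  have "(\<lambda>k. q ^ k) \<longlonglongrightarrow> 0" using q_pos q_less_1 by (intro LIMSEQ_power_zero) simp
  then show "(\<lambda>k. z * q ^ k) \<longlonglongrightarrow> 0" "(\<lambda>k. - (q ^ k)) \<longlonglongrightarrow> 0"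
    using tendsto_mult_right_zero tendsto_minus by fastforce+
qed

text \<open>Constancy on each half-line, combined with the limit at the origin computed from the
  data. As both half-lines have the same limits there, one constant serves for all of
  \<open>II\<close>; this is how the gluing enters the proof.\<close>

lemma Cas_eq:
  assumes "solves lam f" "solves lam g" "data f l m" "data g l' m'" "x \<in> II"
  shows "Cas f g x = \<kappa>0 * (l * m' - m * l')"
  using assms(5)
proof (cases rule: I_cases)
  case (neg k)
  have "(\<lambda>k. Cas f g (- (q ^ k))) \<longlonglongrightarrow> \<kappa>0 * (l * m' - m * l')"
    using assms(3,4) by (intro Cas_tendsto q_power_tendsto_0) (auto simp: data_def)
  then have "Cas f g (- 1) = \<kappa>0 * (l * m' - m * l')"
    unfolding Cas_const_neg[OF assms(1,2)] LIMSEQ_const_iff .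
  then show ?thesis using neg Cas_const_neg[OF assms(1,2)] by simp
next
  case (pos k)
  have "(\<lambda>k. Cas f g (z * q ^ k)) \<longlonglongrightarrow> \<kappa>0 * (l * m' - m * l')"
    using assms(3,4) by (intro Cas_tendsto q_power_tendsto_0) (auto simp: data_def)
  moreover have "Cas f g (z * q ^ k) = Cas f g z" for k
    using Cas_const_pos[OF assms(1,2), of "int k"] by simp
  ultimately have "Cas f g z = \<kappa>0 * (l * m' - m * l')"
    by (simp only: LIMSEQ_const_iff)
  then show ?thesis using pos Cas_const_pos[OF assms(1,2)] by simp
qed

lemma Cas_0D: "x \<in> II \<Longrightarrow> Cas f g x = 0 \<Longrightarrow> f (q * x) * g x = f x * g (q * x)"
  using Ac_pos[of x] wt_pos[of x] I_nonzero[of x] by (simp add: Cas_def sgn_eq_0_iff)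

text \<open>With G the ordinary difference quotient at 0, the q-difference quotient equals (G(s) - q
  G(q s)) / (1 - q), and both values of G tend to D. Differentiability at the single point 0 is
  enough.\<close>

lemma tendsto_Dq:
  fixes h :: "complex \<Rightarrow> complex"
  assumes h: "(h has_field_derivative D) (at 0)"
    and s: "s \<longlonglongrightarrow> 0" "\<And>k. s k \<noteq> (0 :: real)"
  shows "(\<lambda>k. (h (of_real (s k)) - h (of_real (q * s k))) / of_real ((1 - q) * s k)) \<longlonglongrightarrow> D"
proof -
  define G where "G x = (h x - h 0) / x" for x :: complex
  have G: "(G \<longlongrightarrow> D) (at 0)" using h by (simp add: has_field_derivative_iff G_def[abs_def])
  have 1: "filterlim (\<lambda>k. complex_of_real (s k)) (at 0) sequentially"
    using s tendsto_of_real[OF s(1)] by (simp add: filterlim_at)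
  have 2: "filterlim (\<lambda>k. complex_of_real (q * s k)) (at 0) sequentially"
    using s q_pos tendsto_of_real[OF s(1), where 'a = complex]
    by (simp add: filterlim_at)
  have "(\<lambda>k. (G (of_real (s k)) - of_real q * G (of_real (q * s k))) / of_real (1 - q)) \<longlonglongrightarrow> (D - of_real q * D) / of_real (1 - q)"
    using q_less_1 by (intro tendsto_intros filterlim_compose[OF G] 1 2) simp
  also have "(D - of_real q * D) / of_real (1 - q) = D"
  proof -
    have "D - of_real q * D = D * of_real (1 - q)" by (simp add: algebra_simps)
    then show ?thesis using q_less_1 by (simp del: of_real_diff)
  qed
  also have "(\<lambda>k. (G (of_real (s k)) - of_real q * G (of_real (q * s k))) / of_real (1 - q))
    = (\<lambda>k. (h (of_real (s k)) - h (of_real (q * s k))) / of_real ((1 - q) * s k))"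
  proof
    fix k
    have "((H1 - H0) / u - p * ((H2 - H0) / (p * u))) / w = (H1 - H2) / (w * u)"
      if "u \<noteq> 0" "p \<noteq> 0" "w \<noteq> 0" for H0 H1 H2 u p w :: complex
      using that by (simp add: field_simps)
    from this[of "of_real (s k)" "of_real q" "of_real (1 - q)"]
    show "(G (of_real (s k)) - of_real q * G (of_real (q * s k))) / of_real (1 - q)
      = (h (of_real (s k)) - h (of_real (q * s k))) / of_real ((1 - q) * s k)"
      unfolding G_def of_real_mult using s(2)[of k] q_pos q_less_1 by simp
  qed
  finally show ?thesis .
qed

lemma data_of_deriv:
  assumes h: "(h has_field_derivative D) (at 0)" and "0 < \<delta>"
    and f: "\<And>x. x \<in> II \<Longrightarrow> \<bar>x\<bar> < \<delta> \<Longrightarrow> f x = h (of_real x)"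
  shows "data f (h 0) D"
proof -
  have ev: "eventually (\<lambda>k. \<bar>s k\<bar> < \<delta>) sequentially" if "s \<longlonglongrightarrow> 0" for s
    using order_tendstoD(2)[OF tendsto_rabs[OF that], of \<delta>] assms(2) by simp
  have key: "(\<lambda>k. f (s k)) \<longlonglongrightarrow> h 0 \<and> (\<lambda>k. Dq q f (s k)) \<longlonglongrightarrow> D" if s: "s \<longlonglongrightarrow> 0" "\<And>k. s k \<in> II" for s
  proof
    have "isCont h 0" using h by (rule DERIV_isCont)
    then have "(\<lambda>k. h (of_real (s k))) \<longlonglongrightarrow> h 0"
      using isCont_tendsto_compose tendsto_of_real[OF s(1)] by fastforce
    moreover have "eventually (\<lambda>k. h (of_real (s k)) = f (s k)) sequentially"
      using ev[OF s(1)] by eventually_elim (simp add: f s(2))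
    ultimately show "(\<lambda>k. f (s k)) \<longlonglongrightarrow> h 0" by (rule Lim_transform_eventually)
    have "(\<lambda>k. (h (of_real (s k)) - h (of_real (q * s k))) / of_real ((1 - q) * s k)) \<longlonglongrightarrow> D"
      using I_nonzero[OF s(2)] by (intro tendsto_Dq h s)
    moreover have "eventually (\<lambda>k. (h (of_real (s k)) - h (of_real (q * s k))) / of_real ((1 - q) * s k) = Dq q f (s k)) sequentially"
      using ev[OF s(1)]
    proof eventually_elim
      case (elim k)
      have "\<bar>q * s k\<bar> \<le> 1 * \<bar>s k\<bar>" unfolding abs_mult using q_pos q_less_1 by (intro mult_right_mono) auto
      then show ?case using elim by (simp add: f s(2) I_mult_q Dq_def)
    qed
    ultimately show "(\<lambda>k. Dq q f (s k)) \<longlonglongrightarrow> D" by (rule Lim_transform_eventually)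
  qed
  show ?thesis
    unfolding data_def using key[of "\<lambda>k. z * q ^ k"] key[of "\<lambda>k. - (q ^ k)"] q_power_tendsto_0 by simp
qed

text \<open>Dividing \<open>Nsum_equation\<close> by (-bcx;q)_inf and b c x^2 gives the eigenvalue
  equation, because this product changes by one linear factor under x -> q x. At x = -1 the factor 1
  + x removes the term at x/q, so the boundary equation comes out of the same identity.\<close>

lemma Fn_solves:
  assumes g: "g \<noteq> 0" "norm (of_real b * g) < 1"
  shows "solves (mu a g) (\<lambda>x. Fn g (of_real x))" "bdry (mu a g) (\<lambda>x. Fn g (of_real x))"
    "\<exists>l m. data (\<lambda>x. Fn g (of_real x)) l m"
proof -
  let ?A = "complex_of_real a" and ?B = "complex_of_real b" and ?C = "complex_of_real c" and ?q = "complex_of_real q"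
  have D0: "qp (- of_real (b * c) * of_real x) \<noteq> 0" if "- 1 \<le> x" for x
  proof -
    have "- (b * c) * x < 1" using arg_lt[OF that, of "b * c"] b_pos c_pos bc by simp
    then have "qp (of_real (- (b * c) * x)) \<noteq> 0"
      unfolding qp_of_real using qpoch_inf_pos[of "- (b * c) * x"] by simp
    then show ?thesis by simp
  qed
  have Dstep: "qp (- of_real (b * c) * of_real x) = (1 + of_real (b * c) * of_real x) * qp (- of_real (b * c) * of_real (q * x))" for x
    using qp_step[of "- of_real (b * c) * of_real x"] by (simp add: mult_ac)
  have N: "Nsum g (of_real x) = Fn g (of_real x) * qp (- of_real (b * c) * of_real x)" if "- 1 \<le> x" for x
    using D0[OF that] by (simp add: Fn_def)
  have key: "(1 + of_real (a * b) * of_real x) * (1 + of_real (a * c) * of_real x) * (Fn g (of_real (q * x)) - Fn g (of_real x))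
      + (of_real q + of_real (b * c) * of_real x) * (1 + of_real x) * (Fn g (of_real (x / q)) - Fn g (of_real x))
     = mu a g * of_real (b * c) * (of_real x)\<^sup>2 * Fn g (of_real x)"
    if x: "x \<in> II" and xq: "x \<noteq> - 1 \<Longrightarrow> - 1 \<le> x / q" for x
  proof -
    note xm = I_ge[OF x] and qxm = I_ge[OF I_mult_q[OF x]]
    define P where "P = qp (- of_real (b * c) * of_real x)"
    have P0: "P \<noteq> 0" using D0[OF xm] by (simp add: P_def)
    have n1: "Nsum g (of_real x) = Fn g (of_real x) * P" unfolding P_def by (rule N[OF xm])
    have n2: "(1 + of_real (b * c) * of_real x) * Nsum g (of_real (q * x)) = Fn g (of_real (q * x)) * P"
      unfolding N[OF qxm] P_def Dstep[of x] by simp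
    have n3: "(1 + of_real x) * (of_real q * Nsum g (of_real (x / q)))
      = (1 + of_real x) * ((of_real q + of_real (b * c) * of_real x) * Fn g (of_real (x / q)) * P)"
    proof (cases "x = - 1")
      case False
      have "qp (- of_real (b * c) * of_real (x / q)) = (1 + of_real (b * c) * of_real (x / q)) * P"
        using Dstep[of "x / q"] q_pos by (simp add: P_def)
      then have "of_real q * Nsum g (of_real (x / q)) = (of_real q * (1 + of_real (b * c) * of_real (x / q))) * Fn g (of_real (x / q)) * P"
        unfolding N[OF xq[OF False]] by (simp add: mult_ac)
      also have "of_real q * (1 + of_real (b * c) * of_real (x / q)) = of_real q + of_real (b * c) * complex_of_real x"
        using q_pos by (simp add: field_simps)
      finally show ?thesis by simp
    qed simp
    have "(1 + of_real (a * b) * of_real x) * (1 + of_real (a * c) * of_real x) *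
           ((1 + of_real (b * c) * of_real x) * Nsum g (of_real (q * x)) - Nsum g (of_real x))
       + ((1 + of_real x) * (of_real q * Nsum g (of_real (x / q))) - (1 + of_real x) * (of_real q + of_real (b * c) * of_real x) * Nsum g (of_real x))
       = mu a g * of_real (b * c) * (of_real x)\<^sup>2 * Nsum g (of_real x)"
      using Nsum_equation[OF g, of "of_real x"] by (simp add: right_diff_distrib mult.assoc)
    then have "P * ((1 + of_real (a * b) * of_real x) * (1 + of_real (a * c) * of_real x) * (Fn g (of_real (q * x)) - Fn g (of_real x))
      + (of_real q + of_real (b * c) * of_real x) * (1 + of_real x) * (Fn g (of_real (x / q)) - Fn g (of_real x)))
      = P * (mu a g * of_real (b * c) * (of_real x)\<^sup>2 * Fn g (of_real x))"
      unfolding n2 n3 unfolding n1 by (simp add: algebra_simps)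
    then show ?thesis using P0 by simp
  qed
  have bc0: "complex_of_real (b * c) \<noteq> 0" using b_pos c_pos by simp
  show "solves (mu a g) (\<lambda>x. Fn g (of_real x))"
    unfolding solves_def
  proof
    fix x assume x: "x \<in> II - {- 1}"
    then have x0: "x \<noteq> 0" using I_nonzero by blast
    have cA: "of_real (Ac x) = (1 + of_real (a * b) * of_real x) * (1 + of_real (a * c) * of_real x) / (of_real (b * c) * (of_real x)\<^sup>2 :: complex)"
      unfolding Ac_eq[OF x0] by simp
    have cB: "of_real (Bc x) = (of_real q + of_real (b * c) * of_real x) * (1 + of_real x) / (of_real (b * c) * (of_real x)\<^sup>2 :: complex)"
      unfolding Bc_eq[OF x0] by simp
    define d where "d = of_real (b * c) * (complex_of_real x)\<^sup>2"
    have d0: "d \<noteq> 0" using x0 bc0 by (simp add: d_def)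
    have "((1 + of_real (a * b) * of_real x) * (1 + of_real (a * c) * of_real x) * (Fn g (of_real (q * x)) - Fn g (of_real x))
      + (of_real q + of_real (b * c) * of_real x) * (1 + of_real x) * (Fn g (of_real (x / q)) - Fn g (of_real x))) / d
     = mu a g * Fn g (of_real x)"
      using key[of x] I_ge[OF I_div_q, of x] x d0 by (simp add: d_def mult_ac)
    then show "eqn (mu a g) (\<lambda>x. Fn g (of_real x)) x"
      unfolding eqn_def cA cB d_def[symmetric] by (simp add: add_divide_distrib)
  qed
  show "bdry (mu a g) (\<lambda>x. Fn g (of_real x))"
  proof -
    have cA: "of_real (Ac (- 1)) = (1 - of_real (a * b)) * (1 - of_real (a * c)) / (of_real (b * c) :: complex)"
      by (simp add: Ac_eq)
    show ?thesis
      using key[of "- 1"] bc0 unfolding bdry_def cA by (simp add: field_simps)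
  qed
  obtain D where D: "(Fn g has_field_derivative D) (at 0)" using Fn_deriv_0[OF g(2)] by blast
  show "\<exists>l m. data (\<lambda>x. Fn g (of_real x)) l m"
    using data_of_deriv[OF D, of 1 "\<lambda>x. Fn g (of_real x)"] by auto
qed

end

section \<open>Power series solutions at the origin\<close>

lemma three_term_exists:
  fixes E H :: "nat \<Rightarrow> complex"
  shows "\<exists>u. u 0 = s \<and> u (Suc 0) = t \<and> (\<forall>n. u (Suc (Suc n)) = E n * u (Suc n) + H n * u n)"
proof -
  define v where "v = rec_nat (s, t) (\<lambda>n p. (snd p, E n * snd p + H n * fst p))"
  have "fst (v (Suc n)) = snd (v n)" for n by (simp add: v_def)
  moreover have "snd (v (Suc n)) = E n * snd (v n) + H n * fst (v n)" for n by (simp add: v_def)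
  ultimately show ?thesis
    by (intro exI[of _ "\<lambda>n. fst (v n)"]) (simp add: v_def)
qed

text \<open>Induction on two consecutive terms; the base M = 1 + 2 K satisfies K M + K \<le>
  M^2.\<close>

lemma three_term_bound:
  fixes E H :: "nat \<Rightarrow> complex"
  assumes "\<And>n. u (Suc (Suc n)) = E n * u (Suc n) + H n * u n"
    and "\<And>n. norm (E n) \<le> K" "\<And>n. norm (H n) \<le> K" "0 \<le> K"
  shows "norm (u n) \<le> (norm (u 0) + norm (u 1)) * (1 + 2 * K) ^ n"
proof -
  define C M where "C = norm (u 0) + norm (u 1)" and "M = 1 + 2 * K"
  have C: "C \<ge> 0" by (simp add: C_def)
  have M: "M \<ge> 1" using assms(4) by (simp add: M_def)
  have "norm (u n) \<le> C * M ^ n \<and> norm (u (Suc n)) \<le> C * M ^ Suc n"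
  proof (induction n)
    case 0
    have "C \<le> C * M" using mult_left_mono[OF M C] by simp
    moreover have "norm (u 0) \<le> C" "norm (u (Suc 0)) \<le> C" by (simp_all add: C_def)
    ultimately show ?case by simp
  next
    case (Suc n)
    have "norm (u (Suc (Suc n))) \<le> norm (E n) * norm (u (Suc n)) + norm (H n) * norm (u n)"
      unfolding assms(1) by (metis norm_mult norm_triangle_ineq)
    also have "\<dots> \<le> K * (C * M ^ Suc n) + K * (C * M ^ n)"
      using Suc assms by (intro add_mono mult_mono) auto
    also have "\<dots> = C * M ^ n * (K * M + K)" by (simp add: algebra_simps)
    also have "\<dots> \<le> C * M ^ n * (M * M)"
      using C M assms(4) by (intro mult_left_mono) (auto simp: M_def algebra_simps)
    finally show ?case using Suc by (simp add: algebra_simps)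
  qed
  then show ?thesis by (simp add: C_def M_def)
qed

lemma sums_quadratic_mult:
  fixes U :: "nat \<Rightarrow> complex"
  assumes "(\<lambda>n. U n * x ^ n) sums s"
  shows "(\<lambda>n. (p0 * U n + (if n \<ge> 1 then p1 * U (n - 1) else 0) + (if n \<ge> 2 then p2 * U (n - 2) else 0)) * x ^ n)
    sums ((p0 + p1 * x + p2 * x\<^sup>2) * s)"
proof -
  have 1: "(\<lambda>n. (if n \<ge> 1 then p1 * U (n - 1) else 0) * x ^ n) sums (p1 * x * s)"
  proof -
    have "(\<lambda>n. p1 * x * (U n * x ^ n)) sums (p1 * x * s)" by (rule sums_mult[OF assms])
    then have "(\<lambda>n. (if Suc n \<ge> 1 then p1 * U (Suc n - 1) else 0) * x ^ Suc n) sums (p1 * x * s)"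
      by (simp add: mult_ac)
    then show ?thesis by (subst (asm) sums_Suc_iff) simp
  qed
  have 2: "(\<lambda>n. (if n \<ge> 2 then p2 * U (n - 2) else 0) * x ^ n) sums (p2 * x\<^sup>2 * s)"
  proof -
    have "(\<lambda>n. p2 * x\<^sup>2 * (U n * x ^ n)) sums (p2 * x\<^sup>2 * s)" by (rule sums_mult[OF assms])
    then have "(\<lambda>n. (if Suc (Suc n) \<ge> 2 then p2 * U (Suc (Suc n) - 2) else 0) * x ^ Suc (Suc n)) sums (p2 * x\<^sup>2 * s)"
      by (simp add: mult_ac power2_eq_square)
    then show ?thesis by (subst (asm) sums_Suc_iff, subst (asm) sums_Suc_iff) simp
  qed
  have "(\<lambda>n. p0 * (U n * x ^ n) + (if n \<ge> 1 then p1 * U (n - 1) else 0) * x ^ n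
      + (if n \<ge> 2 then p2 * U (n - 2) else 0) * x ^ n) sums (p0 * s + p1 * x * s + p2 * x\<^sup>2 * s)"
    by (intro sums_add sums_mult assms 1 2)
  then show ?thesis by (simp add: algebra_simps)
qed

text \<open>Comparison of coefficients when the unknown series occurs at s x, x/s and x with
  quadratic coefficients. The series at x/s converges worst, hence the condition |x| M < |s|. It is
  applied with s = q, at the origin in the variable x and at infinity in 1/x.\<close>

lemma frobenius_series:
  fixes u :: "nat \<Rightarrow> complex" and s :: complex
  assumes bound: "\<And>n. norm (u n) \<le> C * M ^ n" and M: "0 \<le> M" and s: "norm s < 1" "s \<noteq> 0"
    and c0: "(A0 + B0 + E0) * u 0 = 0"
    and c1: "(A0 * s + B0 / s + E0) * u 1 + (A1 + B1 + E1) * u 0 = 0"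
    and c2: "\<And>n. (A0 * s ^ (n + 2) + B0 / s ^ (n + 2) + E0) * u (n + 2)
      + (A1 * s ^ (n + 1) + B1 / s ^ (n + 1) + E1) * u (n + 1) + (A2 * s ^ n + B2 / s ^ n + E2) * u n = 0"
    and x: "norm x * M < norm s"
  defines "U \<equiv> \<lambda>x. \<Sum>n. u n * x ^ n"
  shows "(A0 + A1 * x + A2 * x\<^sup>2) * U (s * x) + (B0 + B1 * x + B2 * x\<^sup>2) * U (x / s) + (E0 + E1 * x + E2 * x\<^sup>2) * U x = 0"
proof -
  have U: "(\<lambda>n. u n * y ^ n) sums U y" if "norm y * M < 1" for y
  proof -
    have "summable (\<lambda>n. u n * y ^ n)"
    proof (rule summable_comparison_test')
      show "summable (\<lambda>n. C * (norm y * M) ^ n)"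
        using that M by (intro summable_mult summable_geometric) auto
      fix n :: nat
      have "norm (u n) * norm y ^ n \<le> C * M ^ n * norm y ^ n"
        by (intro mult_right_mono bound) auto
      then show "norm (u n * y ^ n) \<le> C * (norm y * M) ^ n"
        by (simp add: norm_mult norm_power power_mult_distrib mult_ac)
    qed
    then show ?thesis unfolding U_def by (rule summable_sums)
  qed
  have x1: "norm x * M < 1" using x s by linarith
  have x2: "norm (s * x) * M < 1"
  proof -
    have "norm s * (norm x * M) \<le> 1 * (norm x * M)" using s M by (intro mult_right_mono) auto
    then show ?thesis using x1 by (simp add: norm_mult mult_ac)
  qed
  have x3: "norm (x / s) * M < 1"
    using x s by (simp add: norm_divide divide_simps)
  have "(\<lambda>n. (u n * s ^ n) * x ^ n) sums U (s * x)"
    using U[OF x2] by (simp add: power_mult_distrib mult_ac)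
  note 1 = sums_quadratic_mult[OF this, of A0 A1 A2]
  have "(\<lambda>n. (u n / s ^ n) * x ^ n) sums U (x / s)"
    using U[OF x3] by (simp add: power_divide)
  note 2 = sums_quadratic_mult[OF this, of B0 B1 B2]
  note 3 = sums_quadratic_mult[OF U[OF x1], of E0 E1 E2]
  note sum = sums_add[OF sums_add[OF 1 2] 3]
  have zero: "(A0 * (u n * s ^ n) + (if n \<ge> 1 then A1 * (u (n - 1) * s ^ (n - 1)) else 0) + (if n \<ge> 2 then A2 * (u (n - 2) * s ^ (n - 2)) else 0)) * x ^ n
     + (B0 * (u n / s ^ n) + (if n \<ge> 1 then B1 * (u (n - 1) / s ^ (n - 1)) else 0) + (if n \<ge> 2 then B2 * (u (n - 2) / s ^ (n - 2)) else 0)) * x ^ n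
     + (E0 * u n + (if n \<ge> 1 then E1 * u (n - 1) else 0) + (if n \<ge> 2 then E2 * u (n - 2) else 0)) * x ^ n = 0" for n
  proof -
    consider "n = 0" | "n = 1" | k where "n = k + 2"
      by (metis One_nat_def add_2_eq_Suc' not0_implies_Suc)
    then show ?thesis
    proof cases
      case 1
      then show ?thesis using c0 by (simp add: algebra_simps)
    next
      case 2
      have "((A0 * s + B0 / s + E0) * u 1 + (A1 + B1 + E1) * u 0) * x = 0" unfolding c1 by simp
      then show ?thesis using 2 by (simp add: algebra_simps)
    next
      case 3
      have "((A0 * s ^ (k + 2) + B0 / s ^ (k + 2) + E0) * u (k + 2)
        + (A1 * s ^ (k + 1) + B1 / s ^ (k + 1) + E1) * u (k + 1) + (A2 * s ^ k + B2 / s ^ k + E2) * u k) * x ^ n = 0"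
        unfolding c2 by simp
      then show ?thesis using 3 by (simp add: distrib_right distrib_left mult.assoc mult.left_commute add_ac mult.commute)
    qed
  qed
  show ?thesis using sum unfolding zero using sums_unique2[OF sums_zero] by auto
qed

lemma frobenius_deriv_0:
  fixes u :: "nat \<Rightarrow> complex"
  assumes bound: "\<And>n. norm (u n) \<le> C * M ^ n" and M: "0 < M"
  shows "((\<lambda>x. \<Sum>n. u n * x ^ n) has_field_derivative u 1) (at 0)"
proof -
  define K :: complex where "K = of_real (1 / (2 * M))"
  have K: "norm K = 1 / (2 * M)" using M by (simp add: K_def norm_divide)
  have "summable (\<lambda>n. u n * K ^ n)"
  proof (rule summable_comparison_test')
    show "summable (\<lambda>n. C * (1 / 2) ^ n)" by (intro summable_mult summable_geometric) auto
    fix n :: nat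
    have "norm (u n) * norm K ^ n \<le> C * M ^ n * norm K ^ n" by (intro mult_right_mono bound) auto
    then show "norm (u n * K ^ n) \<le> C * (1 / 2) ^ n"
      unfolding K using M by (simp add: norm_mult norm_power K power_divide power_mult_distrib)
  qed
  from termdiffs_strong[OF this, of 0] M K
  have "((\<lambda>x. \<Sum>n. u n * x ^ n) has_field_derivative (\<Sum>n. diffs u n * 0 ^ n)) (at 0)" by simp
  then show ?thesis by (simp add: diffs_def)
qed

text \<open>The values at N and N + 1 start a three-term recursion towards smaller indices. In the
  application the index k stands for q^k, so this is the direction away from the origin.\<close>

lemma backward_extension:
  fixes f0 P Q :: "int \<Rightarrow> complex"
  shows "\<exists>f. (\<forall>k\<ge>N. f k = f0 k) \<and> (\<forall>k\<le>N. f (k - 1) = P k * f k + Q k * f (k + 1))"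
proof -
  obtain u where u: "u 0 = f0 (N + 1)" "u (Suc 0) = f0 N"
    "\<And>n. u (Suc (Suc n)) = P (N - int n) * u (Suc n) + Q (N - int n) * u n"
    using three_term_exists[of "f0 (N + 1)" "f0 N" "\<lambda>n. P (N - int n)" "\<lambda>n. Q (N - int n)"] by blast
  define f where "f k = (if k > N then f0 k else u (nat (N + 1 - k)))" for k
  have fu: "f (N + 1 - int n) = u n" for n
    using u(1) by (cases n) (auto simp: f_def nat_add_distrib)
  have "f (k - 1) = P k * f k + Q k * f (k + 1)" if "k \<le> N" for k
  proof -
    define n where "n = nat (N - k)"
    have "k - 1 = N + 1 - int (Suc (Suc n))" "k = N + 1 - int (Suc n)" "k + 1 = N + 1 - int n" "k = N - int n"
      using that by (auto simp: n_def)
    then show ?thesis using fu[of n] fu[of "Suc n"] fu[of "Suc (Suc n)"] u(3)[of n] by metis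
  qed
  moreover have "f k = f0 k" if "k \<ge> N" for k
    using that u(2) by (auto simp: f_def)
  ultimately show ?thesis by blast
qed

context big_q_Jacobi
begin

lemma eqn_iff:
  assumes "x \<in> II" "x \<noteq> - 1"
  shows "eqn lam f x \<longleftrightarrow> f (x / q) = (lam + of_real (Ac x) + of_real (Bc x)) / of_real (Bc x) * f x
    + (- of_real (Ac x) / of_real (Bc x)) * f (q * x)"
proof -
  have B: "complex_of_real (Bc x) \<noteq> 0" using Bc_pos[OF assms] by simp
  have "eqn lam f x \<longleftrightarrow> of_real (Bc x) * f (x / q) = (lam + of_real (Ac x) + of_real (Bc x)) * f x - of_real (Ac x) * f (q * x)"
    unfolding eqn_def by (auto simp: algebra_simps)
  also have "\<dots> \<longleftrightarrow> f (x / q) = ((lam + of_real (Ac x) + of_real (Bc x)) * f x - of_real (Ac x) * f (q * x)) / of_real (Bc x)"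
    using B by (simp add: field_simps)
  finally show ?thesis by (simp add: diff_divide_distrib)
qed

lemma powi_inj: "s \<noteq> 0 \<Longrightarrow> s * q powi k = s * q powi l \<Longrightarrow> k = l"
  using power_int_strict_decreasing[of k l q] power_int_strict_decreasing[of l k q] q_pos q_less_1
  by (cases k l rule: linorder_cases) auto

text \<open>Recovers the exponent of a point, so that sequences indexed by integers can be turned
  into functions on \<open>II\<close>; s is z or -1.\<close>

definition idx :: "real \<Rightarrow> real \<Rightarrow> int"
  where "idx s x = (THE k. x = s * q powi k)"

lemma idx [simp]: "s \<noteq> 0 \<Longrightarrow> idx s (s * q powi k) = k"
  unfolding idx_def by (rule the_equality) (auto dest: powi_inj)

lemma eventually_small:
  assumes "0 < \<delta>"
  obtains N :: nat where "\<And>k. k \<ge> int N \<Longrightarrow> \<bar>s\<bar> * q powi k < \<delta>"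
proof -
  have "(\<lambda>n. \<bar>s\<bar> * q ^ n) \<longlonglongrightarrow> 0"
    using q_pos q_less_1 by (intro tendsto_mult_right_zero LIMSEQ_power_zero) simp
  then have "eventually (\<lambda>n. \<bar>s\<bar> * q ^ n < \<delta>) sequentially"
    using assms order_tendstoD(2) by blast
  then obtain N where N: "\<And>n. n \<ge> N \<Longrightarrow> \<bar>s\<bar> * q ^ n < \<delta>" by (auto simp: eventually_sequentially)
  have "\<bar>s\<bar> * q powi k < \<delta>" if "k \<ge> int N" for k
  proof -
    have "k = int (nat k)" "nat k \<ge> N" using that by auto
    then show ?thesis using N[of "nat k"] by (metis power_int_of_nat)
  qed
  then show ?thesis using that by blast
qed

text \<open>Since \<open>Bc\<close> is nonzero on \<open>II\<close> except at -1, the equation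
  determines f (x/q) from f x and f (q x). A solution near the origin therefore continues outward
  along both half-lines.\<close>

lemma extend_from_0:
  assumes \<delta>: "0 < \<delta>" and f0: "\<And>x. x \<in> II \<Longrightarrow> \<bar>x\<bar> < \<delta> \<Longrightarrow> x \<noteq> - 1 \<Longrightarrow> eqn lam f0 x"
  obtains f \<epsilon> where "0 < \<epsilon>" "solves lam f" "\<And>x. x \<in> II \<Longrightarrow> \<bar>x\<bar> < \<epsilon> \<Longrightarrow> f x = f0 x"
proof -
  define P where "P x = (lam + of_real (Ac x) + of_real (Bc x)) / of_real (Bc x)" for x
  define Q where "Q x = - complex_of_real (Ac x) / of_real (Bc x)" for x
  obtain N1 :: nat where N1: "\<And>k. k \<ge> int N1 \<Longrightarrow> \<bar>z\<bar> * q powi k < \<delta>" using eventually_small[OF \<delta>] by blast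
  obtain N2 :: nat where N2: "\<And>k. k \<ge> int N2 \<Longrightarrow> \<bar>- 1\<bar> * q powi k < \<delta>" using eventually_small[OF \<delta>] by blast
  define N where "N = int (max N1 N2)"
  obtain fp where fp: "\<And>k. k \<ge> N \<Longrightarrow> fp k = f0 (z * q powi k)"
    "\<And>k. k \<le> N \<Longrightarrow> fp (k - 1) = P (z * q powi k) * fp k + Q (z * q powi k) * fp (k + 1)"
    using backward_extension[of N "\<lambda>k. f0 (z * q powi k)" "\<lambda>k. P (z * q powi k)" "\<lambda>k. Q (z * q powi k)"] by blast
  \<comment> \<open>The negative branch is indexed by all integers too; for k < 0 the values belong
    to points outside \<open>II\<close> and carry no condition.\<close>
  obtain fn where fn: "\<And>k. k \<ge> N \<Longrightarrow> fn k = f0 (- 1 * q powi k)"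
    "\<And>k. k \<le> N \<Longrightarrow> fn (k - 1) = P (- 1 * q powi k) * fn k + Q (- 1 * q powi k) * fn (k + 1)"
    using backward_extension[of N "\<lambda>k. f0 (- 1 * q powi k)" "\<lambda>k. P (- 1 * q powi k)" "\<lambda>k. Q (- 1 * q powi k)"] by blast
  define f where "f x = (if x > 0 then fp (idx z x) else fn (idx (- 1) x))" for x
  have f_pos: "f (z * q powi k) = fp k" for k
    using z_pos idx[of z k] by (simp add: f_def)
  have f_neg: "f (- 1 * q powi k) = fn k" for k
  proof -
    have "\<not> 0 < - 1 * q powi k" using q_powi_pos[of k] by linarith
    then show ?thesis using idx[of "- 1" k] by (simp add: f_def)
  qed
  have shift: "s * q powi k / q = s * q powi (k - 1)" "q * (s * q powi k) = s * q powi (k + 1)" for s k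
    using q_pos by (simp_all add: power_int_diff power_int_add)
  have eq: "eqn lam f (s * q powi k)"
    if I: "s * q powi k \<in> II" "s * q powi k \<noteq> - 1"
      and fs: "\<And>k. f (s * q powi k) = h k" "\<And>k. k \<ge> N \<Longrightarrow> h k = f0 (s * q powi k)"
        "\<And>k. k \<le> N \<Longrightarrow> h (k - 1) = P (s * q powi k) * h k + Q (s * q powi k) * h (k + 1)"
      and small: "\<And>k. k \<ge> N \<Longrightarrow> \<bar>s\<bar> * q powi k < \<delta>" for s k h
  proof (cases "k \<le> N")
    case True
    then show ?thesis
      unfolding eqn_iff[OF I] shift fs(1) using fs(3) by (simp add: P_def Q_def)
  next
    case False
    have "\<bar>s * q powi k\<bar> < \<delta>" using small[of k] False by (simp add: abs_mult abs_of_pos[OF q_powi_pos])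
    from f0[OF I(1) this I(2)] show ?thesis
      unfolding eqn_iff[OF I] shift fs(1) using fs(2)[of k] fs(2)[of "k - 1"] fs(2)[of "k + 1"] False by simp
  qed
  have "solves lam f"
    unfolding solves_def
  proof
    fix x assume x: "x \<in> II - {- 1}"
    then have "x \<in> II" by blast
    then show "eqn lam f x"
    proof (cases rule: I_cases)
      case (neg k)
      have *: "- 1 * q powi (int k) = x" using neg by simp
      have "eqn lam f (- 1 * q powi (int k))"
      proof (rule eq[OF _ _ f_neg fn])
        show "\<And>k. N \<le> k \<Longrightarrow> \<bar>- 1\<bar> * q powi k < \<delta>" using N2 by (auto simp: N_def)
      qed (use x in \<open>simp_all only: * Diff_iff singleton_iff not_False_eq_True\<close>)
      then show ?thesis by (simp only: *)
    next
      case (pos k)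
      have "eqn lam f (z * q powi k)"
      proof (rule eq[OF _ _ f_pos fp])
        show "\<And>k. N \<le> k \<Longrightarrow> \<bar>z\<bar> * q powi k < \<delta>" using N1 by (auto simp: N_def)
      qed (auto simp: pos_ne_minus_1)
      then show ?thesis using pos by simp
    qed
  qed
  moreover define \<epsilon> where "\<epsilon> = min (z * q powi N) (q powi N)"
  have "0 < \<epsilon>" using z_pos by (simp add: \<epsilon>_def)
  moreover have "f x = f0 x" if "x \<in> II" "\<bar>x\<bar> < \<epsilon>" for x
  proof -
    have mono: "k \<ge> N" if "q powi k < q powi N" for k
      using that power_int_decreasing[of k N q] q_pos q_less_1 by (cases "k \<ge> N") auto
    from that(1) show ?thesis
    proof (cases rule: I_cases)
      case (neg k)
      then have "q powi int k < q powi N" using that(2) q_pos by (simp add: \<epsilon>_def)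
      from mono[OF this] show ?thesis using f_neg[of "int k"] fn(1)[of "int k"] neg by simp
    next
      case (pos k)
      then have "z * q powi k < z * q powi N"
        using that(2) abs_of_pos[OF mult_pos_pos[OF z_pos q_powi_pos], of k] by (simp add: \<epsilon>_def)
      then have "q powi k < q powi N" using z_pos by simp
      from mono[OF this] show ?thesis using f_pos[of k] fp(1)[of k] pos by simp
    qed
  qed
  ultimately show ?thesis using that by blast
qed

text \<open>Both exponents of the equation at the origin, 0 and 1, give power series: the indicial factor
  is \<open>(1 - q\<^sup>n) (q\<^sup>1\<^sup>-\<^sup>n - 1)\<close>.\<close>
lemma exists_solution_with_data:
  obtains f where "solves lam f" "data f l m"
proof -
  let ?q = "complex_of_real q"
  have q0: "?q \<noteq> 0" using q_pos by simp
  define A1 A2 B1 B2 where "A1 = complex_of_real (a * b + a * c)" and "A2 = complex_of_real (a * b * (a * c))"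
    and "B1 = complex_of_real (q + b * c)" and "B2 = complex_of_real (b * c)"
  \<comment> \<open>The recursion is multiplied by q^(n+1). Then the indicial factor of index n + 2
    becomes \<open>D n\<close>, which is bounded below by (1-q)^2, while \<open>E'\<close> and
    \<open>H'\<close> stay bounded.\<close>
  define D where "D n = (1 - ?q ^ (n + 2)) * (1 - ?q ^ (n + 1))" for n
  define E' where "E' n = - (A1 * ?q ^ (n + 1) * (?q ^ (n + 1) - 1) + B1 * (1 - ?q ^ (n + 1)))" for n
  define H' where "H' n = - (A2 * ?q ^ (n + 1) * (?q ^ n - 1) + B2 * ?q * (1 - ?q ^ n) - lam * B2 * ?q ^ (n + 1))" for n
  obtain u where u0: "u 0 = l" and u1: "u (Suc 0) = m"
    and u2: "\<And>n. u (Suc (Suc n)) = E' n / D n * u (Suc n) + H' n / D n * u n"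
    using three_term_exists[of l m "\<lambda>n. E' n / D n" "\<lambda>n. H' n / D n"] by blast
  have q1: "norm (1 - ?q ^ n) \<le> 1" for n
  proof -
    have "1 - ?q ^ n = of_real (1 - q ^ n)" by simp
    then show ?thesis using q_pos q_less_1 power_le_one[of q n] by (simp only: norm_of_real) simp
  qed
  have q1': "norm (?q ^ n - 1) \<le> 1" for n using q1[of n] by (simp add: norm_minus_commute)
  have qn1: "norm (?q ^ n) \<le> 1" for n
    using q_pos q_less_1 by (simp add: norm_q_power power_le_one)
  have qlow: "1 - q \<le> norm (1 - ?q ^ Suc n)" for n
  proof -
    have "q * q ^ n \<le> q * 1" using q_pos q_less_1 by (intro mult_left_mono power_le_one) auto
    moreover have "1 - ?q ^ Suc n = of_real (1 - q ^ Suc n)" by simp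
    ultimately show ?thesis by (simp only: norm_of_real) simp
  qed
  have Dlow: "(1 - q) * (1 - q) \<le> norm (D n)" for n
    unfolding D_def norm_mult using qlow[of "n + 1"] qlow[of n] q_less_1 by (intro mult_mono) auto
  then have D0: "D n \<noteq> 0" for n using q_less_1 mult_pos_pos[of "1 - q" "1 - q"] by (metis diff_gt_0_iff_gt linorder_not_less norm_zero)
  define K where "K = (norm A1 + norm B1 + norm A2 + norm B2 + norm (lam * B2)) / ((1 - q) * (1 - q))"
  have tri: "norm x \<le> 1 \<Longrightarrow> norm y \<le> 1 \<Longrightarrow> norm (t * x * y) \<le> norm t" for t x y :: complex
    unfolding norm_mult using mult_mono[of "norm x" 1 "norm y" 1] mult_left_mono[of "norm x * norm y" 1 "norm t"]
    by (simp add: mult.assoc)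
  have E: "norm (E' n / D n) \<le> K" for n
  proof -
    have "norm (E' n) \<le> norm (A1 * ?q ^ (n + 1) * (?q ^ (n + 1) - 1)) + norm (B1 * 1 * (1 - ?q ^ (n + 1)))"
      unfolding E'_def norm_minus_cancel by (simp add: norm_triangle_ineq)
    also have "\<dots> \<le> norm A1 + norm B1" by (intro add_mono tri q1 q1' qn1) simp
    finally have "norm (E' n) \<le> norm A1 + norm B1 + norm A2 + norm B2 + norm (lam * B2)"
      by (simp add: add_increasing2)
    then show ?thesis unfolding K_def norm_divide using Dlow q_less_1 by (intro frac_le) auto
  qed
  have H: "norm (H' n / D n) \<le> K" for n
  proof -
    have "norm (H' n) \<le> norm (A2 * ?q ^ (n + 1) * (?q ^ n - 1)) + norm (B2 * ?q * (1 - ?q ^ n)) + norm (lam * B2 * 1 * ?q ^ (n + 1))"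
      unfolding H'_def norm_minus_cancel
      by (simp add: order_trans[OF norm_triangle_ineq4] norm_triangle_ineq)
    also have "\<dots> \<le> norm A2 + norm B2 + norm (lam * B2)"
      using qn1[of 1] by (intro add_mono tri q1 q1' qn1) simp_all
    finally have "norm (H' n) \<le> norm A1 + norm B1 + norm A2 + norm B2 + norm (lam * B2)"
      using norm_ge_zero[of A1] norm_ge_zero[of B1] by linarith
    then show ?thesis unfolding K_def norm_divide using Dlow q_less_1 by (intro frac_le) auto
  qed
  have K0: "0 \<le> K" using q_less_1 by (simp add: K_def)
  define C M where "C = norm (u 0) + norm (u 1)" and "M = 1 + 2 * K"
  have bound: "norm (u n) \<le> C * M ^ n" for n
    unfolding C_def M_def 
    by (rule three_term_bound[where u = u and E = "\<lambda>n. E' n / D n" and H = "\<lambda>n. H' n / D n"]) (rule u2 E H K0)+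
  have M: "0 < M" using K0 by (simp add: M_def)
  define U where "U x = (\<Sum>n. u n * x ^ n)" for x
  have ser: "(1 + A1 * x + A2 * x\<^sup>2) * U (?q * x) + (?q + B1 * x + B2 * x\<^sup>2) * U (x / ?q)
      + (- (1 + ?q) + - (A1 + B1) * x + - (A2 + B2 + lam * B2) * x\<^sup>2) * U x = 0" if "norm x * M < norm ?q" for x
    unfolding U_def
  proof (rule frobenius_series[OF bound less_imp_le[OF M] _ q0 _ _ _ that])
    show "norm ?q < 1" using q_pos q_less_1 by simp
    \<comment> \<open>The exponents 0 and 1 differ by an integer, but no logarithm arises: the
      constant term contributes nothing in order 1, its coefficient being A1 + B1 - (A1 + B1). Hence
      \<open>u 0\<close> and \<open>u 1\<close> are both free.\<close>
    show "(1 * ?q + ?q / ?q + - (1 + ?q)) * u 1 + (A1 + B1 + - (A1 + B1)) * u 0 = 0"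
      using q0 by simp
    fix n
    define Q where "Q = ?q ^ n"
    have Q0: "Q \<noteq> 0" using q0 by (simp add: Q_def)
    have "D n * u (n + 2) = E' n * u (n + 1) + H' n * u n"
      using u2[of n] D0[of n] by (simp add: field_simps)
    moreover have "?q * Q * (1 * ?q ^ (n + 2) + ?q / ?q ^ (n + 2) + - (1 + ?q)) = D n"
      using q0 Q0 by (simp add: D_def Q_def[symmetric] field_simps)
    moreover have "?q * Q * (A1 * ?q ^ (n + 1) + B1 / ?q ^ (n + 1) + - (A1 + B1)) = - E' n"
      using q0 Q0 by (simp add: E'_def Q_def[symmetric] field_simps)
    moreover have "?q * Q * (A2 * ?q ^ n + B2 / ?q ^ n + - (A2 + B2 + lam * B2)) = - H' n"
      using q0 Q0 by (simp add: H'_def Q_def[symmetric] field_simps)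
    ultimately have "?q * Q * ((1 * ?q ^ (n + 2) + ?q / ?q ^ (n + 2) + - (1 + ?q)) * u (n + 2)
      + (A1 * ?q ^ (n + 1) + B1 / ?q ^ (n + 1) + - (A1 + B1)) * u (n + 1) + (A2 * ?q ^ n + B2 / ?q ^ n + - (A2 + B2 + lam * B2)) * u n) = 0"
      by (simp only: distrib_left mult.assoc[symmetric]) simp
    then show "(1 * ?q ^ (n + 2) + ?q / ?q ^ (n + 2) + - (1 + ?q)) * u (n + 2)
      + (A1 * ?q ^ (n + 1) + B1 / ?q ^ (n + 1) + - (A1 + B1)) * u (n + 1) + (A2 * ?q ^ n + B2 / ?q ^ n + - (A2 + B2 + lam * B2)) * u n = 0"
      using q0 Q0 by simp
  qed simp
  define \<delta> where "\<delta> = q / M"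
  have \<delta>: "0 < \<delta>" using q_pos M by (simp add: \<delta>_def)
  have "eqn lam (\<lambda>x. U (of_real x)) x" if x: "x \<in> II" "\<bar>x\<bar> < \<delta>" for x
  proof -
    have x0: "x \<noteq> 0" using I_nonzero x by blast
    have cx: "complex_of_real x \<noteq> 0" "B2 \<noteq> 0" using x0 b_pos c_pos by (auto simp: B2_def)
    have "norm (complex_of_real x) * M < norm ?q" using x(2) M q_pos by (simp add: \<delta>_def field_simps)
    note s = ser[OF this]
    have A: "complex_of_real (Ac x) = (1 + A1 * x + A2 * (of_real x)\<^sup>2) / (B2 * (of_real x)\<^sup>2)"
      unfolding Ac_eq[OF x0] A1_def A2_def B2_def by (simp add: algebra_simps power2_eq_square)
    have B: "complex_of_real (Bc x) = (?q + B1 * x + B2 * (of_real x)\<^sup>2) / (B2 * (of_real x)\<^sup>2)"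
      unfolding Bc_eq[OF x0] B1_def B2_def by (simp add: algebra_simps power2_eq_square)
    define a' b' where "a' = 1 + A1 * x + A2 * (of_real x)\<^sup>2" and "b' = ?q + B1 * x + B2 * (of_real x)\<^sup>2"
    have eqc: "- (1 + ?q) + - (A1 + B1) * x + - (A2 + B2 + lam * B2) * (of_real x)\<^sup>2 = - a' - b' - lam * (B2 * (of_real x)\<^sup>2)"
      by (simp add: a'_def b'_def algebra_simps)
    from s have "a' * (U (of_real (q * x)) - U (of_real x)) + b' * (U (of_real (x / q)) - U (of_real x)) = lam * U (of_real x) * (B2 * (of_real x)\<^sup>2)"
      unfolding eqc unfolding a'_def[symmetric] b'_def[symmetric] by (simp add: algebra_simps)
    moreover define d where "d = B2 * (complex_of_real x)\<^sup>2"
    moreover have "d \<noteq> 0" using cx by (simp add: d_def)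
    ultimately have "(a' * (U (of_real (q * x)) - U (of_real x)) + b' * (U (of_real (x / q)) - U (of_real x))) / d = lam * U (of_real x)"
      by simp
    then show ?thesis unfolding eqn_def A B unfolding a'_def[symmetric] b'_def[symmetric]
      unfolding d_def[symmetric]
      by (simp add: add_divide_distrib)
  qed
  then obtain f \<epsilon> where f: "0 < \<epsilon>" "solves lam f" "\<And>x. x \<in> II \<Longrightarrow> \<bar>x\<bar> < \<epsilon> \<Longrightarrow> f x = U (of_real x)"
    using extend_from_0[OF \<delta>, of lam "\<lambda>x. U (of_real x)"] by blast
  have "(U has_field_derivative m) (at 0)"
    using frobenius_deriv_0[OF bound M] u1 by (simp add: U_def[abs_def])
  from data_of_deriv[OF this f(1) f(3)] have "data f (U 0) m" by blast
  moreover have "U 0 = l" using u0 by (simp add: U_def)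
  ultimately show ?thesis using that f(2) by blast
qed

section \<open>Solutions at infinity\<close>

lemma solves_zero:
  assumes f: "solves lam f" "data f 0 0" and x: "x \<in> II"
  shows "f x = 0"
proof -
  \<comment> \<open>Against the basis with data (1, 0) and (0, 1) both Casoratians of f vanish,
    while that of the basis itself is \<open>\<kappa>0\<close>; eliminating the values at q x leaves
    f x = 0.\<close>
  obtain g1 where g1: "solves lam g1" "data g1 1 0" by (rule exists_solution_with_data)
  obtain g2 where g2: "solves lam g2" "data g2 0 1" by (rule exists_solution_with_data)
  have 1: "f (q * x) * g1 x = f x * g1 (q * x)"
    by (rule Cas_0D[OF x]) (simp add: Cas_eq[OF f(1) g1(1) f(2) g1(2) x])
  have 2: "f (q * x) * g2 x = f x * g2 (q * x)"
    by (rule Cas_0D[OF x]) (simp add: Cas_eq[OF f(1) g2(1) f(2) g2(2) x])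
  have "Cas g1 g2 x = \<kappa>0"
    by (simp add: Cas_eq[OF g1(1) g2(1) g1(2) g2(2) x])
  then have "g1 (q * x) * g2 x - g1 x * g2 (q * x) \<noteq> 0"
    by (auto simp: Cas_def)
  moreover have "f x * (g1 (q * x) * g2 x - g1 x * g2 (q * x)) = 0"
    using 1 2 by algebra
  ultimately show ?thesis by simp
qed

lemma solves_eqI:
  assumes "solves lam f" "data f l m" "solves lam g" "data g l m" "x \<in> II"
  shows "f x = g x"
proof -
  have "solves lam (\<lambda>x. 1 * f x + (- 1) * g x)" by (intro solves_lin assms)
  moreover have "data (\<lambda>x. 1 * f x + (- 1) * g x) 0 0"
    using data_lin[OF assms(2,4), of 1 "- 1"] by simp
  ultimately have "1 * f x + (- 1) * g x = 0" using assms(5) by (rule solves_zero)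
  then show ?thesis by simp
qed

lemma data_nonzero:
  assumes "solves lam f" "data f l m" "x \<in> II" "f x \<noteq> 0"
  shows "l \<noteq> 0 \<or> m \<noteq> 0"
  using solves_zero assms by blast

lemma solves_proportional:
  assumes f: "solves lam f" "data f l m" and g: "solves lam g" "data g l' m'"
    and ne: "l' \<noteq> 0 \<or> m' \<noteq> 0" and eq: "l * m' = m * l'"
  obtains t where "\<And>x. x \<in> II \<Longrightarrow> f x = t * g x"
proof -
  define t where "t = (if l' \<noteq> 0 then l / l' else m / m')"
  have t: "l = t * l'" "m = t * m'" using ne eq by (auto simp: t_def field_simps)
  have gt: "solves lam (\<lambda>x. t * g x + 0 * g x)" by (intro solves_lin g)
  have "data (\<lambda>x. t * g x + 0 * g x) l m"
    using data_lin[OF g(2) g(2), of t 0] t by simp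
  from solves_eqI[OF f gt this] have "f x = t * g x" if "x \<in> II" for x using that by simp
  then show ?thesis by (rule that)
qed

lemma exists_bdry_solution:
  obtains \<phi> l m where "solves lam \<phi>" "bdry lam \<phi>" "data \<phi> l m" "l \<noteq> 0 \<or> m \<noteq> 0"
proof -
  obtain g1 where g1: "solves lam g1" "data g1 1 0" by (rule exists_solution_with_data)
  obtain g2 where g2: "solves lam g2" "data g2 0 1" by (rule exists_solution_with_data)
  define \<beta> where "\<beta> g = of_real (Ac (- 1)) * (g (- q) - g (- 1)) - lam * g (- 1)" for g :: "real \<Rightarrow> complex"
  show ?thesis
  proof (cases "\<beta> g1 = 0")
    case True
    then show ?thesis using that[OF g1(1) _ g1(2)] by (simp add: bdry_def \<beta>_def)
  next
    case False
    let ?f = "\<lambda>x. \<beta> g2 * g1 x + (- \<beta> g1) * g2 x"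
    have "solves lam ?f" by (intro solves_lin g1 g2)
    moreover have "data ?f (\<beta> g2) (- \<beta> g1)"
      using data_lin[OF g1(2) g2(2), of "\<beta> g2" "- \<beta> g1"] by simp
    moreover have "\<beta> ?f = \<beta> g2 * \<beta> g1 + (- \<beta> g1) * \<beta> g2"
      unfolding \<beta>_def by (simp add: algebra_simps)
    then have "\<beta> ?f = 0" by simp
    then have "bdry lam ?f" unfolding bdry_def \<beta>_def[of ?f] by (simp only: right_minus_eq)
    ultimately show ?thesis using that[of ?f] False by simp
  qed
qed

text \<open>The boundary equation makes f (-q) a fixed multiple of f (-1). So the Casoratian of two
  such solutions vanishes at -1, and with it the determinant of their data.\<close>

lemma bdry_unique:
  assumes f: "solves lam f" "bdry lam f" "data f l m"
    and g: "solves lam g" "bdry lam g" "data g l' m'" and ne: "l' \<noteq> 0 \<or> m' \<noteq> 0"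
  obtains t where "\<And>x. x \<in> II \<Longrightarrow> f x = t * g x"
proof -
  have "of_real (Ac (- 1)) * (f (- q) * g (- 1) - f (- 1) * g (- q)) = 0"
    using f(2) g(2) unfolding bdry_def by algebra
  then have "Cas f g (- 1) = 0" using Ac_pos[OF minus_1_in_I] by (simp add: Cas_def)
  then have "l * m' = m * l'"
    using Cas_eq[OF f(1) g(1) f(3) g(3) minus_1_in_I] by simp
  from solves_proportional[OF f(1,3) g(1,3) ne this] show ?thesis using that by blast
qed

text \<open>Two theta quotients, a b over b c and a c over q, show that p(z / q^k) behaves like
  (a^2/q)^k. Hence membership in the space is decided at infinity by the square summability of f (z
  / q^k) / a^k.\<close>

lemma wt_asymptotics:
  obtains W where "0 < W" "(\<lambda>k. wt (z / q ^ k) * a ^ (2 * k)) \<longlonglongrightarrow> W"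
proof -
  let ?y = "\<lambda>s. - complex_of_real (s * z)"
  have nz: "qp (of_real q / ?y s) \<noteq> 0" "qp (?y s) \<noteq> 0" "?y s \<noteq> 0" if "0 < s" for s
  proof -
    have "of_real q / ?y s = - complex_of_real (q / (s * z))" by simp
    then show "qp (of_real q / ?y s) \<noteq> 0"
      using qp_neg_nonzero[of "q / (s * z)"] that q_pos z_pos by simp
    show "qp (?y s) \<noteq> 0" using qp_neg_nonzero[of "s * z"] that z_pos by simp
  qed (use that z_pos in auto)
  define L where "L s = qp (of_real q / ?y s) * qp (?y s)" for s
  have L: "L s \<noteq> 0" if "0 < s" for s using nz[OF that] by (simp add: L_def)
  have ratio: "(\<lambda>k. (?y t / ?y s) ^ k * (qp (?y s / of_real q ^ k) / qp (?y t / of_real q ^ k))) \<longlonglongrightarrow> L s / L t"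
    if "0 < s" "0 < t" for s t
    unfolding L_def using that by (intro theta_ratio_limit nz)
  have qpy: "qp (?y s / of_real q ^ k) = of_real (qpoch_inf (- s * (z / q ^ k)) q)" for s k
    by (simp add: qp_of_real[symmetric])
  have p: "0 < a * b" "0 < a * c" "0 < b * c" using a_pos b_pos c_pos by auto
  have "(\<lambda>k. (?y (b * c) / ?y (a * b)) ^ k * (qp (?y (a * b) / of_real q ^ k) / qp (?y (b * c) / of_real q ^ k))
        * ((?y q / ?y (a * c)) ^ k * (qp (?y (a * c) / of_real q ^ k) / qp (?y q / of_real q ^ k))))
      \<longlonglongrightarrow> L (a * b) / L (b * c) * (L (a * c) / L q)"
    by (intro tendsto_mult ratio p q_pos)
  moreover have "(?y (b * c) / ?y (a * b)) ^ k * (qp (?y (a * b) / of_real q ^ k) / qp (?y (b * c) / of_real q ^ k))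
        * ((?y q / ?y (a * c)) ^ k * (qp (?y (a * c) / of_real q ^ k) / qp (?y q / of_real q ^ k)))
      = of_real ((q / a\<^sup>2) ^ k * pf (z / q ^ k))" for k
  proof -
    have "(?y (b * c) / ?y (a * b)) * (?y q / ?y (a * c)) = of_real (q / a\<^sup>2)"
      using a_pos b_pos c_pos z_pos by (simp add: field_simps power2_eq_square)
    then have "(?y (b * c) / ?y (a * b)) ^ k * (?y q / ?y (a * c)) ^ k = of_real ((q / a\<^sup>2) ^ k)"
      by (simp only: power_mult_distrib[symmetric] of_real_power)
    moreover have "(qp (?y (a * b) / of_real q ^ k) / qp (?y (b * c) / of_real q ^ k))
        * (qp (?y (a * c) / of_real q ^ k) / qp (?y q / of_real q ^ k)) = of_real (pf (z / q ^ k))"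
      unfolding qpy pfun_def by simp
    ultimately show ?thesis by (simp only: of_real_mult mult_ac)
  qed
  moreover define P where "P = L (a * b) / L (b * c) * (L (a * c) / L q)"
  ultimately have lim: "(\<lambda>k. complex_of_real ((q / a\<^sup>2) ^ k * pf (z / q ^ k))) \<longlonglongrightarrow> P" by simp
  have P0: "P \<noteq> 0" using L p q_pos by (simp add: P_def)
  have limR: "(\<lambda>k. (q / a\<^sup>2) ^ k * pf (z / q ^ k)) \<longlonglongrightarrow> Re P"
    using tendsto_Re[OF lim] by simp
  have "P = of_real (Re P)"
    using LIMSEQ_unique[OF lim tendsto_of_real[OF limR]] .
  then have ReP0: "Re P \<noteq> 0" using P0 by auto
  \<comment> \<open>The limit is nonzero because no theta factor vanishes; its sign comes from the
    positivity of \<open>pf\<close>.\<close>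
  have "0 \<le> Re P"
  proof (rule LIMSEQ_le_const[OF limR])
    show "\<exists>N. \<forall>n\<ge>N. 0 \<le> (q / a\<^sup>2) ^ n * pf (z / q ^ n)"
      using pf_pos[OF I_ge, of "z / q ^ n" for n] q_pos a_pos by (intro exI[of _ 0]) (auto intro!: mult_nonneg_nonneg simp: less_imp_le)
  qed
  then have ReP: "0 < Re P" using ReP0 by simp
  have "(\<lambda>k. (1 - q) * z / ((q / a\<^sup>2) ^ k * pf (z / q ^ k))) \<longlonglongrightarrow> (1 - q) * z / Re P"
    by (intro tendsto_intros limR ReP0)
  moreover have "(1 - q) * z / ((q / a\<^sup>2) ^ k * pf (z / q ^ k)) = wt (z / q ^ k) * a ^ (2 * k)" for k
  proof -
    have "\<bar>z / q ^ k\<bar> = z / q ^ k" using z_pos q_pos by simp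
    moreover have "a ^ (2 * k) = (a\<^sup>2) ^ k" by (rule power_mult)
    ultimately show ?thesis unfolding wt_def using q_pos a_pos
      by (simp add: power_divide field_simps)
  qed
  ultimately show ?thesis using that[of "(1 - q) * z / Re P"] ReP q_less_1 z_pos by simp
qed

lemma inverse_power_tendsto: "(\<lambda>k. q ^ k / z) \<longlonglongrightarrow> 0"
proof -
  have "(\<lambda>k. q ^ k / z) \<longlonglongrightarrow> 0 / z"
    using q_pos q_less_1 z_pos by (intro tendsto_intros LIMSEQ_power_zero) auto
  then show ?thesis by simp
qed

lemma Ac_infinity: "Ac (z / q ^ k) = a\<^sup>2 + (a / b + a / c) * (q ^ k / z) + 1 / (b * c) * (q ^ k / z)\<^sup>2"
  using a_pos b_pos c_pos z_pos q_pos by (simp add: Acoeff_def field_simps power2_eq_square)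

lemma Bc_infinity: "Bc (z / q ^ k) = 1 + (1 + q / (b * c)) * (q ^ k / z) + q / (b * c) * (q ^ k / z)\<^sup>2"
  using a_pos b_pos c_pos z_pos q_pos by (simp add: Bcoeff_def field_simps power2_eq_square)

text \<open>With the limits a^2 and 1 the equation turns into a recurrence with constant
  coefficients, solved by \<alpha>^k if \<alpha> + a^2/\<alpha> = lam + 1 + a^2. For lam = mu(g) the
  roots are a g and a/g, which explains the form of \<open>mu\<close>.\<close>

lemma Ac_tendsto: "(\<lambda>k. Ac (z / q ^ k)) \<longlonglongrightarrow> a\<^sup>2"
proof -
  have "(\<lambda>k. Ac (z / q ^ k)) \<longlonglongrightarrow> a\<^sup>2 + (a / b + a / c) * 0 + 1 / (b * c) * 0\<^sup>2"
    unfolding Ac_infinity by (intro tendsto_intros inverse_power_tendsto)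
  then show ?thesis by simp
qed

lemma Bc_tendsto: "(\<lambda>k. Bc (z / q ^ k)) \<longlonglongrightarrow> 1"
proof -
  have "(\<lambda>k. Bc (z / q ^ k)) \<longlonglongrightarrow> 1 + (1 + q / (b * c)) * 0 + q / (b * c) * 0\<^sup>2"
    unfolding Bc_infinity by (intro tendsto_intros inverse_power_tendsto)
  then show ?thesis by simp
qed

lemma q_mult_div_Suc: "q * (z / q ^ Suc k) = z / q ^ k"
  using q_pos by simp

text \<open>The product of the two exponents is a^2, which the weight compensates, so only the
  leading coefficients enter the limit. For s = 1/g and t = g it contains g - 1/g, nonzero inside
  the unit disc.\<close>

lemma Cas_infinity:
  fixes s t :: complex
  assumes st: "s * t = 1"
    and f: "(\<lambda>k. f (z / q ^ k) / (of_real a * s) ^ k) \<longlonglongrightarrow> l"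
    and g: "(\<lambda>k. g (z / q ^ k) / (of_real a * t) ^ k) \<longlonglongrightarrow> m"
    and W: "(\<lambda>k. wt (z / q ^ k) * a ^ (2 * k)) \<longlonglongrightarrow> W"
  shows "(\<lambda>k. Cas f g (z / q ^ Suc k)) \<longlonglongrightarrow> of_real (a * W) * (t - s) * l * m"
proof -
  have a0: "complex_of_real a \<noteq> 0" and s0: "s \<noteq> 0" and t0: "t \<noteq> 0" using a_pos st by auto
  define F where "F k = f (z / q ^ k) / (of_real a * s) ^ k" for k
  define G where "G k = g (z / q ^ k) / (of_real a * t) ^ k" for k
  have fF: "f (z / q ^ k) = F k * (of_real a * s) ^ k" for k using a0 s0 by (simp add: F_def)
  have gG: "g (z / q ^ k) = G k * (of_real a * t) ^ k" for k using a0 t0 by (simp add: G_def)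
  have "Cas f g (z / q ^ Suc k) = of_real (Ac (z / q ^ Suc k)) * of_real (wt (z / q ^ Suc k) * a ^ (2 * Suc k))
      * (F k * G (Suc k) * t - F (Suc k) * G k * s) / of_real a" for k
  proof -
    have sgn: "sgn (z / q ^ Suc k) = 1" using z_pos q_pos by simp
    have stk: "s ^ k * t ^ k = 1" using st by (simp add: power_mult_distrib[symmetric])
    have "f (z / q ^ k) * g (z / q ^ Suc k) - f (z / q ^ Suc k) * g (z / q ^ k)
      = (of_real a ^ k * of_real a ^ Suc k) * (s ^ k * t ^ k) * (F k * G (Suc k) * t - F (Suc k) * G k * s)"
      unfolding fF gG by (simp add: power_mult_distrib algebra_simps)
    also have "of_real a ^ k * of_real a ^ Suc k = of_real (a ^ (2 * Suc k)) / complex_of_real a"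
      using a0 by (simp add: power_mult power2_eq_square mult_2 power_add)
    finally show ?thesis unfolding Cas_def q_mult_div_Suc sgn stk by simp
  qed
  moreover have "(\<lambda>k. of_real (Ac (z / q ^ Suc k)) * of_real (wt (z / q ^ Suc k) * a ^ (2 * Suc k))
      * (F k * G (Suc k) * t - F (Suc k) * G k * s) / of_real a)
     \<longlonglongrightarrow> of_real (a\<^sup>2) * of_real W * (l * m * t - l * m * s) / of_real a"
    using f g unfolding F_def[symmetric] G_def[symmetric]
    by (intro tendsto_intros tendsto_of_real LIMSEQ_Suc[OF Ac_tendsto] LIMSEQ_Suc[OF W] LIMSEQ_Suc[of F] LIMSEQ_Suc[of G] a0)
  moreover have "of_real (a\<^sup>2) * of_real W * (l * m * t - l * m * s) / of_real a = of_real (a * W) * (t - s) * l * m"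
    using a0 by (simp add: power2_eq_square field_simps)
  ultimately show ?thesis by simp
qed

lemma mu_alt: "mu a g = - 1 - of_real (a\<^sup>2) + of_real a * (g + 1 / g)"
  by (simp add: mu_def inverse_eq_divide)

text \<open>Series in \<open>1/x\<close>; the indicial factor is \<open>(a/g) (1 - q\<^sup>n) (q\<^sup>-\<^sup>n - g\<^sup>2)\<close>, which for
  \<open>|g| \<le> 1\<close> does not vanish if \<open>n \<ge> 1\<close>.\<close>
lemma exists_local_solution_infinity:
  assumes g: "g \<noteq> 0" "norm g \<le> 1"
  obtains h K where "(\<lambda>k. h k / (of_real a * g) ^ k) \<longlonglongrightarrow> 1"
    "\<And>k. K \<le> k \<Longrightarrow> of_real (Ac (z / q ^ Suc k)) * (h k - h (Suc k))
      + of_real (Bc (z / q ^ Suc k)) * (h (Suc (Suc k)) - h (Suc k)) = mu a g * h (Suc k)"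
proof -
  let ?q = "complex_of_real q"
  define lam where "lam = mu a g"
  define \<alpha> where "\<alpha> = of_real a * g"
  have q0: "?q \<noteq> 0" using q_pos by simp
  have a0: "complex_of_real a \<noteq> 0" using a_pos by simp
  have \<alpha>0: "\<alpha> \<noteq> 0" using g a0 by (simp add: \<alpha>_def)
  define a1 a2 b1 b2 where "a1 = complex_of_real (a / b + a / c)" and "a2 = complex_of_real (1 / (b * c))"
    and "b1 = complex_of_real (1 + q / (b * c))" and "b2 = complex_of_real (q / (b * c))"
  \<comment> \<open>The factor \<alpha>^k is split off, so a step outward contributes \<alpha> and a
    step inward 1/\<alpha>. In t = 1/x the outward step is t -> q t; therefore the coefficients of
    \<open>Bc\<close> accompany U(q t) and those of \<open>Ac\<close> accompany U(t/q).\<close>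
  define A0 A1 A2 where "A0 = \<alpha>" and "A1 = \<alpha> * b1" and "A2 = \<alpha> * b2"
  define B0 B1 B2 where "B0 = of_real (a\<^sup>2) / \<alpha>" and "B1 = a1 / \<alpha>" and "B2 = a2 / \<alpha>"
  define E0 E1 E2 where "E0 = - (of_real (a\<^sup>2) + 1 + lam)" and "E1 = - (a1 + b1)" and "E2 = - (a2 + b2)"
  define D where "D n = (of_real a / g) * (1 - ?q ^ Suc n) * (1 - g\<^sup>2 * ?q ^ Suc n)" for n
  define E' where "E' n = - (A1 * (?q ^ n * ?q ^ n) * ?q + B1 * ?q * 1 + E1 * ?q ^ n * ?q)" for n
  define H' where "H' n = - (A2 * ?q ^ n * ?q ^ n + B2 * ?q * ?q + E2 * ?q ^ n * ?q)" for n
  \<comment> \<open>Starting from \<open>v 0 = 0\<close> makes the relation of order 1 an instance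
    of the three-term recursion. The coefficients of the series are \<open>u n = v (Suc n)\<close>,
    with \<open>u 0 = 1\<close>.\<close>
  obtain v where v0: "v 0 = 0" and v1: "v (Suc 0) = 1"
    and v2: "\<And>n. v (Suc (Suc n)) = E' n / D n * v (Suc n) + H' n / D n * v n"
    using three_term_exists[of 0 1 "\<lambda>n. E' n / D n" "\<lambda>n. H' n / D n"] by blast
  have qn1: "norm (?q ^ n) \<le> 1" for n
    using q_pos q_less_1 by (simp add: norm_q_power power_le_one)
  have qlow: "1 - q \<le> norm (1 - y * ?q ^ Suc n)" if "norm y \<le> 1" for n and y :: complex
  proof -
    have "q * q ^ n \<le> q * 1" using q_pos q_less_1 by (intro mult_left_mono power_le_one) auto
    then have "norm y * q ^ Suc n \<le> 1 * q" using that q_pos by (intro mult_mono) auto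
    then have "norm (y * ?q ^ Suc n) \<le> q" by (simp only: norm_mult norm_q_power mult_1)
    then show ?thesis using norm_triangle_ineq2[of 1 "y * ?q ^ Suc n"] by simp
  qed
  \<comment> \<open>As |g| \<le> 1, the factors 1 - q^n and 1 - g^2 q^n with n \<ge> 1 have modulus
    at least 1 - q, on the unit circle as well.\<close>
  define d where "d = a / norm g * ((1 - q) * (1 - q))"
  have d0: "0 < d" using a_pos g q_less_1 by (simp add: d_def)
  have Dlow: "d \<le> norm (D n)" for n
  proof -
    have "norm (g\<^sup>2) \<le> 1" using g by (simp add: norm_power power_le_one)
    then have "(1 - q) * (1 - q) \<le> norm (1 - ?q ^ Suc n) * norm (1 - g\<^sup>2 * ?q ^ Suc n)"
      using qlow[of 1 n] qlow[of "g\<^sup>2" n] q_less_1 by (intro mult_mono) auto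
    then have "a / norm g * ((1 - q) * (1 - q)) \<le> a / norm g * (norm (1 - ?q ^ Suc n) * norm (1 - g\<^sup>2 * ?q ^ Suc n))"
      using a_pos by (intro mult_left_mono) auto
    then show ?thesis unfolding d_def D_def norm_mult norm_divide using a_pos by (simp add: mult_ac)
  qed
  have D0: "D n \<noteq> 0" for n using Dlow[of n] d0 by auto
  define K where "K = (norm A1 + norm B1 + norm E1 + norm A2 + norm B2 + norm E2) / d"
  have tri: "norm x \<le> 1 \<Longrightarrow> norm y \<le> 1 \<Longrightarrow> norm (t * x * y) \<le> norm t" for t x y :: complex
    unfolding norm_mult using mult_mono[of "norm x" 1 "norm y" 1] mult_left_mono[of "norm x * norm y" 1 "norm t"]
    by (simp add: mult.assoc)
  have tri3: "norm (x + y + w) \<le> norm x + norm y + norm w" for x y w :: complex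
    using norm_triangle_ineq[of "x + y" w] norm_triangle_ineq[of x y] by linarith
  have q1: "norm ?q \<le> 1" using qn1[of 1] by simp
  have qq: "norm (?q ^ n * ?q ^ n) \<le> 1" for n
    using qn1[of "n + n"] by (simp only: power_add)
  have E: "norm (E' n / D n) \<le> K" for n
  proof -
    have "norm (E' n) \<le> norm (A1 * (?q ^ n * ?q ^ n) * ?q) + norm (B1 * ?q * 1) + norm (E1 * ?q ^ n * ?q)"
      unfolding E'_def norm_minus_cancel by (rule tri3)
    also have "\<dots> \<le> norm A1 + norm B1 + norm E1" by (intro add_mono tri q1 qn1 qq) simp_all
    finally have "norm (E' n) \<le> norm A1 + norm B1 + norm E1 + norm A2 + norm B2 + norm E2"
      by (simp add: add_increasing2)
    then show ?thesis unfolding K_def norm_divide using Dlow d0 by (intro frac_le) auto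
  qed
  have H: "norm (H' n / D n) \<le> K" for n
  proof -
    have "norm (H' n) \<le> norm (A2 * ?q ^ n * ?q ^ n) + norm (B2 * ?q * ?q) + norm (E2 * ?q ^ n * ?q)"
      unfolding H'_def norm_minus_cancel by (rule tri3)
    also have "\<dots> \<le> norm A2 + norm B2 + norm E2" by (intro add_mono tri q1 qn1)
    finally have "norm (H' n) \<le> norm A1 + norm B1 + norm E1 + norm A2 + norm B2 + norm E2"
      using norm_ge_zero[of A1] norm_ge_zero[of B1] norm_ge_zero[of E1] by linarith
    then show ?thesis unfolding K_def norm_divide using Dlow d0 by (intro frac_le) auto
  qed
  have K0: "0 \<le> K" using d0 by (simp add: K_def)
  define u where "u n = v (Suc n)" for n
  define M where "M = 1 + 2 * K"
  have M: "0 < M" using K0 by (simp add: M_def)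
  have vb: "norm (v n) \<le> (norm (v 0) + norm (v 1)) * (1 + 2 * K) ^ n" for n
    by (rule three_term_bound[where u = v and E = "\<lambda>n. E' n / D n" and H = "\<lambda>n. H' n / D n"]) (rule v2 E H K0)+
  have bound: "norm (u n) \<le> M * M ^ n" for n
    using vb[of "Suc n"] v0 v1 by (simp add: u_def M_def)
  have DD: "?q * Q * (A0 * (?q * Q) + B0 / (?q * Q) + E0) = (of_real a / g) * (1 - ?q * Q) * (1 - g\<^sup>2 * (?q * Q))"
    if "Q \<noteq> 0" for Q
    unfolding A0_def B0_def E0_def lam_def mu_alt \<alpha>_def using g a0 q0 that
    by (simp add: field_simps power2_eq_square)
  define U where "U x = (\<Sum>n. u n * x ^ n)" for x
  have ser: "(A0 + A1 * x + A2 * x\<^sup>2) * U (?q * x) + (B0 + B1 * x + B2 * x\<^sup>2) * U (x / ?q)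
      + (E0 + E1 * x + E2 * x\<^sup>2) * U x = 0" if "norm x * M < norm ?q" for x
    unfolding U_def
  proof (rule frobenius_series[OF bound less_imp_le[OF M] _ q0 _ _ _ that])
    show "norm ?q < 1" using q_pos q_less_1 by simp
    show "(A0 + B0 + E0) * u 0 = 0"
      unfolding A0_def B0_def E0_def lam_def mu_alt \<alpha>_def using g a0 by (simp add: field_simps power2_eq_square)
    have "D 0 * u 1 = E' 0 * u 0"
      using v2[of 0] D0[of 0] v0 by (simp add: u_def field_simps)
    moreover have "?q * (A0 * ?q + B0 / ?q + E0) = D 0"
      using DD[of 1] by (simp add: D_def)
    moreover have "?q * (A1 + B1 + E1) = - E' 0"
      by (simp add: E'_def algebra_simps)
    ultimately have "?q * ((A0 * ?q + B0 / ?q + E0) * u 1 + (A1 + B1 + E1) * u 0) = 0"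
      by (simp only: distrib_left mult.assoc[symmetric]) simp
    then show "(A0 * ?q + B0 / ?q + E0) * u 1 + (A1 + B1 + E1) * u 0 = 0" using q0 by simp
    fix n
    define Q where "Q = ?q ^ n"
    have Q0: "Q \<noteq> 0" using q0 by (simp add: Q_def)
    have "D (n + 1) * u (n + 2) = E' (n + 1) * u (n + 1) + H' (n + 1) * u n"
      using v2[of "n + 1"] D0[of "n + 1"] by (simp add: u_def field_simps)
    moreover have "?q * (?q * Q) * (A0 * ?q ^ (n + 2) + B0 / ?q ^ (n + 2) + E0) = D (n + 1)"
      using DD[of "?q * Q"] q0 Q0 by (simp add: D_def Q_def mult_ac)
    moreover have "?q * (?q * Q) * (A1 * ?q ^ (n + 1) + B1 / ?q ^ (n + 1) + E1) = - E' (n + 1)"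
      using q0 Q0 by (simp add: E'_def Q_def[symmetric] field_simps)
    moreover have "?q * (?q * Q) * (A2 * ?q ^ n + B2 / ?q ^ n + E2) = - H' (n + 1)"
      using q0 Q0 by (simp add: H'_def Q_def[symmetric] field_simps)
    ultimately have "?q * (?q * Q) * ((A0 * ?q ^ (n + 2) + B0 / ?q ^ (n + 2) + E0) * u (n + 2)
      + (A1 * ?q ^ (n + 1) + B1 / ?q ^ (n + 1) + E1) * u (n + 1) + (A2 * ?q ^ n + B2 / ?q ^ n + E2) * u n) = 0"
      by (simp only: distrib_left mult.assoc[symmetric]) simp
    then show "(A0 * ?q ^ (n + 2) + B0 / ?q ^ (n + 2) + E0) * u (n + 2)
      + (A1 * ?q ^ (n + 1) + B1 / ?q ^ (n + 1) + E1) * u (n + 1) + (A2 * ?q ^ n + B2 / ?q ^ n + E2) * u n = 0"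
      using q0 Q0 by simp
  qed
  define h where "h k = \<alpha> ^ k * U (of_real (q ^ k / z))" for k
  have "(U has_field_derivative u 1) (at 0)"
    using frobenius_deriv_0[OF bound M] by (simp add: U_def[abs_def])
  then have "isCont U 0" by (rule DERIV_isCont)
  then have "(\<lambda>k. U (of_real (q ^ k / z))) \<longlonglongrightarrow> U (of_real 0)"
    using isCont_tendsto_compose[OF _ tendsto_of_real[OF inverse_power_tendsto]] by fastforce
  moreover have "U 0 = 1" using v1 by (simp add: U_def u_def)
  moreover have "h k / \<alpha> ^ k = U (of_real (q ^ k / z))" for k using \<alpha>0 by (simp add: h_def)
  ultimately have lim: "(\<lambda>k. h k / (of_real a * g) ^ k) \<longlonglongrightarrow> 1" by (simp add: \<alpha>_def)
  have "(\<lambda>k. q ^ k / z * M) \<longlonglongrightarrow> 0" by (intro tendsto_mult_left_zero inverse_power_tendsto)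
  then have "eventually (\<lambda>k. q ^ k / z * M < q) sequentially" using order_tendstoD(2) q_pos by blast
  then obtain N where N: "\<And>k. k \<ge> N \<Longrightarrow> q ^ k / z * M < q" by (auto simp: eventually_sequentially)
  have "of_real (Ac (z / q ^ Suc k)) * (h k - h (Suc k))
      + of_real (Bc (z / q ^ Suc k)) * (h (Suc (Suc k)) - h (Suc k)) = mu a g * h (Suc k)" if k: "N \<le> k" for k
  proof -
    define t where "t = complex_of_real (q ^ Suc k / z)"
    have "norm t * M < norm ?q"
      unfolding t_def norm_of_real using N[of "Suc k"] k z_pos q_pos by simp
    note s = ser[OF this]
    have hk: "h k = \<alpha> ^ k * U (t / ?q)" "h (Suc k) = \<alpha> ^ k * \<alpha> * U t" "h (Suc (Suc k)) = \<alpha> ^ k * (\<alpha> * \<alpha>) * U (?q * t)"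
      using q_pos by (simp_all add: h_def t_def)
    have cA: "of_real (Ac (z / q ^ Suc k)) = of_real (a\<^sup>2) + a1 * t + a2 * t\<^sup>2"
      unfolding Ac_infinity a1_def a2_def t_def by (simp only: of_real_add of_real_mult of_real_power)
    have cB: "of_real (Bc (z / q ^ Suc k)) = 1 + b1 * t + b2 * t\<^sup>2"
      unfolding Bc_infinity b1_def b2_def t_def by (simp only: of_real_add of_real_mult of_real_power of_real_1)
    define X where "X = of_real (a\<^sup>2) + a1 * t + a2 * t\<^sup>2"
    define Y where "Y = 1 + b1 * t + b2 * t\<^sup>2"
    have eA: "A0 + A1 * t + A2 * t\<^sup>2 = \<alpha> * Y" by (simp add: A0_def A1_def A2_def Y_def algebra_simps)
    have eB: "B0 + B1 * t + B2 * t\<^sup>2 = X / \<alpha>" by (simp add: B0_def B1_def B2_def X_def add_divide_distrib)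
    have eE: "E0 + E1 * t + E2 * t\<^sup>2 = - X - Y - lam" by (simp add: E0_def E1_def E2_def X_def Y_def algebra_simps)
    have "\<alpha> ^ k * \<alpha> * (\<alpha> * Y * U (?q * t) + X / \<alpha> * U (t / ?q) + (- X - Y - lam) * U t) = 0"
      using s unfolding eA eB eE by simp
    then have "X * (\<alpha> ^ k * U (t / ?q) - \<alpha> ^ k * \<alpha> * U t) + Y * (\<alpha> ^ k * (\<alpha> * \<alpha>) * U (?q * t) - \<alpha> ^ k * \<alpha> * U t)
        = lam * (\<alpha> ^ k * \<alpha> * U t)"
      using \<alpha>0 by (simp add: algebra_simps)
    then show ?thesis unfolding cA cB hk lam_def[symmetric] X_def[symmetric] Y_def[symmetric] .
  qed
  then show ?thesis using that[of h N] lim by blast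
qed

lemma div_power_eq_powi: "z / q ^ k = z * q powi (- int k)"
  by (simp add: power_int_minus divide_inverse)

lemma div_power_ne_minus_1: "z / q ^ k \<noteq> - 1"
  unfolding div_power_eq_powi by (rule pos_ne_minus_1)

lemma solves_infinity:
  assumes "solves lam f"
  shows "of_real (Ac (z / q ^ Suc k)) * (f (z / q ^ k) - f (z / q ^ Suc k))
      + of_real (Bc (z / q ^ Suc k)) * (f (z / q ^ Suc (Suc k)) - f (z / q ^ Suc k)) = lam * f (z / q ^ Suc k)"
proof -
  have "eqn lam f (z / q ^ Suc k)"
    using assms div_power_ne_minus_1[of "Suc k"] by (simp add: solves_def del: power_Suc)
  moreover have "z / q ^ Suc k / q = z / q ^ Suc (Suc k)" by (simp add: mult_ac)
  ultimately show ?thesis unfolding eqn_def q_mult_div_Suc by (simp only:)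
qed

text \<open>The series solves the equation for large k only. Matching it at two neighbouring points
  with a combination of the basis (Cramer's rule with determinant \<Delta>) gives a solution on all
  of \<open>II\<close> that has data at the origin by construction.\<close>

lemma exists_solution_infinity:
  assumes g: "g \<noteq> 0" "norm g \<le> 1"
  obtains \<Phi> l m where "solves (mu a g) \<Phi>" "data \<Phi> l m"
    "(\<lambda>k. \<Phi> (z / q ^ k) / (of_real a * g) ^ k) \<longlonglongrightarrow> 1"
proof -
  obtain h K where lim: "(\<lambda>k. h k / (of_real a * g) ^ k) \<longlonglongrightarrow> 1" and
    h: "\<And>k. K \<le> k \<Longrightarrow> of_real (Ac (z / q ^ Suc k)) * (h k - h (Suc k))
      + of_real (Bc (z / q ^ Suc k)) * (h (Suc (Suc k)) - h (Suc k)) = mu a g * h (Suc k)"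
    using exists_local_solution_infinity[OF g] by blast
  obtain g1 where g1: "solves (mu a g) g1" "data g1 1 0" by (rule exists_solution_with_data)
  obtain g2 where g2: "solves (mu a g) g2" "data g2 0 1" by (rule exists_solution_with_data)
  define x where "x = z / q ^ Suc K"
  have x: "x \<in> II" unfolding x_def by (rule pos_in_I_power)
  have qx: "q * x = z / q ^ K" unfolding x_def by (rule q_mult_div_Suc)
  define \<Delta> where "\<Delta> = g1 (q * x) * g2 x - g1 x * g2 (q * x)"
  have "Cas g1 g2 x = \<kappa>0" by (simp add: Cas_eq[OF g1(1) g2(1) g1(2) g2(2) x])
  then have \<Delta>: "\<Delta> \<noteq> 0" by (auto simp: Cas_def \<Delta>_def)
  define c1 c2 where "c1 = (h K * g2 x - h (Suc K) * g2 (q * x)) / \<Delta>"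
    and "c2 = (g1 (q * x) * h (Suc K) - g1 x * h K) / \<Delta>"
  define \<Phi> where "\<Phi> y = c1 * g1 y + c2 * g2 y" for y
  have s: "solves (mu a g) \<Phi>" unfolding \<Phi>_def[abs_def] by (intro solves_lin g1 g2)
  have d: "data \<Phi> (c1 * 1 + c2 * 0) (c1 * 0 + c2 * 1)" unfolding \<Phi>_def[abs_def] by (intro data_lin g1 g2)
  have base: "\<Phi> (z / q ^ K) = h K" "\<Phi> (z / q ^ Suc K) = h (Suc K)"
    unfolding qx[symmetric] x_def[symmetric] \<Phi>_def c1_def c2_def using \<Delta>
    by (simp_all add: divide_simps) (simp_all add: \<Delta>_def algebra_simps)
  have eq: "\<Phi> (z / q ^ k) = h k \<and> \<Phi> (z / q ^ Suc k) = h (Suc k)" if "K \<le> k" for k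
    using that
  proof (induction k rule: dec_induct)
    case (step n)
    have B: "complex_of_real (Bc (z / q ^ Suc n)) \<noteq> 0"
      using Bc_pos[OF pos_in_I_power(2) div_power_ne_minus_1, of "Suc n"] by simp
    have "of_real (Bc (z / q ^ Suc n)) * \<Phi> (z / q ^ Suc (Suc n)) = of_real (Bc (z / q ^ Suc n)) * h (Suc (Suc n))"
      using solves_infinity[OF s, of n] h[of n] step by algebra
    then show ?case using B step by simp
  qed (use base in blast)
  have "eventually (\<lambda>k. h k / (of_real a * g) ^ k = \<Phi> (z / q ^ k) / (of_real a * g) ^ k) sequentially"
    using eventually_ge_at_top[of K] by eventually_elim (simp add: eq)
  with lim have "(\<lambda>k. \<Phi> (z / q ^ k) / (of_real a * g) ^ k) \<longlonglongrightarrow> 1"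
    by (rule Lim_transform_eventually)
  then show ?thesis using that s d by blast
qed

end

section \<open>The Hilbert space\<close>

lemma nonneg_summable_infsum_le:
  fixes f :: "'a \<Rightarrow> real"
  assumes "\<And>x. x \<in> A \<Longrightarrow> 0 \<le> f x" "\<And>F. finite F \<Longrightarrow> F \<subseteq> A \<Longrightarrow> sum f F \<le> B"
  shows "f summable_on A" "infsum f A \<le> B"
proof -
  show s: "f summable_on A"
    using assms by (intro nonneg_bdd_above_summable_on bdd_aboveI[of _ B]) auto
  show "infsum f A \<le> B" by (rule infsum_le_finite_sums[OF s assms(2)])
qed

lemma has_sum_sum_finite:
  fixes f :: "'b \<Rightarrow> 'a \<Rightarrow> real"
  assumes "finite X" "\<And>x. x \<in> X \<Longrightarrow> (f x has_sum s x) A"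
  shows "((\<lambda>y. \<Sum>x\<in>X. f x y) has_sum (\<Sum>x\<in>X. s x)) A"
  using assms by (induction X rule: finite_induct) (auto intro: has_sum_add)

text \<open>Dominated convergence for indicator functions: outside a finite set the sum of |f| is
  small, and on that set membership is eventually constant. It gives the limits at the origin of the
  sums in the Green operator.\<close>

lemma infsum_tendsto_of_eventually_eq:
  fixes f :: "'a \<Rightarrow> complex"
  assumes f: "f summable_on A" and S: "\<And>k. S k \<subseteq> A" "S' \<subseteq> A"
    and ev: "\<And>x. x \<in> A \<Longrightarrow> eventually (\<lambda>k. x \<in> S k \<longleftrightarrow> x \<in> S') sequentially"
  shows "(\<lambda>k. infsum f (S k)) \<longlonglongrightarrow> infsum f S'"
proof (rule tendstoI)
  fix e :: real assume e: "0 < e"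
  have nf: "(\<lambda>x. norm (f x)) summable_on A"
    using f summable_on_iff_abs_summable_on_complex by blast
  obtain F where F: "finite F" "F \<subseteq> A" "dist (\<Sum>x\<in>F. norm (f x)) (\<Sum>\<^sub>\<infinity>x\<in>A. norm (f x)) \<le> e / 3"
    using infsum_finite_approximation[OF nf, of "e / 3"] e by auto
  have nfs: "(\<lambda>x. norm (f x)) summable_on T" if "T \<subseteq> A" for T
    using nf that by (rule summable_on_subset)
  have "(\<Sum>\<^sub>\<infinity>x\<in>A. norm (f x)) = (\<Sum>x\<in>F. norm (f x)) + (\<Sum>\<^sub>\<infinity>x\<in>A - F. norm (f x))"
    using infsum_Un_disjoint[of "\<lambda>x. norm (f x)" F "A - F"] nfs[of "A - F"] F by (simp add: Un_absorb1)
  then have tail: "(\<Sum>\<^sub>\<infinity>x\<in>A - F. norm (f x)) \<le> e / 3"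
    using F(3) by (simp add: dist_real_def)
  have split: "norm (infsum f T - sum f (T \<inter> F)) \<le> e / 3" if T: "T \<subseteq> A" for T
  proof -
    have fs: "f summable_on (T - F)" using f T by (intro summable_on_subset[OF f]) auto
    have "infsum f T = sum f (T \<inter> F) + infsum f (T - F)"
      using infsum_Un_disjoint[of f "T \<inter> F" "T - F"] F fs by (simp add: Int_Diff_Un Int_Diff_disjoint)
    moreover have "norm (infsum f (T - F)) \<le> (\<Sum>\<^sub>\<infinity>x\<in>T - F. norm (f x))"
      using T by (intro norm_infsum_bound nfs) auto
    moreover have "(\<Sum>\<^sub>\<infinity>x\<in>T - F. norm (f x)) \<le> (\<Sum>\<^sub>\<infinity>x\<in>A - F. norm (f x))"
      using T by (intro infsum_mono2 nfs) auto
    ultimately show ?thesis using tail by simp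
  qed
  have "eventually (\<lambda>k. \<forall>x\<in>F. x \<in> S k \<longleftrightarrow> x \<in> S') sequentially"
    using F ev by (intro eventually_ball_finite) auto
  then show "eventually (\<lambda>k. dist (infsum f (S k)) (infsum f S') < e) sequentially"
  proof eventually_elim
    case (elim k)
    then have "S k \<inter> F = S' \<inter> F" by blast
    then have d: "infsum f (S k) - infsum f S' = (infsum f (S k) - sum f (S k \<inter> F)) - (infsum f S' - sum f (S' \<inter> F))"
      by simp
    have "norm (infsum f (S k) - infsum f S') \<le> e / 3 + e / 3"
      unfolding d using norm_triangle_ineq4[of "infsum f (S k) - sum f (S k \<inter> F)" "infsum f S' - sum f (S' \<inter> F)"]
        split[OF S(1), of k] split[OF S(2)] by linarith
    then show ?case using e by (simp add: dist_norm)
  qed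
qed

text \<open>Cauchy-Schwarz, after splitting \<rho> into two square roots, one attached to p and one
  to v, bounds the inner sum by a row sum. After exchanging the sums, symmetry of \<rho> lets the
  same bound serve for the columns.\<close>

lemma schur_test:
  fixes p v :: "'a \<Rightarrow> real" and \<rho> :: "'a \<Rightarrow> 'a \<Rightarrow> real"
  assumes \<rho>: "\<And>x y. 0 \<le> \<rho> x y" "\<And>x y. \<rho> x y \<le> 1" "\<And>x y. \<rho> x y = \<rho> y x"
    and p: "\<And>x. 0 \<le> p x" and v: "\<And>x. 0 \<le> v x" "(\<lambda>x. (v x)\<^sup>2) summable_on A"
    and S: "\<And>x. x \<in> A \<Longrightarrow> (\<lambda>y. (p y)\<^sup>2 * \<rho> x y) summable_on A"
      "\<And>x. x \<in> A \<Longrightarrow> (\<Sum>\<^sub>\<infinity>y\<in>A. (p y)\<^sup>2 * \<rho> x y) \<le> S"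
    and S0: "0 \<le> S"
  shows "\<And>x. x \<in> A \<Longrightarrow> (\<lambda>y. p y * \<rho> x y * v y) summable_on A"
    and "(\<lambda>x. (p x * (\<Sum>\<^sub>\<infinity>y\<in>A. p y * \<rho> x y * v y))\<^sup>2) summable_on A"
    and "(\<Sum>\<^sub>\<infinity>x\<in>A. (p x * (\<Sum>\<^sub>\<infinity>y\<in>A. p y * \<rho> x y * v y))\<^sup>2) \<le> S\<^sup>2 * (\<Sum>\<^sub>\<infinity>x\<in>A. (v x)\<^sup>2)"
proof -
  have rv: "(\<lambda>y. \<rho> x y * (v y)\<^sup>2) summable_on A" for x
    by (rule summable_on_comparison_test[OF v(2)])
      (use \<rho>(1,2)[of x] in \<open>auto intro: mult_left_le_one_le mult_nonneg_nonneg\<close>)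
  define R where "R x = (\<Sum>\<^sub>\<infinity>y\<in>A. \<rho> x y * (v y)\<^sup>2)" for x
  have R0: "0 \<le> R x" for x unfolding R_def using \<rho> by (intro infsum_nonneg) simp
  have fin: "(\<Sum>y\<in>F. p y * \<rho> x y * v y) \<le> sqrt (S * R x)" if "x \<in> A" "finite F" "F \<subseteq> A" for x F
  proof (rule real_le_rsqrt)
    have "(\<Sum>y\<in>F. p y * \<rho> x y * v y)\<^sup>2 = (\<Sum>y\<in>F. (p y * sqrt (\<rho> x y)) * (sqrt (\<rho> x y) * v y))\<^sup>2"
    proof -
      have "p y * \<rho> x y * v y = (p y * sqrt (\<rho> x y)) * (sqrt (\<rho> x y) * v y)" for y
        using \<rho>(1)[of x y] real_sqrt_mult_self[of "\<rho> x y"] by (simp add: mult_ac)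
      then show ?thesis by (simp only:)
    qed
    also have "\<dots> \<le> (\<Sum>y\<in>F. (p y * sqrt (\<rho> x y))\<^sup>2) * (\<Sum>y\<in>F. (sqrt (\<rho> x y) * v y)\<^sup>2)"
      by (rule Cauchy_Schwarz_ineq_sum)
    also have "\<dots> = (\<Sum>y\<in>F. (p y)\<^sup>2 * \<rho> x y) * (\<Sum>y\<in>F. \<rho> x y * (v y)\<^sup>2)"
      using \<rho>(1) by (simp add: power_mult_distrib)
    also have "\<dots> \<le> S * R x"
    proof (rule mult_mono)
      show "(\<Sum>y\<in>F. (p y)\<^sup>2 * \<rho> x y) \<le> S"
        using finite_sum_le_infsum[OF S(1)[OF that(1)] that(2,3)] S(2)[OF that(1)] \<rho>(1) by fastforce
      show "(\<Sum>y\<in>F. \<rho> x y * (v y)\<^sup>2) \<le> R x"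
        unfolding R_def using finite_sum_le_infsum[OF rv that(2,3)] \<rho>(1) by simp
    qed (use S0 \<rho>(1) in \<open>auto intro: sum_nonneg\<close>)
    finally show "(\<Sum>y\<in>F. p y * \<rho> x y * v y)\<^sup>2 \<le> S * R x" .
  qed
  have nn: "0 \<le> p y * \<rho> x y * v y" for x y using p v \<rho> by simp
  show s: "(\<lambda>y. p y * \<rho> x y * v y) summable_on A" if "x \<in> A" for x
    using nonneg_summable_infsum_le(1)[of A "\<lambda>y. p y * \<rho> x y * v y"] nn fin[OF that] by blast
  have le: "(\<Sum>\<^sub>\<infinity>y\<in>A. p y * \<rho> x y * v y) \<le> sqrt (S * R x)" if "x \<in> A" for x
    using nonneg_summable_infsum_le(2)[of A "\<lambda>y. p y * \<rho> x y * v y"] nn fin[OF that] by blast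
  have sq: "(p x * (\<Sum>\<^sub>\<infinity>y\<in>A. p y * \<rho> x y * v y))\<^sup>2 \<le> (p x)\<^sup>2 * (S * R x)" if "x \<in> A" for x
  proof -
    have "(\<Sum>\<^sub>\<infinity>y\<in>A. p y * \<rho> x y * v y)\<^sup>2 \<le> (sqrt (S * R x))\<^sup>2"
      using nn by (intro power_mono le that infsum_nonneg)
    then show ?thesis unfolding power_mult_distrib using S0 R0[of x] by (intro mult_left_mono) auto
  qed
  have fin2: "(\<Sum>x\<in>F. (p x * (\<Sum>\<^sub>\<infinity>y\<in>A. p y * \<rho> x y * v y))\<^sup>2) \<le> S\<^sup>2 * (\<Sum>\<^sub>\<infinity>x\<in>A. (v x)\<^sup>2)"
    if F: "finite F" "F \<subseteq> A" for F
  proof -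
    have "(\<Sum>x\<in>F. (p x * (\<Sum>\<^sub>\<infinity>y\<in>A. p y * \<rho> x y * v y))\<^sup>2) \<le> (\<Sum>x\<in>F. (p x)\<^sup>2 * (S * R x))"
      using F by (intro sum_mono sq) auto
    also have "\<dots> = S * (\<Sum>x\<in>F. (p x)\<^sup>2 * R x)" by (simp add: sum_distrib_left mult_ac)
    also have "S * (\<Sum>x\<in>F. (p x)\<^sup>2 * R x) \<le> S * (S * (\<Sum>\<^sub>\<infinity>x\<in>A. (v x)\<^sup>2))"
    proof (rule mult_left_mono[OF _ S0], rule has_sum_mono)
      show "((\<lambda>y. \<Sum>x\<in>F. (p x)\<^sup>2 * (\<rho> x y * (v y)\<^sup>2)) has_sum (\<Sum>x\<in>F. (p x)\<^sup>2 * R x)) A"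
        unfolding R_def by (intro has_sum_sum_finite F has_sum_cmult_right has_sum_infsum rv)
      show "((\<lambda>y. S * (v y)\<^sup>2) has_sum S * (\<Sum>\<^sub>\<infinity>x\<in>A. (v x)\<^sup>2)) A"
        by (intro has_sum_cmult_right has_sum_infsum v)
      fix y assume y: "y \<in> A"
      have "(\<Sum>x\<in>F. (p x)\<^sup>2 * \<rho> y x) \<le> S"
        using finite_sum_le_infsum[OF S(1)[OF y] F] S(2)[OF y] \<rho>(1) by fastforce
      then have "(\<Sum>x\<in>F. (p x)\<^sup>2 * \<rho> y x) * (v y)\<^sup>2 \<le> S * (v y)\<^sup>2" by (intro mult_right_mono) auto
      then show "(\<Sum>x\<in>F. (p x)\<^sup>2 * (\<rho> x y * (v y)\<^sup>2)) \<le> S * (v y)\<^sup>2"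
        unfolding sum_distrib_right \<rho>(3)[of y] by (simp add: mult_ac)
    qed
    finally show ?thesis by (simp add: power2_eq_square mult.assoc)
  qed
  show "(\<lambda>x. (p x * (\<Sum>\<^sub>\<infinity>y\<in>A. p y * \<rho> x y * v y))\<^sup>2) summable_on A"
    and "(\<Sum>\<^sub>\<infinity>x\<in>A. (p x * (\<Sum>\<^sub>\<infinity>y\<in>A. p y * \<rho> x y * v y))\<^sup>2) \<le> S\<^sup>2 * (\<Sum>\<^sub>\<infinity>x\<in>A. (v x)\<^sup>2)"
    using nonneg_summable_infsum_le[of A "\<lambda>x. (p x * (\<Sum>\<^sub>\<infinity>y\<in>A. p y * \<rho> x y * v y))\<^sup>2"] fin2 by auto
qed

context big_q_Jacobi
begin

section \<open>The Hilbert space as a weighted l^2 space over \<open>II\<close>\<close>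

abbreviation "HH \<equiv> Hspace q z a b c"
abbreviation "NN \<equiv> Hnorm q z a b c"
abbreviation "DD \<equiv> Ddom q z a b c"
abbreviation "LL \<equiv> Lop q z a b c"

definition nsq :: "(real \<Rightarrow> complex) \<Rightarrow> real \<Rightarrow> real"
  where "nsq f x = (norm (f x))\<^sup>2 * wt x"

lemma nsq_nonneg [simp]: "x \<in> II \<Longrightarrow> 0 \<le> nsq f x"
  using wt_pos[of x] by (simp add: nsq_def)

definition Ineg :: "real set"
  where "Ineg = range (\<lambda>k::nat. - (q ^ k))"

definition Ipos :: "real set"
  where "Ipos = range (\<lambda>k::int. z * q powi k)"

lemma II_eq: "II = Ineg \<union> Ipos" and Ineg_Ipos: "Ineg \<inter> Ipos = {}"
proof -
  show "II = Ineg \<union> Ipos" unfolding Iset_def Ineg_def Ipos_def by blast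
  have "y < 0" if "y \<in> Ineg" for y using that q_pos by (auto simp: Ineg_def)
  moreover have "0 < y" if "y \<in> Ipos" for y using that z_pos by (auto simp: Ipos_def)
  ultimately show "Ineg \<inter> Ipos = {}" by fastforce
qed

lemma inj_neg: "inj (\<lambda>k::nat. - (q ^ k))"
proof (rule injI)
  fix x y assume "- (q ^ x) = - (q ^ y)"
  then show "x = y" using power_inject_exp'[of q x y] q_pos q_less_1 by simp
qed

lemma inj_pos: "inj (\<lambda>k::int. z * q powi k)"
proof (rule injI)
  fix k l :: int assume "z * q powi k = z * q powi l"
  then show "k = l" by (rule powi_inj[rotated]) (use z_pos in simp)
qed

lemma inj_mult_power: "inj (\<lambda>k::nat. z * q ^ k)"
proof (rule injI)
  fix k l :: nat assume "z * q ^ k = z * q ^ l"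
  then have "z * q powi (int k) = z * q powi (int l)" by simp
  then have "int k = int l" by (rule powi_inj[rotated]) (use z_pos in simp)
  then show "k = l" by simp
qed

lemma summable_on_Ineg: "f summable_on Ineg \<longleftrightarrow> (\<lambda>k. f (- (q ^ k))) summable_on UNIV"
  unfolding Ineg_def summable_on_reindex[OF inj_neg] by (simp add: o_def)

lemma summable_on_Ipos: "f summable_on Ipos \<longleftrightarrow> (\<lambda>k. f (z * q powi k)) summable_on UNIV"
  unfolding Ipos_def summable_on_reindex[OF inj_pos] by (simp add: o_def)

lemma summable_on_II: "(f :: real \<Rightarrow> real) summable_on II \<longleftrightarrow> f summable_on Ineg \<and> f summable_on Ipos"
  unfolding II_eq using summable_on_union summable_on_subset[of f "Ineg \<union> Ipos"] by blast

lemma wminus_wt: "wminus q a b c k = wt (- (q ^ k))"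
  using q_pos by (simp add: wminus_def wt_def)

lemma wplus_wt: "wplus q z a b c k = wt (z * q powi k)"
proof -
  have "\<bar>z * q powi k\<bar> = z * q powi k" using z_pos by (intro abs_of_pos mult_pos_pos) auto
  then show ?thesis by (simp add: wplus_def wt_def mult_ac)
qed

text \<open>For nonnegative terms \<open>summable\<close> and \<open>summable_on\<close> agree, so
  both branches merge into one unordered sum over \<open>II\<close>.\<close>

lemma HH_iff: "f \<in> HH \<longleftrightarrow> (\<forall>x. x \<notin> II \<longrightarrow> f x = 0) \<and> nsq f summable_on II"
proof -
  have "summable (\<lambda>k. (cmod (f (- (q ^ k))))\<^sup>2 * wminus q a b c k) \<longleftrightarrow> nsq f summable_on Ineg"
    unfolding summable_on_Ineg wminus_wt nsq_def
    by (subst summable_on_UNIV_nonneg_real_iff) (use wt_pos[OF neg_in_I] in \<open>auto simp: less_imp_le\<close>)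
  moreover have "(\<lambda>k. (cmod (f (z * q powi k)))\<^sup>2 * wplus q z a b c k) summable_on UNIV \<longleftrightarrow> nsq f summable_on Ipos"
    unfolding summable_on_Ipos wplus_wt nsq_def ..
  ultimately show ?thesis unfolding Hspace_def summable_on_II by simp
qed

lemma NN_eq:
  assumes "f \<in> HH"
  shows "NN f = sqrt (\<Sum>\<^sub>\<infinity>x\<in>II. nsq f x)"
proof -
  have s: "nsq f summable_on Ineg" "nsq f summable_on Ipos"
    using assms by (auto simp: HH_iff summable_on_II)
  have nsq: "f x * cnj (f x) * of_real (wt x) = of_real (nsq f x)" for x
    by (simp only: nsq_def of_real_mult complex_norm_square)
  have "((\<lambda>k. nsq f (- (q ^ k))) has_sum infsum (nsq f) Ineg) UNIV"
    using has_sum_infsum[OF s(1)] has_sum_reindex[OF inj_neg, of "nsq f"] by (simp add: Ineg_def o_def)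
  then have "(\<lambda>k. nsq f (- (q ^ k))) sums infsum (nsq f) Ineg" by (rule has_sum_imp_sums)
  then have 1: "(\<Sum>k. f (- (q ^ k)) * cnj (f (- (q ^ k))) * of_real (wminus q a b c k)) = of_real (infsum (nsq f) Ineg)"
    unfolding wminus_wt nsq by (intro sums_unique[symmetric] sums_of_real)
  have "((\<lambda>k. nsq f (z * q powi k)) has_sum infsum (nsq f) Ipos) UNIV"
    using has_sum_infsum[OF s(2)] has_sum_reindex[OF inj_pos, of "nsq f"] by (simp add: Ipos_def o_def)
  then have 2: "(\<Sum>\<^sub>\<infinity>k\<in>UNIV. f (z * q powi k) * cnj (f (z * q powi k)) * of_real (wplus q z a b c k)) = of_real (infsum (nsq f) Ipos)"
    unfolding wplus_wt nsq by (intro infsumI has_sum_of_real)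
  have "infsum (nsq f) II = infsum (nsq f) Ineg + infsum (nsq f) Ipos"
    unfolding II_eq by (rule infsum_Un_disjoint[OF s Ineg_Ipos])
  then show ?thesis unfolding Hnorm_def Hinner_def 1 2 by simp
qed

lemma HH_bound: "nsq (\<lambda>x. s * f x + t * g x) x \<le> 2 * (norm s)\<^sup>2 * nsq f x + 2 * (norm t)\<^sup>2 * nsq g x" if "x \<in> II"
proof -
  have "(norm (s * f x + t * g x))\<^sup>2 \<le> (norm s * norm (f x) + norm t * norm (g x))\<^sup>2"
    by (intro power_mono) (metis norm_mult norm_triangle_ineq, simp)
  also have "\<dots> \<le> 2 * (norm s * norm (f x))\<^sup>2 + 2 * (norm t * norm (g x))\<^sup>2"
    using sum_squares_bound[of "norm s * norm (f x)" "norm t * norm (g x)"] by (simp add: power2_sum)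
  finally have "(norm (s * f x + t * g x))\<^sup>2 * wt x \<le> (2 * (norm s * norm (f x))\<^sup>2 + 2 * (norm t * norm (g x))\<^sup>2) * wt x"
    using wt_pos[OF that] by (intro mult_right_mono) auto
  then show ?thesis by (simp add: nsq_def power_mult_distrib algebra_simps)
qed

lemma HH_lin:
  assumes "f \<in> HH" "g \<in> HH"
  shows "(\<lambda>x. s * f x + t * g x) \<in> HH"
proof -
  have "nsq (\<lambda>x. s * f x + t * g x) summable_on II"
  proof (rule summable_on_comparison_test)
    show "(\<lambda>x. 2 * (norm s)\<^sup>2 * nsq f x + 2 * (norm t)\<^sup>2 * nsq g x) summable_on II"
      using assms by (intro summable_on_add summable_on_cmult_right) (auto simp: HH_iff)
  qed (auto intro: HH_bound)
  then show ?thesis using assms by (simp add: HH_iff)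
qed

lemma LL_eq: "x \<in> II \<Longrightarrow> x \<noteq> - 1 \<Longrightarrow> LL f x = of_real (Ac x) * (f (q * x) - f x) + of_real (Bc x) * (f (x / q) - f x)"
  "LL f (- 1) = of_real (Ac (- 1)) * (f (- q) - f (- 1))" "x \<notin> II \<Longrightarrow> LL f x = 0"
  by (auto simp: Lop_def)

lemma LL_lin: "LL (\<lambda>x. s * f x + t * g x) x = s * LL f x + t * LL g x"
  unfolding Lop_def by (simp add: algebra_simps)

lemma DD_iff: "f \<in> DD \<longleftrightarrow> f \<in> HH \<and> LL f \<in> HH \<and> (\<exists>l m. data f l m)"
  unfolding Ddom_def data_def by blast

lemma DD_lin:
  assumes "f \<in> DD" "g \<in> DD"
  shows "(\<lambda>x. s * f x + t * g x) \<in> DD"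
proof -
  have "LL (\<lambda>x. s * f x + t * g x) = (\<lambda>x. s * LL f x + t * LL g x)" by (simp add: LL_lin fun_eq_iff)
  moreover obtain l m l' m' where "data f l m" "data g l' m'" using assms unfolding DD_iff by blast
  then have "data (\<lambda>x. s * f x + t * g x) (s * l + t * l') (s * m + t * m')" by (rule data_lin)
  ultimately show ?thesis using assms HH_lin[of f g] HH_lin[of "LL f" "LL g"] unfolding DD_iff by auto
qed

lemma shift_lin: "shift_op LL lam (\<lambda>x. s * f x + t * g x) = (\<lambda>x. s * shift_op LL lam f x + t * shift_op LL lam g x)"
  unfolding shift_op_def LL_lin by (simp add: algebra_simps)

lemma shift_in_HH: "f \<in> DD \<Longrightarrow> shift_op LL lam f \<in> HH"
  unfolding shift_op_def using HH_lin[of "LL f" f 1 "- lam"] by (simp add: DD_iff)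

lemma solution_iff:
  "(\<forall>x\<in>II. LL f x = lam * f x) \<longleftrightarrow> solves lam f \<and> bdry lam f"
proof
  assume L: "\<forall>x\<in>II. LL f x = lam * f x"
  have "solves lam f" unfolding solves_def eqn_def
  proof
    fix x assume "x \<in> II - {- 1}"
    then have "x \<in> II" "x \<noteq> - 1" by auto
    with L show "of_real (Ac x) * (f (q * x) - f x) + of_real (Bc x) * (f (x / q) - f x) = lam * f x"
      unfolding LL_eq(1)[OF \<open>x \<in> II\<close> \<open>x \<noteq> - 1\<close>, symmetric] by blast
  qed
  moreover have "bdry lam f" unfolding bdry_def using L LL_eq(2) minus_1_in_I by metis
  ultimately show "solves lam f \<and> bdry lam f" ..
next
  assume s: "solves lam f \<and> bdry lam f"
  show "\<forall>x\<in>II. LL f x = lam * f x"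
  proof
    fix x assume "x \<in> II"
    then show "LL f x = lam * f x"
      using s by (cases "x = - 1") (auto simp: LL_eq solves_def eqn_def bdry_def)
  qed
qed

lemma data_cong: "(\<And>x. x \<in> II \<Longrightarrow> f x = g x) \<Longrightarrow> data f l m = data g l m"
  unfolding data_def Dq_def using pos_in_I_power(1) I_mult_q[OF pos_in_I_power(1)] I_mult_q[OF neg_in_I] by simp

lemma solves_cong: "(\<And>x. x \<in> II \<Longrightarrow> f x = g x) \<Longrightarrow> solves lam f = solves lam g"
  unfolding solves_def eqn_def using I_mult_q I_div_q by (intro ball_cong) auto

lemma bdry_cong: "(\<And>x. x \<in> II \<Longrightarrow> f x = g x) \<Longrightarrow> bdry lam f = bdry lam g"
  unfolding bdry_def by simp

text \<open>Up to z the set \<open>II\<close> consists of the two sequences that converge to the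
  origin, and convergent sequences are bounded.\<close>

lemma data_Bseq:
  assumes "data f l m"
  obtains C where "0 < C" "\<And>x. x \<in> II \<Longrightarrow> x \<le> z \<Longrightarrow> norm (f x) \<le> C"
proof -
  have "Bseq (\<lambda>k. f (z * q ^ k))" "Bseq (\<lambda>k. f (- (q ^ k)))"
    using assms unfolding data_def by (blast intro: convergent_imp_Bseq convergentI)+
  then obtain C1 C2 where C: "0 < C1" "\<And>k. norm (f (z * q ^ k)) \<le> C1" "0 < C2" "\<And>k. norm (f (- (q ^ k))) \<le> C2"
    by (auto simp: Bseq_def)
  have "norm (f x) \<le> max C1 C2" if "x \<in> II" "x \<le> z" for x
    using that(1)
  proof (cases rule: I_cases)
    case (neg k)
    then show ?thesis using C(4)[of k] by simp
  next
    case (pos k)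
    have "0 \<le> k"
    proof (rule ccontr)
      assume "\<not> 0 \<le> k"
      then have "q powi 0 < q powi k" using q_pos q_less_1 by (intro power_int_strict_decreasing) auto
      then show False using pos that(2) z_pos by simp
    qed
    then obtain j where "k = int j" using nonneg_int_cases by blast
    then show ?thesis using C(2)[of j] pos by simp
  qed
  then show ?thesis using that[of "max C1 C2"] C by simp
qed

lemma Ipos_split: "Ipos = range (\<lambda>k::nat. z * q ^ k) \<union> range (\<lambda>k::nat. z / q ^ Suc k)"
proof -
  have "z * q powi k \<in> range (\<lambda>k::nat. z * q ^ k) \<union> range (\<lambda>k::nat. z / q ^ Suc k)" for k
  proof (cases "0 \<le> k")
    case True
    then obtain j where "k = int j" using nonneg_int_cases by blast
    then have "z * q powi k = z * q ^ j" by simp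
    then show ?thesis by blast
  next
    case False
    define j where "j = nat (- k - 1)"
    have "k = - int (Suc j)" using False by (simp add: j_def)
    then have "z * q powi k = z / q ^ Suc j" unfolding div_power_eq_powi by simp
    then show ?thesis by blast
  qed
  moreover have "z * q ^ k \<in> Ipos" "z / q ^ Suc k \<in> Ipos" for k
    unfolding Ipos_def div_power_eq_powi by (auto intro: image_eqI[of _ _ "int k"])
  ultimately show ?thesis unfolding Ipos_def by blast
qed

lemma inj_div_power: "inj (\<lambda>k::nat. z / q ^ Suc k)"
proof (rule injI)
  fix k l :: nat assume "z / q ^ Suc k = z / q ^ Suc l"
  then have "z * q powi (- int (Suc k)) = z * q powi (- int (Suc l))" unfolding div_power_eq_powi .
  then have "- int (Suc k) = - int (Suc l)" by (rule powi_inj[rotated]) (use z_pos in simp)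
  then show "k = l" by simp
qed

lemma summable_on_IIi:
  fixes f :: "real \<Rightarrow> real"
  assumes "\<And>x. x \<in> II \<Longrightarrow> 0 \<le> f x" "summable (\<lambda>k. f (- (q ^ k)))" "summable (\<lambda>k. f (z * q ^ k))"
    "summable (\<lambda>k. f (z / q ^ Suc k))"
  shows "f summable_on II"
proof -
  have "f summable_on Ineg"
    unfolding summable_on_Ineg using assms(1,2) by (subst summable_on_UNIV_nonneg_real_iff) auto
  moreover have "f summable_on range (\<lambda>k::nat. z * q ^ k)"
    using assms(1,3) by (subst summable_on_reindex[OF inj_mult_power]) (auto simp: o_def summable_on_UNIV_nonneg_real_iff)
  moreover have "f summable_on range (\<lambda>k::nat. z / q ^ Suc k)"
    using assms(1,4) pos_in_I_power(2)[of "Suc k" for k]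
    by (subst summable_on_reindex[OF inj_div_power])
      (auto simp: o_def summable_on_UNIV_nonneg_real_iff simp del: power_Suc)
  ultimately show ?thesis
    unfolding summable_on_II Ipos_split by (auto intro: summable_on_union)
qed

text \<open>As p tends to 1 at the origin, the weight is of order |x| and its sums are geometric.
  Together with \<open>data_Bseq\<close>, every function with data is square summable near the
  origin: the limit circle case.\<close>

lemma wt_summable_0: "summable (\<lambda>k. wt (- (q ^ k)))" "summable (\<lambda>k. wt (z * q ^ k))"
proof -
  have key: "summable (\<lambda>k. wt (s * q ^ k))" if I: "\<And>k. s * q ^ k \<in> II" for s
  proof -
    have "(\<lambda>k. s * q ^ k) \<longlonglongrightarrow> 0"
      using q_pos q_less_1 by (intro tendsto_mult_right_zero LIMSEQ_power_zero) simp
    then have "(\<lambda>k. 1 / pf (s * q ^ k)) \<longlonglongrightarrow> 1 / 1" by (intro tendsto_intros pf_tendsto_1) auto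
    then have "Bseq (\<lambda>k. 1 / pf (s * q ^ k))" using convergent_imp_Bseq convergentI by blast
    then obtain C where C: "0 < C" "\<And>k. norm (1 / pf (s * q ^ k)) \<le> C" by (auto simp: Bseq_def)
    show ?thesis
    proof (rule summable_comparison_test')
      show "summable (\<lambda>k. (1 - q) * \<bar>s\<bar> * C * q ^ k)" by (rule summable_qpow)
      fix k :: nat
      have "norm (wt (s * q ^ k)) = (1 - q) * \<bar>s\<bar> * q ^ k * norm (1 / pf (s * q ^ k))"
        using q_pos q_less_1 by (simp add: wt_def abs_mult)
      also have "\<dots> \<le> (1 - q) * \<bar>s\<bar> * q ^ k * C"
        using C q_pos q_less_1 by (intro mult_left_mono) auto
      finally show "norm (wt (s * q ^ k)) \<le> (1 - q) * \<bar>s\<bar> * C * q ^ k" by (simp add: mult_ac)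
    qed
  qed
  show "summable (\<lambda>k. wt (- (q ^ k)))" using key[of "- 1"] by simp
  show "summable (\<lambda>k. wt (z * q ^ k))" using key[of z] by simp
qed

lemma HH_of_data:
  assumes f: "data f l m" "\<And>x. x \<notin> II \<Longrightarrow> f x = 0" and s: "summable (\<lambda>k. nsq f (z / q ^ Suc k))"
  shows "f \<in> HH"
proof -
  obtain C where C: "0 < C" "\<And>x. x \<in> II \<Longrightarrow> x \<le> z \<Longrightarrow> norm (f x) \<le> C" using data_Bseq[OF f(1)] by blast
  have le: "nsq f x \<le> C\<^sup>2 * wt x" if "x \<in> II" "x \<le> z" for x
    unfolding nsq_def using C(2)[OF that] wt_pos[OF that(1)] by (intro mult_right_mono power_mono) auto
  have zq: "z * q ^ k \<le> z" for k using z_pos q_pos q_less_1 mult_left_mono[of "q ^ k" 1 z] power_le_one[of q k] by simp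
  have nz: "- (q ^ k) \<le> z" for k using z_pos q_pos zero_le_power[of q k] by linarith
  have "nsq f summable_on II"
  proof (rule summable_on_IIi)
    show "summable (\<lambda>k. nsq f (- (q ^ k)))"
      by (rule summable_comparison_test'[OF summable_mult[OF wt_summable_0(1), of "C\<^sup>2"]])
        (use le[OF neg_in_I nz] in simp)
    show "summable (\<lambda>k. nsq f (z * q ^ k))"
      by (rule summable_comparison_test'[OF summable_mult[OF wt_summable_0(2), of "C\<^sup>2"]])
        (use le[OF pos_in_I_power(1) zq] in simp)
  qed (use s in auto)
  then show ?thesis using f by (simp add: HH_iff)
qed

text \<open>The terms of the squared norm tend to 0, and by \<open>wt_asymptotics\<close> they are
  comparable to |f (z / q^k) / a^k|^2. Solutions of size a^k or larger are thereby excluded from the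
  space.\<close>

lemma HH_infinity_tendsto_0:
  assumes "f \<in> HH"
  shows "(\<lambda>k. f (z / q ^ k) / of_real a ^ k) \<longlonglongrightarrow> 0"
proof -
  obtain W where W: "0 < W" "(\<lambda>k. wt (z / q ^ k) * a ^ (2 * k)) \<longlonglongrightarrow> W" by (rule wt_asymptotics)
  have "nsq f summable_on range (\<lambda>k::nat. z / q ^ Suc k)"
    using assms unfolding HH_iff summable_on_II Ipos_split by (meson Un_upper2 summable_on_subset)
  then have "summable (\<lambda>k. nsq f (z / q ^ Suc k))"
    unfolding summable_on_reindex[OF inj_div_power]
    by (auto simp: o_def intro: summable_on_imp_summable simp del: power_Suc)
  then have "(\<lambda>k. nsq f (z / q ^ Suc k)) \<longlonglongrightarrow> 0" by (rule summable_LIMSEQ_zero)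
  then have n0: "(\<lambda>k. nsq f (z / q ^ k)) \<longlonglongrightarrow> 0" by (rule LIMSEQ_imp_Suc)
  have "(\<lambda>k. sqrt (nsq f (z / q ^ k) / (wt (z / q ^ k) * a ^ (2 * k)))) \<longlonglongrightarrow> sqrt (0 / W)"
    using W by (intro tendsto_intros n0 W) auto
  moreover have "sqrt (nsq f (z / q ^ k) / (wt (z / q ^ k) * a ^ (2 * k))) = norm (f (z / q ^ k) / of_real a ^ k)" for k
  proof -
    have "wt (z / q ^ k) > 0" by (rule wt_pos[OF pos_in_I_power(2)])
    then have "nsq f (z / q ^ k) / (wt (z / q ^ k) * a ^ (2 * k)) = (norm (f (z / q ^ k)) / a ^ k)\<^sup>2"
      by (simp add: nsq_def power_divide power_mult[of a k 2] mult.commute[of 2 k])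
    then show ?thesis using a_pos by (simp add: norm_divide norm_power)
  qed
  ultimately show ?thesis by (simp add: tendsto_norm_zero_iff)
qed

text \<open>|g| wt is the geometric mean of |g|^2 wt and wt, which both tend to 0. It removes the
  jump term in the q-derivative of the Green potential.\<close>

lemma HH_origin_tendsto_0:
  assumes "g \<in> HH"
  shows "(\<lambda>k. g (z * q ^ k) * of_real (wt (z * q ^ k))) \<longlonglongrightarrow> 0"
proof -
  have "nsq g summable_on range (\<lambda>k::nat. z * q ^ k)"
    using assms unfolding HH_iff summable_on_II Ipos_split by (meson Un_upper1 summable_on_subset)
  then have "summable (\<lambda>k. nsq g (z * q ^ k))"
    unfolding summable_on_reindex[OF inj_mult_power]
    by (auto simp: o_def intro: summable_on_imp_summable)
  then have "(\<lambda>k. nsq g (z * q ^ k)) \<longlonglongrightarrow> 0" by (rule summable_LIMSEQ_zero)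
  moreover have "(\<lambda>k. wt (z * q ^ k)) \<longlonglongrightarrow> 0" by (rule summable_LIMSEQ_zero[OF wt_summable_0(2)])
  ultimately have "(\<lambda>k. sqrt (nsq g (z * q ^ k) * wt (z * q ^ k))) \<longlonglongrightarrow> sqrt (0 * 0)"
    by (intro tendsto_intros)
  moreover have "sqrt (nsq g (z * q ^ k) * wt (z * q ^ k)) = norm (g (z * q ^ k) * of_real (wt (z * q ^ k)))" for k
  proof -
    have "wt (z * q ^ k) > 0" by (rule wt_pos[OF pos_in_I_power(1)])
    moreover have "nsq g (z * q ^ k) * wt (z * q ^ k) = (norm (g (z * q ^ k)) * wt (z * q ^ k))\<^sup>2"
      by (simp add: nsq_def power2_eq_square)
    ultimately show ?thesis by (simp add: norm_mult)
  qed
  ultimately show ?thesis by (simp add: tendsto_norm_zero_iff)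
qed

section \<open>Green operators\<close>

lemma mult_power_le: "z * q ^ k \<le> z"
  using mult_left_mono[of "q ^ k" 1 z] power_le_one[of q k] z_pos q_pos q_less_1 by simp

lemma neg_power_le: "- (q ^ k) \<le> z"
  using z_pos q_pos zero_less_power[of q k] by linarith

lemma gap_pos:
  assumes "x \<in> II" "y \<in> II" "0 < x" "y < x"
  shows "y \<le> q * x"
proof -
  from assms(1) obtain k :: int where k: "x = z * q powi k"
    using assms(3) q_pos by (cases rule: I_cases) (auto simp: not_less[symmetric])
  from assms(2) show ?thesis
  proof (cases rule: I_cases)
    case (neg j)
    have "0 < q * x" using assms(3) q_pos by simp
    moreover have "y < 0" using neg q_pos by simp
    ultimately show ?thesis by linarith
  next
    case (pos j)
    have "\<not> j \<le> k"
    proof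
      assume "j \<le> k"
      then have "q powi k \<le> q powi j" using q_pos q_less_1 by (intro power_int_decreasing) auto
      then show False using assms(4) k pos z_pos by (simp add: not_less[symmetric])
    qed
    then have "q powi j \<le> q powi (k + 1)" using q_pos q_less_1 by (intro power_int_decreasing) auto
    then have "z * q powi j \<le> z * q powi (k + 1)" using z_pos by simp
    then show ?thesis unfolding k pos powi_step(2) .
  qed
qed

lemma gap_neg:
  assumes "x \<in> II" "y \<in> II" "x < 0" "x < y"
  shows "q * x \<le> y"
proof -
  from assms(1) obtain k where k: "x = - (q ^ k)"
  proof (cases rule: I_cases)
    case (pos k)
    have "0 < z * q powi k" using z_pos by simp
    then show ?thesis using pos assms(3) by simp
  qed blast
  from assms(2) show ?thesis
  proof (cases rule: I_cases)
    case (neg j)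
    have "\<not> j \<le> k"
    proof
      assume "j \<le> k"
      then have "q ^ k \<le> q ^ j" using q_pos q_less_1 by (intro power_decreasing) auto
      then show False using assms(4) k neg by simp
    qed
    then have "q ^ j \<le> q ^ Suc k" using q_pos q_less_1 by (intro power_decreasing) auto
    then show ?thesis using k neg by simp
  next
    case (pos j)
    have "0 < z * q powi j" using z_pos by simp
    moreover have "q * x < 0" using assms(3) q_pos by (simp add: mult_pos_neg)
    ultimately show ?thesis using pos by linarith
  qed
qed

abbreviation "Ile x \<equiv> {y \<in> II. y \<le> x}"
abbreviation "Igt x \<equiv> {y \<in> II. x < y}"

lemma q_mult_less: "0 < x \<Longrightarrow> q * x < x" "x < 0 \<Longrightarrow> x < q * x"
  using q_less_1 by auto

text \<open>Multiplication by q leads to the left neighbour on the positive half-line but to the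
  right neighbour on the negative one (\<open>gap_pos\<close>, \<open>gap_neg\<close>), so the cut
  of the Green kernel moves in opposite directions.\<close>

lemma Ile_pos: "x \<in> II \<Longrightarrow> 0 < x \<Longrightarrow> Ile x = insert x (Ile (q * x)) \<and> x \<notin> Ile (q * x)"
  and Igt_pos: "x \<in> II \<Longrightarrow> 0 < x \<Longrightarrow> Igt (q * x) = insert x (Igt x) \<and> x \<notin> Igt x"
proof -
  assume x: "x \<in> II" "0 < x"
  note lt = q_mult_less(1)[OF x(2)]
  have "y \<le> x \<longleftrightarrow> y = x \<or> y \<le> q * x" if "y \<in> II" for y
    using gap_pos[OF x(1) that x(2)] lt by fastforce
  then show "Ile x = insert x (Ile (q * x)) \<and> x \<notin> Ile (q * x)"
    "Igt (q * x) = insert x (Igt x) \<and> x \<notin> Igt x"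
    using x lt by (auto simp: not_le[symmetric])
qed

lemma Ile_neg: "x \<in> II \<Longrightarrow> x < 0 \<Longrightarrow> Ile (q * x) = insert (q * x) (Ile x) \<and> q * x \<notin> Ile x"
  and Igt_neg: "x \<in> II \<Longrightarrow> x < 0 \<Longrightarrow> Igt x = insert (q * x) (Igt (q * x)) \<and> q * x \<notin> Igt (q * x)"
proof -
  assume x: "x \<in> II" "x < 0"
  note lt = q_mult_less(2)[OF x(2)]
  have "x < y \<longleftrightarrow> y = q * x \<or> q * x < y" if "y \<in> II" for y
    using gap_neg[OF x(1) that x(2)] lt by fastforce
  then show "Ile (q * x) = insert (q * x) (Ile x) \<and> q * x \<notin> Ile x"
    "Igt x = insert (q * x) (Igt (q * x)) \<and> q * x \<notin> Igt (q * x)"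
    using I_mult_q[OF x(1)] lt by (auto simp: not_less[symmetric])
qed

lemma Ile_minus_1: "Ile (- 1) = {- 1}"
  using I_ge by force

text \<open>Variation of constants: \<open>\<phi>\<close> belongs to the left end -1,
  \<open>\<psi>\<close> to infinity. Points of \<open>II\<close> accumulate at 0, so the sums may be
  infinite and run through the origin.\<close>

definition aL :: "(real \<Rightarrow> complex) \<Rightarrow> (real \<Rightarrow> complex) \<Rightarrow> real \<Rightarrow> complex"
  where "aL \<phi> g x = (\<Sum>\<^sub>\<infinity>y\<in>Ile x. \<phi> y * (g y * of_real (wt y)))"

definition bR :: "(real \<Rightarrow> complex) \<Rightarrow> (real \<Rightarrow> complex) \<Rightarrow> real \<Rightarrow> complex"
  where "bR \<psi> g x = (\<Sum>\<^sub>\<infinity>y\<in>Igt x. \<psi> y * (g y * of_real (wt y)))"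

definition green :: "complex \<Rightarrow> (real \<Rightarrow> complex) \<Rightarrow> (real \<Rightarrow> complex) \<Rightarrow> (real \<Rightarrow> complex) \<Rightarrow> real \<Rightarrow> complex"
  where "green \<kappa> \<phi> \<psi> g x = (if x \<in> II then (\<psi> x * aL \<phi> g x + \<phi> x * bR \<psi> g x) / \<kappa> else 0)"

lemma limits_of_data:
  assumes pos: "(\<lambda>k. f (z * q ^ k)) \<longlonglongrightarrow> l" "(\<lambda>k. Dq q f (z * q ^ k)) \<longlonglongrightarrow> m"
    and neg: "(\<lambda>k. f (- (q ^ k))) \<longlonglongrightarrow> l" "(\<lambda>k. Dq q f (- (q ^ k))) \<longlonglongrightarrow> m"
  shows "data f l m"
  using assms by (simp add: data_def)

text \<open>Three configurations: a positive point, a negative point, the boundary point -1. On the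
  positive half-line the cut moves on the way to q x and the Casoratian is taken with A; on the
  negative one it moves on the way to x/q and is taken with B.\<close>

lemma green_algebra:
  fixes A B lam \<alpha> \<beta> \<phi>0 \<phi>p \<phi>m \<psi>0 \<psi>p \<psi>m g w \<kappa> :: complex
  shows "A * (\<phi>p - \<phi>0) + B * (\<phi>m - \<phi>0) = lam * \<phi>0 \<Longrightarrow> A * (\<psi>p - \<psi>0) + B * (\<psi>m - \<psi>0) = lam * \<psi>0
      \<Longrightarrow> A * w * (\<phi>p * \<psi>0 - \<phi>0 * \<psi>p) = \<kappa>
      \<Longrightarrow> A * ((\<psi>p * (\<alpha> - \<phi>0 * (g * w)) + \<phi>p * (\<beta> + \<psi>0 * (g * w))) - (\<psi>0 * \<alpha> + \<phi>0 * \<beta>))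
        + B * ((\<psi>m * \<alpha> + \<phi>m * \<beta>) - (\<psi>0 * \<alpha> + \<phi>0 * \<beta>)) - lam * (\<psi>0 * \<alpha> + \<phi>0 * \<beta>) = \<kappa> * g"
    and "A * (\<phi>p - \<phi>0) + B * (\<phi>m - \<phi>0) = lam * \<phi>0 \<Longrightarrow> A * (\<psi>p - \<psi>0) + B * (\<psi>m - \<psi>0) = lam * \<psi>0
      \<Longrightarrow> B * w * (\<phi>m * \<psi>0 - \<phi>0 * \<psi>m) = \<kappa>
      \<Longrightarrow> A * ((\<psi>p * \<alpha> + \<phi>p * \<beta>) - (\<psi>0 * \<alpha> + \<phi>0 * \<beta>))
        + B * ((\<psi>m * (\<alpha> - \<phi>0 * (g * w)) + \<phi>m * (\<beta> + \<psi>0 * (g * w))) - (\<psi>0 * \<alpha> + \<phi>0 * \<beta>))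
        - lam * (\<psi>0 * \<alpha> + \<phi>0 * \<beta>) = \<kappa> * g"
    and "A * (\<phi>p - \<phi>0) = lam * \<phi>0 \<Longrightarrow> A * w * (\<phi>0 * \<psi>p - \<phi>p * \<psi>0) = \<kappa>
      \<Longrightarrow> A * ((\<psi>p * (\<phi>0 * (g * w)) + \<phi>p * \<beta>) - (\<psi>0 * (\<phi>0 * (g * w)) + \<phi>0 * \<beta>))
        - lam * (\<psi>0 * (\<phi>0 * (g * w)) + \<phi>0 * \<beta>) = \<kappa> * g"
  by algebra+

theorem green_solution:
  assumes \<phi>: "solves lam \<phi>" "bdry lam \<phi>" "data \<phi> l m" and \<psi>: "solves lam \<psi>" "data \<psi> l' m'"
    and \<kappa>: "\<kappa> = \<kappa>0 * (l * m' - m * l')" "\<kappa> \<noteq> 0" and g: "g \<in> HH"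
    and sa: "\<And>x. x \<in> II \<Longrightarrow> (\<lambda>y. \<phi> y * (g y * of_real (wt y))) summable_on Ile x"
    and sb: "\<And>x. x \<in> II \<Longrightarrow> (\<lambda>y. \<psi> y * (g y * of_real (wt y))) summable_on Igt x"
  shows "\<And>x. x \<in> II \<Longrightarrow> LL (green \<kappa> \<phi> \<psi> g) x - lam * green \<kappa> \<phi> \<psi> g x = g x"
    and "\<exists>L M. data (green \<kappa> \<phi> \<psi> g) L M"
proof -
  define G where "G y = g y * of_real (wt y)" for y
  define \<alpha> where "\<alpha> = aL \<phi> g"
  define \<beta> where "\<beta> = bR \<psi> g"
  define f where "f = green \<kappa> \<phi> \<psi> g"
  note sa' = sa[folded G_def] and sb' = sb[folded G_def]
  have f: "\<kappa> * f x = \<psi> x * \<alpha> x + \<phi> x * \<beta> x" if "x \<in> II" for x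
    using that \<kappa>(2) by (simp add: f_def green_def \<alpha>_def \<beta>_def)
  have \<alpha>: "\<alpha> x = (\<Sum>\<^sub>\<infinity>y\<in>Ile x. \<phi> y * G y)" and \<beta>: "\<beta> x = (\<Sum>\<^sub>\<infinity>y\<in>Igt x. \<psi> y * G y)" for x
    by (simp_all add: \<alpha>_def \<beta>_def aL_def bR_def G_def)
  have step_pos: "\<alpha> x = \<phi> x * G x + \<alpha> (q * x)" "\<beta> (q * x) = \<psi> x * G x + \<beta> x" if x: "x \<in> II" "0 < x" for x
  proof -
    show "\<alpha> x = \<phi> x * G x + \<alpha> (q * x)"
      unfolding \<alpha> using Ile_pos[OF x] infsum_insert[OF sa'[OF I_mult_q[OF x(1)]], of x] by metis
    show "\<beta> (q * x) = \<psi> x * G x + \<beta> x"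
      unfolding \<beta> using Igt_pos[OF x] infsum_insert[OF sb'[OF x(1)], of x] by metis
  qed
  have step_neg: "\<alpha> (q * x) = \<phi> (q * x) * G (q * x) + \<alpha> x" "\<beta> x = \<psi> (q * x) * G (q * x) + \<beta> (q * x)"
    if x: "x \<in> II" "x < 0" for x
  proof -
    show "\<alpha> (q * x) = \<phi> (q * x) * G (q * x) + \<alpha> x"
      unfolding \<alpha> using Ile_neg[OF x] infsum_insert[OF sa'[OF x(1)], of "q * x"] by metis
    show "\<beta> x = \<psi> (q * x) * G (q * x) + \<beta> (q * x)"
      unfolding \<beta> using Igt_neg[OF x] infsum_insert[OF sb'[OF I_mult_q[OF x(1)]], of "q * x"] by metis
  qed
  have Cas: "Cas \<phi> \<psi> x = \<kappa>" if "x \<in> II" for x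
    unfolding \<kappa> by (rule Cas_eq[OF \<phi>(1) \<psi>(1) \<phi>(3) \<psi>(2) that])
  have "\<kappa> * (LL f x - lam * f x) = \<kappa> * g x" if x: "x \<in> II" for x
  proof (cases "x = - 1")
    case True
    have st: "\<alpha> (- q) = \<phi> (- q) * G (- q) + \<alpha> (- 1)" "\<beta> (- 1) = \<psi> (- q) * G (- q) + \<beta> (- q)"
      using step_neg[OF minus_1_in_I] by simp_all
    have a1: "\<alpha> (- 1) = \<phi> (- 1) * G (- 1)"
      unfolding \<alpha> Ile_minus_1 by simp
    have fq: "\<kappa> * f (- q) = \<psi> (- q) * \<alpha> (- 1) + \<phi> (- q) * \<beta> (- 1)"
      unfolding f[OF minus_q_in_I] st by (simp add: algebra_simps)
    have "of_real (Ac (- 1)) * (\<phi> (- q) - \<phi> (- 1)) = lam * \<phi> (- 1)"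
      using \<phi>(2) by (simp add: bdry_def)
    moreover have "of_real (Ac (- 1)) * of_real (wt (- 1)) * (\<phi> (- 1) * \<psi> (- q) - \<phi> (- q) * \<psi> (- 1)) = \<kappa>"
      using Cas[OF minus_1_in_I] by (simp add: Cas_def algebra_simps)
    moreover have "\<kappa> * (LL f (- 1) - lam * f (- 1)) = of_real (Ac (- 1)) * (\<kappa> * f (- q) - \<kappa> * f (- 1)) - lam * (\<kappa> * f (- 1))"
      unfolding LL_eq by (simp add: algebra_simps)
    ultimately have "\<kappa> * (LL f (- 1) - lam * f (- 1)) = \<kappa> * g (- 1)"
      unfolding fq f[OF minus_1_in_I] a1 G_def by (simp add: green_algebra(3))
    then show ?thesis by (simp only: True)
  next
    case False
    have y: "x / q \<in> II" by (rule I_div_q[OF x False])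
    have qy: "q * (x / q) = x" using q_pos by simp
    define A where "A = complex_of_real (Ac x)"
    define B where "B = complex_of_real (Bc x)"
    have eq\<phi>: "A * (\<phi> (q * x) - \<phi> x) + B * (\<phi> (x / q) - \<phi> x) = lam * \<phi> x"
      and eq\<psi>: "A * (\<psi> (q * x) - \<psi> x) + B * (\<psi> (x / q) - \<psi> x) = lam * \<psi> x"
      using \<phi>(1) \<psi>(1) x False by (auto simp: solves_def eqn_def A_def B_def)
    have L: "\<kappa> * (LL f x - lam * f x) = A * (\<kappa> * f (q * x) - \<kappa> * f x) + B * (\<kappa> * f (x / q) - \<kappa> * f x) - lam * (\<kappa> * f x)"
      unfolding LL_eq(1)[OF x False] A_def B_def by (simp add: algebra_simps)
    show ?thesis
    proof (cases "0 < x")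
      case True
      have y0: "0 < x / q" using True q_pos by simp
      note s1 = step_pos[OF x True] and s2 = step_pos[OF y y0, unfolded qy]
      have f1: "\<kappa> * f (q * x) = \<psi> (q * x) * (\<alpha> x - \<phi> x * G x) + \<phi> (q * x) * (\<beta> x + \<psi> x * G x)"
        unfolding f[OF I_mult_q[OF x]] s1 by (simp add: algebra_simps)
      have f2: "\<kappa> * f (x / q) = \<psi> (x / q) * \<alpha> x + \<phi> (x / q) * \<beta> x"
        unfolding f[OF y] s2 by (simp add: algebra_simps)
      have "A * of_real (wt x) * (\<phi> (q * x) * \<psi> x - \<phi> x * \<psi> (q * x)) = \<kappa>"
        using Cas[OF x] True by (simp add: Cas_def A_def)
      then show ?thesis
        unfolding L f1 f2 f[OF x] G_def by (rule green_algebra(1)[OF eq\<phi> eq\<psi>])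
    next
      case False
      then have x0: "x < 0" using I_nonzero[OF x] by simp
      then have y0: "x / q < 0" using q_pos by (simp add: divide_neg_pos)
      note s1 = step_neg[OF x x0] and s2 = step_neg[OF y y0, unfolded qy]
      have f1: "\<kappa> * f (q * x) = \<psi> (q * x) * \<alpha> x + \<phi> (q * x) * \<beta> x"
        unfolding f[OF I_mult_q[OF x]] s1 by (simp add: algebra_simps)
      have f2: "\<kappa> * f (x / q) = \<psi> (x / q) * (\<alpha> x - \<phi> x * G x) + \<phi> (x / q) * (\<beta> x + \<psi> x * G x)"
        unfolding f[OF y] s2 by (simp add: algebra_simps)
      have "of_real (Ac (x / q) * wt (x / q)) * (\<phi> (x / q) * \<psi> x - \<phi> x * \<psi> (x / q)) = \<kappa>"
      proof -
        have "sgn (x / q) = - 1" using y0 by (rule sgn_neg)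
        from Cas[OF y, unfolded Cas_def qy this] show ?thesis by (simp add: algebra_simps)
      qed
      moreover have "Ac (x / q) * wt (x / q) = Bc x * wt x" using Ac_wt[OF y] unfolding qy .
      ultimately have "B * of_real (wt x) * (\<phi> (x / q) * \<psi> x - \<phi> x * \<psi> (x / q)) = \<kappa>"
        by (simp add: B_def)
      then show ?thesis
        unfolding L f1 f2 f[OF x] G_def by (rule green_algebra(2)[OF eq\<phi> eq\<psi>])
    qed
  qed
  then show "\<And>x. x \<in> II \<Longrightarrow> LL (green \<kappa> \<phi> \<psi> g) x - lam * green \<kappa> \<phi> \<psi> g x = g x"
    unfolding f_def[symmetric] using \<kappa>(2) by simp
  have zI: "z \<in> II" using pos_in_I_power(1)[of 0] by simp
  have ev: "eventually (\<lambda>k. \<not> y \<le> z * q ^ k) sequentially" if "0 < y" for y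
    using order_tendstoD(2)[OF q_power_tendsto_0(1) that] by eventually_elim simp
  have ev': "eventually (\<lambda>k. y \<le> - (q ^ k)) sequentially" if "y < 0" for y
    using order_tendstoD(1)[OF q_power_tendsto_0(2) that] by eventually_elim simp
  have nneg: "\<not> y \<le> - (q ^ k)" if "0 < y" for y k using that q_pos zero_less_power[of q k] by linarith
  have ppos: "y \<le> z * q ^ k" if "y < 0" for y k
  proof -
    have "0 < z * q ^ k" using z_pos q_pos by simp
    then show ?thesis using that by linarith
  qed
  \<comment> \<open>Limits of the two sums at the origin, the same from both sides: in the limit the
    cut separates the negative from the positive half-line.\<close>
  define \<alpha>0 where "\<alpha>0 = (\<Sum>\<^sub>\<infinity>y\<in>{y\<in>II. y < 0}. \<phi> y * G y)"
  define \<beta>0 where "\<beta>0 = (\<Sum>\<^sub>\<infinity>y\<in>{y\<in>II. 0 < y}. \<psi> y * G y)"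
  have \<alpha>p: "(\<lambda>k. \<alpha> (z * q ^ k)) \<longlonglongrightarrow> \<alpha>0"
    unfolding \<alpha> \<alpha>0_def
  proof (rule infsum_tendsto_of_eventually_eq[OF sa'[OF zI]])
    show "Ile (z * q ^ k) \<subseteq> Ile z" for k
      using mult_power_le[of k] by auto
    show "{y \<in> II. y < 0} \<subseteq> Ile z" using z_pos by auto
    fix y assume "y \<in> Ile z"
    then have "y \<in> II" by simp
    then show "eventually (\<lambda>k. y \<in> Ile (z * q ^ k) \<longleftrightarrow> y \<in> {y \<in> II. y < 0}) sequentially"
    proof (cases "y < 0")
      case False
      then have "0 < y" using I_nonzero[OF \<open>y \<in> II\<close>] by simp
      from ev[OF this] show ?thesis by eventually_elim (use False in simp)
    qed (simp add: ppos)
  qed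
  have \<alpha>n: "(\<lambda>k. \<alpha> (- (q ^ k))) \<longlonglongrightarrow> \<alpha>0"
    unfolding \<alpha> \<alpha>0_def
  proof (rule infsum_tendsto_of_eventually_eq[OF sa'[OF zI]])
    show "Ile (- (q ^ k)) \<subseteq> Ile z" for k
      using neg_power_le[of k] by auto
    show "{y \<in> II. y < 0} \<subseteq> Ile z" using z_pos by auto
    fix y assume "y \<in> Ile z"
    then have "y \<in> II" by simp
    then show "eventually (\<lambda>k. y \<in> Ile (- (q ^ k)) \<longleftrightarrow> y \<in> {y \<in> II. y < 0}) sequentially"
    proof (cases "y < 0")
      case True
      from ev'[OF this] show ?thesis by eventually_elim (use True in simp)
    next
      case False
      then have "0 < y" using I_nonzero[OF \<open>y \<in> II\<close>] by simp
      then show ?thesis using nneg False by simp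
    qed
  qed
  have \<beta>p: "(\<lambda>k. \<beta> (z * q ^ k)) \<longlonglongrightarrow> \<beta>0"
    unfolding \<beta> \<beta>0_def
  proof (rule infsum_tendsto_of_eventually_eq[OF sb'[OF minus_1_in_I]])
    show "Igt (z * q ^ k) \<subseteq> Igt (- 1)" for k
      using less_trans[of "- 1" 0 "z * q ^ k"] mult_pos_pos[OF z_pos, of "q ^ k"] q_pos by auto
    show "{y \<in> II. 0 < y} \<subseteq> Igt (- 1)" by auto
    fix y assume "y \<in> Igt (- 1)"
    then have "y \<in> II" by simp
    then show "eventually (\<lambda>k. y \<in> Igt (z * q ^ k) \<longleftrightarrow> y \<in> {y \<in> II. 0 < y}) sequentially"
    proof (cases "0 < y")
      case True
      from ev[OF this] show ?thesis by eventually_elim (use True in auto)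
    next
      case False
      then have "y < 0" using I_nonzero[OF \<open>y \<in> II\<close>] by simp
      then have "\<not> z * q ^ k < y" for k using ppos[of y k] by simp
      then show ?thesis using False by simp
    qed
  qed
  have \<beta>n: "(\<lambda>k. \<beta> (- (q ^ k))) \<longlonglongrightarrow> \<beta>0"
    unfolding \<beta> \<beta>0_def
  proof (rule infsum_tendsto_of_eventually_eq[OF sb'[OF minus_1_in_I]])
    show "Igt (- (q ^ k)) \<subseteq> Igt (- 1)" for k
      using I_ge[OF neg_in_I, of k] by auto
    show "{y \<in> II. 0 < y} \<subseteq> Igt (- 1)" by auto
    fix y assume "y \<in> Igt (- 1)"
    then have "y \<in> II" by simp
    then show "eventually (\<lambda>k. y \<in> Igt (- (q ^ k)) \<longleftrightarrow> y \<in> {y \<in> II. 0 < y}) sequentially"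
    proof (cases "0 < y")
      case True
      have "- (q ^ k) < y" for k using nneg[OF True, of k] by simp
      then show ?thesis using True \<open>y \<in> II\<close> by simp
    next
      case False
      then have "y < 0" using I_nonzero[OF \<open>y \<in> II\<close>] by simp
      from ev'[OF this] show ?thesis by eventually_elim (use False in auto)
    qed
  qed
  have fk: "f x = (\<psi> x * \<alpha> x + \<phi> x * \<beta> x) / \<kappa>" if "x \<in> II" for x
    using f[OF that] \<kappa>(2) by (simp add: field_simps)
  have L1: "(\<lambda>k. f (z * q ^ k)) \<longlonglongrightarrow> (l' * \<alpha>0 + l * \<beta>0) / \<kappa>"
    unfolding fk[OF pos_in_I_power(1)] using \<phi>(3) \<psi>(2) \<kappa>(2) unfolding data_def
    by (intro tendsto_intros \<alpha>p \<beta>p) auto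
  have L2: "(\<lambda>k. f (- (q ^ k))) \<longlonglongrightarrow> (l' * \<alpha>0 + l * \<beta>0) / \<kappa>"
    unfolding fk[OF neg_in_I] using \<phi>(3) \<psi>(2) \<kappa>(2) unfolding data_def
    by (intro tendsto_intros \<alpha>n \<beta>n) auto
  \<comment> \<open>On the negative side the values of \<alpha> and \<beta> at x may also be used at
    q x, since the changes of the two sums cancel; no additional term appears.\<close>
  have Dn: "Dq q f x = (Dq q \<psi> x * \<alpha> x + Dq q \<phi> x * \<beta> x) / \<kappa>" if x: "x \<in> II" "x < 0" for x
  proof -
    have "\<kappa> * f (q * x) = \<psi> (q * x) * \<alpha> x + \<phi> (q * x) * \<beta> x"
      unfolding f[OF I_mult_q[OF x(1)]] step_neg[OF x] by (simp add: algebra_simps)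
    then have "\<kappa> * (f x - f (q * x)) = (\<psi> x - \<psi> (q * x)) * \<alpha> x + (\<phi> x - \<phi> (q * x)) * \<beta> x"
      unfolding right_diff_distrib f[OF x(1)] by (simp add: algebra_simps)
    then have "f x - f (q * x) = ((\<psi> x - \<psi> (q * x)) * \<alpha> x + (\<phi> x - \<phi> (q * x)) * \<beta> x) / \<kappa>"
      using \<kappa>(2) by (simp add: field_simps)
    then show ?thesis unfolding Dq_def by (simp add: add_divide_distrib mult.commute)
  qed
  have L3: "(\<lambda>k. Dq q f (- (q ^ k))) \<longlonglongrightarrow> (m' * \<alpha>0 + m * \<beta>0) / \<kappa>"
  proof -
    have "- (q ^ k) < 0" for k using q_pos by simp
    note D = Dn[OF neg_in_I this]
    show ?thesis
      unfolding D using \<phi>(3) \<psi>(2) \<kappa>(2) unfolding data_def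
      by (intro tendsto_intros \<alpha>n \<beta>n) auto
  qed
  \<comment> \<open>On the positive side the cut passes x itself and leaves a determinant times
    \<open>G x\<close>; this tends to 0 by \<open>HH_origin_tendsto_0\<close>.\<close>
  have Dp: "Dq q f x = (Dq q \<psi> x * \<alpha> x + Dq q \<phi> x * \<beta> x - (\<phi> x * Dq q \<psi> x - \<psi> x * Dq q \<phi> x) * G x) / \<kappa>"
    if x: "x \<in> II" "0 < x" for x
  proof -
    have "\<kappa> * f (q * x) = \<psi> (q * x) * (\<alpha> x - \<phi> x * G x) + \<phi> (q * x) * (\<beta> x + \<psi> x * G x)"
      unfolding f[OF I_mult_q[OF x(1)]] step_pos[OF x] by (simp add: algebra_simps)
    then have "\<kappa> * (f x - f (q * x)) = (\<psi> x - \<psi> (q * x)) * \<alpha> x + (\<phi> x - \<phi> (q * x)) * \<beta> x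
        - (\<phi> x * (\<psi> x - \<psi> (q * x)) - \<psi> x * (\<phi> x - \<phi> (q * x))) * G x"
      unfolding right_diff_distrib f[OF x(1)] by (simp add: algebra_simps)
    then have "f x - f (q * x) = ((\<psi> x - \<psi> (q * x)) * \<alpha> x + (\<phi> x - \<phi> (q * x)) * \<beta> x
        - (\<phi> x * (\<psi> x - \<psi> (q * x)) - \<psi> x * (\<phi> x - \<phi> (q * x))) * G x) / \<kappa>"
      using \<kappa>(2) by (simp add: field_simps)
    moreover have "(u * s + v * t - (P * u - R * v) * w) / \<kappa> / d
        = (u / d * s + v / d * t - (P * (u / d) - R * (v / d)) * w) / \<kappa>" for u v s t P R w d :: complex
      by (simp add: divide_inverse algebra_simps)
    ultimately show ?thesis unfolding Dq_def by (simp only:)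
  qed
  have L4: "(\<lambda>k. Dq q f (z * q ^ k)) \<longlonglongrightarrow> (m' * \<alpha>0 + m * \<beta>0) / \<kappa>"
  proof -
    have "0 < z * q ^ k" for k using z_pos q_pos by simp
    note D = Dp[OF pos_in_I_power(1) this]
    have "(\<lambda>k. G (z * q ^ k)) \<longlonglongrightarrow> 0" unfolding G_def by (rule HH_origin_tendsto_0[OF g])
    then have "(\<lambda>k. Dq q f (z * q ^ k)) \<longlonglongrightarrow> (m' * \<alpha>0 + m * \<beta>0 - (l * m' - l' * m) * 0) / \<kappa>"
      unfolding D using \<phi>(3) \<psi>(2) \<kappa>(2) unfolding data_def
      by (intro tendsto_intros \<alpha>p \<beta>p) auto
    then show ?thesis by simp
  qed
  show "\<exists>L M. data (green \<kappa> \<phi> \<psi> g) L M"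
    unfolding f_def[symmetric] using limits_of_data[OF L1 L4 L2 L3] by blast
qed

section \<open>The index of a point at infinity, and exponential bounds in terms of it\<close>

definition nn :: "real \<Rightarrow> nat"
  where "nn x = (if x \<le> z then 0 else nat (- idx z x))"

text \<open>Up to z the weight is summable and is kept. Beyond z its square root is of order a^(-k)
  and is used up by the factor a^k of the solutions, so that 1 remains.\<close>

definition pp :: "real \<Rightarrow> real"
  where "pp x = (if x \<le> z then sqrt (wt x) else 1)"

lemma nn_div_power [simp]: "nn (z / q ^ k) = k"
proof (cases k)
  case 0
  then show ?thesis by (simp add: nn_def)
next
  case (Suc j)
  have "z < z / q ^ k"
    using z_pos q_pos q_less_1 power_Suc_less_one[of q j] Suc by (simp add: divide_simps)
  moreover have "idx z (z / q ^ k) = - int k"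
    using idx[of z "- int k"] z_pos by (simp add: div_power_eq_powi)
  ultimately show ?thesis by (simp add: nn_def)
qed

lemma I_infinity_cases:
  assumes "x \<in> II" "z < x"
  obtains k where "x = z / q ^ Suc k"
proof -
  have "x \<notin> Ineg"
  proof
    assume "x \<in> Ineg"
    then obtain k where "x = - (q ^ k)" by (auto simp: Ineg_def)
    then show False using assms(2) z_pos q_pos zero_less_power[of q k] by linarith
  qed
  then have "x \<in> Ipos" using assms(1) unfolding II_eq by blast
  moreover have "z * q ^ k \<le> z" for k
    by (rule mult_power_le)
  then have "x \<notin> range (\<lambda>k. z * q ^ k)" using assms(2) by (auto simp: not_le[symmetric])
  ultimately have "x \<in> range (\<lambda>k. z / q ^ Suc k)" unfolding Ipos_split by blast
  then show ?thesis using that by blast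
qed

lemma div_power_greater: "z < z / q ^ Suc k"
  using z_pos q_pos q_less_1 power_Suc_less_one[of q k] by (simp add: divide_simps)

lemma nn_mono: assumes "x \<in> II" "y \<in> II" "x \<le> y" shows "nn x \<le> nn y"
proof (cases "x \<le> z")
  case True
  then show ?thesis by (simp add: nn_def)
next
  case False
  obtain j where j: "x = z / q ^ Suc j" using False assms by (meson I_infinity_cases not_le)
  obtain k where k: "y = z / q ^ Suc k" using False assms by (meson I_infinity_cases not_le order_trans)
  have "Suc j \<le> Suc k"
  proof (rule ccontr)
    assume "\<not> Suc j \<le> Suc k"
    then have "q ^ Suc j < q ^ Suc k" using q_pos q_less_1 by (intro power_strict_decreasing) auto
    then have "z / q ^ Suc k < z / q ^ Suc j" using z_pos q_pos by (intro divide_strict_left_mono) auto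
    then show False using assms(3) j k by simp
  qed
  then show ?thesis unfolding j k nn_div_power .
qed

text \<open>Subtraction of naturals is truncated, so the exponent is |N - n|; each of its values is
  taken at most twice.\<close>

lemma sum_geometric_distance:
  fixes r :: real
  assumes r: "0 \<le> r" "r < 1" and F: "finite F"
  shows "(\<Sum>n\<in>F. r ^ ((N - n) + (n - N))) \<le> 2 / (1 - r)"
proof -
  have geo: "(\<Sum>j\<in>X. r ^ j) \<le> 1 / (1 - r)" if "finite X" for X
    using sum_le_suminf[OF summable_geometric[of r] that] r by (simp add: suminf_geometric)
  have "(\<Sum>n\<in>F. r ^ ((N - n) + (n - N))) = (\<Sum>n\<in>{n\<in>F. n \<le> N}. r ^ ((N - n) + (n - N))) + (\<Sum>n\<in>{n\<in>F. \<not> n \<le> N}. r ^ ((N - n) + (n - N)))"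
    using F by (subst sum.union_disjoint[symmetric]) (auto intro!: sum.cong)
  also have "(\<Sum>n\<in>{n\<in>F. n \<le> N}. r ^ ((N - n) + (n - N))) = (\<Sum>j\<in>(\<lambda>n. N - n) ` {n\<in>F. n \<le> N}. r ^ j)"
    by (subst sum.reindex) (auto simp: inj_on_def intro!: sum.cong)
  also have "(\<Sum>n\<in>{n\<in>F. \<not> n \<le> N}. r ^ ((N - n) + (n - N))) = (\<Sum>j\<in>(\<lambda>n. n - N) ` {n\<in>F. \<not> n \<le> N}. r ^ j)"
    by (subst sum.reindex) (auto simp: inj_on_def intro!: sum.cong)
  finally show ?thesis
    using geo[of "(\<lambda>n. N - n) ` {n\<in>F. n \<le> N}"] geo[of "(\<lambda>n. n - N) ` {n\<in>F. \<not> n \<le> N}"] F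
    by simp
qed

lemma wt_summable_Ile: "wt summable_on Ile z"
proof -
  define h :: "real \<Rightarrow> complex" where "h x = (if x \<in> Ile z then 1 else 0)" for x
  have "nsq h summable_on II"
  proof (rule summable_on_IIi)
    have "\<not> z / q ^ Suc k \<le> z" for k using div_power_greater[of k] by simp
    then have "nsq h (z / q ^ Suc k) = 0" for k by (simp add: nsq_def h_def del: power_Suc)
    then show "summable (\<lambda>k. nsq h (z / q ^ Suc k))" by simp
    have "z * q ^ k \<le> z" for k
  by (rule mult_power_le)
    then have "nsq h (z * q ^ k) = wt (z * q ^ k)" for k by (simp add: nsq_def h_def)
    then show "summable (\<lambda>k. nsq h (z * q ^ k))" using wt_summable_0 by simp
    have "- (q ^ k) \<le> z" for k by (rule neg_power_le)
    then have "nsq h (- (q ^ k)) = wt (- (q ^ k))" for k by (simp add: nsq_def h_def)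
    then show "summable (\<lambda>k. nsq h (- (q ^ k)))" using wt_summable_0 by simp
  qed auto
  then have "nsq h summable_on Ile z" by (rule summable_on_subset) auto
  then show ?thesis by (rule summable_on_cong[THEN iffD1, rotated]) (simp add: nsq_def h_def)
qed

text \<open>Points up to z contribute at most the total weight there. A point beyond z is determined
  by its index, so the others contribute at most a two-sided geometric series.\<close>

lemma kernel_row_sum:
  assumes r: "0 \<le> r" "r < 1"
  obtains S where "0 \<le> S" "\<And>x. (\<lambda>y. (pp y)\<^sup>2 * r ^ ((nn x - nn y) + (nn y - nn x))) summable_on II"
    "\<And>x. (\<Sum>\<^sub>\<infinity>y\<in>II. (pp y)\<^sup>2 * r ^ ((nn x - nn y) + (nn y - nn x))) \<le> S"
proof -
  define S where "S = infsum wt (Ile z) + 2 / (1 - r)"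
  have fin: "(\<Sum>y\<in>F. (pp y)\<^sup>2 * r ^ ((nn x - nn y) + (nn y - nn x))) \<le> S" if F: "finite F" "F \<subseteq> II" for F x
  proof -
    let ?t = "\<lambda>y. (pp y)\<^sup>2 * r ^ ((nn x - nn y) + (nn y - nn x))"
    have "sum ?t F = sum ?t {y\<in>F. y \<le> z} + sum ?t {y\<in>F. \<not> y \<le> z}"
      using F by (subst sum.union_disjoint[symmetric]) (auto intro!: sum.cong)
    moreover have "sum ?t {y\<in>F. y \<le> z} \<le> infsum wt (Ile z)"
    proof -
      have "sum ?t {y\<in>F. y \<le> z} \<le> sum wt {y\<in>F. y \<le> z}"
      proof (rule sum_mono)
        fix y assume y: "y \<in> {y\<in>F. y \<le> z}"
        then have "(pp y)\<^sup>2 = wt y" "0 < wt y" using wt_pos[of y] F by (auto simp: pp_def)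
        moreover have "r ^ ((nn x - nn y) + (nn y - nn x)) \<le> 1" using r by (intro power_le_one) auto
        ultimately show "?t y \<le> wt y" by (simp add: mult_left_le)
      qed
      also have "\<dots> \<le> infsum wt (Ile z)"
        using F wt_pos by (intro finite_sum_le_infsum wt_summable_Ile) (auto simp: less_imp_le)
      finally show ?thesis .
    qed
    moreover have "sum ?t {y\<in>F. \<not> y \<le> z} \<le> 2 / (1 - r)"
    proof -
      have inj: "inj_on nn {y\<in>F. \<not> y \<le> z}"
      proof (rule inj_onI)
        fix x y assume xy: "x \<in> {y\<in>F. \<not> y \<le> z}" "y \<in> {y\<in>F. \<not> y \<le> z}" "nn x = nn y"
        then obtain j where j: "x = z / q ^ Suc j" using F by (force elim: I_infinity_cases)
        obtain k where k: "y = z / q ^ Suc k" using xy F by (force elim: I_infinity_cases)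
        show "x = y" using xy(3) unfolding j k nn_div_power by simp
      qed
      have "sum ?t {y\<in>F. \<not> y \<le> z} = (\<Sum>y\<in>{y\<in>F. \<not> y \<le> z}. r ^ ((nn x - nn y) + (nn y - nn x)))"
        by (intro sum.cong) (auto simp: pp_def)
      also have "\<dots> = (\<Sum>n\<in>nn ` {y\<in>F. \<not> y \<le> z}. r ^ ((nn x - n) + (n - nn x)))"
        by (simp add: sum.reindex[OF inj])
      also have "\<dots> \<le> 2 / (1 - r)" using F by (intro sum_geometric_distance r) auto
      finally show ?thesis .
    qed
    ultimately show ?thesis by (simp add: S_def)
  qed
  have nonneg: "0 \<le> (pp y)\<^sup>2 * r ^ ((nn x - nn y) + (nn y - nn x))" for x y using r by simp
  have "0 \<le> S" using fin[of "{}"] by simp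
  then show ?thesis
    using that[of S] nonneg_summable_infsum_le[of II "\<lambda>y. (pp y)\<^sup>2 * r ^ ((nn x - nn y) + (nn y - nn x))" S for x]
      nonneg fin by blast
qed

text \<open>By \<open>wt_asymptotics\<close> the square root of the weight cancels the factor a^k of
  the solution; up to z boundedness suffices.\<close>

lemma asymptotic_bound:
  assumes s: "s \<noteq> 0" and f: "data f l m" "(\<lambda>k. f (z / q ^ k) / (of_real a * s) ^ k) \<longlonglongrightarrow> L"
  obtains C where "0 < C" "\<And>x. x \<in> II \<Longrightarrow> norm (f x) * sqrt (wt x) \<le> C * pp x * norm s ^ nn x"
proof -
  obtain W where W: "0 < W" "(\<lambda>k. wt (z / q ^ k) * a ^ (2 * k)) \<longlonglongrightarrow> W" by (rule wt_asymptotics)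
  obtain C1 where C1: "0 < C1" "\<And>x. x \<in> II \<Longrightarrow> x \<le> z \<Longrightarrow> norm (f x) \<le> C1" using data_Bseq[OF f(1)] by blast
  have "(\<lambda>k. norm (f (z / q ^ k) / (of_real a * s) ^ k) * sqrt (wt (z / q ^ k) * a ^ (2 * k))) \<longlonglongrightarrow> norm L * sqrt W"
    by (intro tendsto_intros f W)
  then have "Bseq (\<lambda>k. norm (f (z / q ^ k) / (of_real a * s) ^ k) * sqrt (wt (z / q ^ k) * a ^ (2 * k)))"
    using convergent_imp_Bseq convergentI by blast
  then obtain C2 where C2: "0 < C2" "\<And>k. norm (norm (f (z / q ^ k) / (of_real a * s) ^ k) * sqrt (wt (z / q ^ k) * a ^ (2 * k))) \<le> C2"
    by (auto simp: Bseq_def)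
  have inf: "norm (f (z / q ^ k)) * sqrt (wt (z / q ^ k)) \<le> C2 * norm s ^ k" for k
  proof -
    have "sqrt (a ^ (2 * k)) = a ^ k"
      using a_pos by (simp add: power_mult[of a k 2] mult.commute[of 2 k])
    then have "norm (f (z / q ^ k) / (of_real a * s) ^ k) * sqrt (wt (z / q ^ k) * a ^ (2 * k))
        = norm (f (z / q ^ k)) * sqrt (wt (z / q ^ k)) / norm s ^ k"
      using a_pos by (simp add: real_sqrt_mult norm_divide norm_mult norm_power power_mult_distrib)
    then have "norm (f (z / q ^ k)) * sqrt (wt (z / q ^ k)) / norm s ^ k \<le> C2"
      using C2(2)[of k] by (simp only: real_norm_def abs_le_iff)
    then show ?thesis using s by (simp add: pos_divide_le_eq)
  qed
  have "norm (f x) * sqrt (wt x) \<le> max C1 C2 * pp x * norm s ^ nn x" if x: "x \<in> II" for x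
  proof (cases "x \<le> z")
    case True
    have "norm (f x) * sqrt (wt x) \<le> max C1 C2 * sqrt (wt x)"
      using C1(2)[OF x True] wt_pos[OF x] by (intro mult_right_mono) auto
    then show ?thesis using True by (simp add: pp_def nn_def)
  next
    case False
    then obtain k where k: "x = z / q ^ Suc k" using I_infinity_cases[OF x] by auto
    have "C2 * norm s ^ Suc k \<le> max C1 C2 * norm s ^ Suc k" by (intro mult_right_mono) auto
    moreover have "pp x = 1" using False by (simp add: pp_def)
    ultimately show ?thesis using inf[of "Suc k"] unfolding k nn_div_power by simp
  qed
  then show ?thesis using that[of "max C1 C2"] C1 by simp
qed

lemma HH_of_asymptotics:
  assumes s: "s \<noteq> 0" "norm s < 1" and f: "data f l m" "(\<lambda>k. f (z / q ^ k) / (of_real a * s) ^ k) \<longlonglongrightarrow> L"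
    and off: "\<And>x. x \<notin> II \<Longrightarrow> f x = 0"
  shows "f \<in> HH"
proof (rule HH_of_data[OF f(1) off])
  obtain C where C: "0 < C" "\<And>x. x \<in> II \<Longrightarrow> norm (f x) * sqrt (wt x) \<le> C * pp x * norm s ^ nn x"
    using asymptotic_bound[OF s(1) f] by blast
  show "summable (\<lambda>k. nsq f (z / q ^ Suc k))"
  proof (rule summable_comparison_test')
    have "norm ((norm s)\<^sup>2) < 1" using s by (simp add: power_less_one_iff)
    then show "summable (\<lambda>k. C\<^sup>2 * (norm s)\<^sup>2 * ((norm s)\<^sup>2) ^ k)"
      by (intro summable_mult summable_geometric)
    fix k :: nat
    let ?x = "z / q ^ Suc k"
    have w: "0 < wt ?x" by (rule wt_pos[OF pos_in_I_power(2)])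
    have "norm (f ?x) * sqrt (wt ?x) \<le> C * norm s ^ Suc k"
      using C(2)[OF pos_in_I_power(2), of "Suc k"] div_power_greater[of k]
      unfolding nn_div_power by (simp add: pp_def del: power_Suc)
    then have "(norm (f ?x) * sqrt (wt ?x))\<^sup>2 \<le> (C * norm s ^ Suc k)\<^sup>2"
      using w by (intro power_mono) auto
    then show "norm (nsq f ?x) \<le> C\<^sup>2 * (norm s)\<^sup>2 * ((norm s)\<^sup>2) ^ k"
      using w by (simp add: nsq_def power_mult_distrib abs_mult power_mult[symmetric] power_add[symmetric] mult_ac del: power_Suc)
  qed
qed

text \<open>The Green kernel decays exponentially in the distance of the indices near infinity,
  so that the Schur test applies.\<close>
theorem green_bounded:
  assumes r: "0 < r" "r < 1" and C: "0 < C"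
    and \<phi>: "\<And>x. x \<in> II \<Longrightarrow> norm (\<phi> x) * sqrt (wt x) \<le> C * pp x * (1 / r) ^ nn x"
    and \<psi>: "\<And>x. x \<in> II \<Longrightarrow> norm (\<psi> x) * sqrt (wt x) \<le> C * pp x * r ^ nn x"
    and \<kappa>: "\<kappa> \<noteq> 0"
  obtains M where "\<And>g x. g \<in> HH \<Longrightarrow> x \<in> II \<Longrightarrow> (\<lambda>y. \<phi> y * (g y * of_real (wt y))) summable_on Ile x"
    "\<And>g x. g \<in> HH \<Longrightarrow> x \<in> II \<Longrightarrow> (\<lambda>y. \<psi> y * (g y * of_real (wt y))) summable_on Igt x"
    "\<And>g. g \<in> HH \<Longrightarrow> green \<kappa> \<phi> \<psi> g \<in> HH"
    "\<And>g. g \<in> HH \<Longrightarrow> NN (green \<kappa> \<phi> \<psi> g) \<le> M * NN g"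
proof -
  obtain S where S: "0 \<le> S" "\<And>x. (\<lambda>y. (pp y)\<^sup>2 * r ^ ((nn x - nn y) + (nn y - nn x))) summable_on II"
    "\<And>x. (\<Sum>\<^sub>\<infinity>y\<in>II. (pp y)\<^sup>2 * r ^ ((nn x - nn y) + (nn y - nn x))) \<le> S"
    using kernel_row_sum[of r] r by auto
  define \<rho> where "\<rho> x y = r ^ ((nn x - nn y) + (nn y - nn x))" for x y
  \<comment> \<open>\<open>schur_test\<close> asks for nonnegativity on the whole type, whereas
    \<open>wt\<close> and hence \<open>pp\<close> may be negative off \<open>II\<close>.\<close>
  define ppp where "ppp x = \<bar>pp x\<bar>" for x
  have ppp: "ppp x = pp x" if "x \<in> II" for x
    using wt_pos[OF that] by (simp add: ppp_def pp_def)
  define D where "D = 2 * C\<^sup>2 / norm \<kappa>"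
  have D0: "0 \<le> D" by (simp add: D_def)
  have main: "(\<lambda>y. \<phi> y * (g y * of_real (wt y))) summable_on Ile x \<and>
      (\<lambda>y. \<psi> y * (g y * of_real (wt y))) summable_on Igt x \<and>
      norm (green \<kappa> \<phi> \<psi> g x) * sqrt (wt x) \<le> D * (ppp x * (\<Sum>\<^sub>\<infinity>y\<in>II. ppp y * \<rho> x y * (norm (g y) * sqrt \<bar>wt y\<bar>)))"
    if g: "g \<in> HH" and x: "x \<in> II"
      and s: "(\<lambda>y. ppp y * \<rho> x y * (norm (g y) * sqrt \<bar>wt y\<bar>)) summable_on II" for g x
  proof -
    let ?T = "\<lambda>y. ppp y * \<rho> x y * (norm (g y) * sqrt \<bar>wt y\<bar>)"
    \<comment> \<open>For y \<le> x the bound of \<open>\<phi>\<close> at y is the one at x times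
      r^(nn x - nn y), so the kernel decays with the distance of the indices. The growth (1/r)^(nn
      x) is cancelled later by r^(nn x) from \<open>\<psi> x\<close>.\<close>
    have n\<phi>: "norm (\<phi> y * (g y * of_real (wt y))) \<le> C * (1 / r) ^ nn x * ?T y" if "y \<in> Ile x" for y
    proof -
      have y: "y \<in> II" "y \<le> x" using that by auto
      have le: "nn y \<le> nn x" by (rule nn_mono[OF y(1) x y(2)])
      have w: "0 < wt y" by (rule wt_pos[OF y(1)])
      have "norm (\<phi> y * (g y * of_real (wt y))) = (norm (\<phi> y) * sqrt (wt y)) * (norm (g y) * sqrt \<bar>wt y\<bar>)"
        using w real_sqrt_mult_self[of "wt y"] by (simp add: norm_mult mult_ac)
      also have "\<dots> \<le> (C * pp y * (1 / r) ^ nn y) * (norm (g y) * sqrt \<bar>wt y\<bar>)"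
        using w by (intro mult_right_mono \<phi> y) auto
      also have "(1 / r) ^ nn y = (1 / r) ^ nn x * \<rho> x y"
        unfolding \<rho>_def using le r by (simp add: power_one_over power_diff field_simps)
      finally show ?thesis unfolding ppp[OF y(1)] by (simp add: mult_ac)
    qed
    have n\<psi>: "norm (\<psi> y * (g y * of_real (wt y))) \<le> C * r ^ nn x * ?T y" if "y \<in> Igt x" for y
    proof -
      have y: "y \<in> II" "x \<le> y" using that by auto
      have le: "nn x \<le> nn y" by (rule nn_mono[OF x y])
      have w: "0 < wt y" by (rule wt_pos[OF y(1)])
      have "norm (\<psi> y * (g y * of_real (wt y))) = (norm (\<psi> y) * sqrt (wt y)) * (norm (g y) * sqrt \<bar>wt y\<bar>)"
        using w real_sqrt_mult_self[of "wt y"] by (simp add: norm_mult mult_ac)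
      also have "\<dots> \<le> (C * pp y * r ^ nn y) * (norm (g y) * sqrt \<bar>wt y\<bar>)"
        using w by (intro mult_right_mono \<psi> y) auto
      also have "r ^ nn y = r ^ nn x * \<rho> x y"
        unfolding \<rho>_def using le by (simp add: power_add[symmetric])
      finally show ?thesis unfolding ppp[OF y(1)] by (simp add: mult_ac)
    qed
    have Tn: "0 \<le> ?T y" for y using r by (simp add: \<rho>_def ppp_def)
    have sT: "?T summable_on X" if "X \<subseteq> II" for X using s that by (rule summable_on_subset)
    have a\<phi>: "(\<lambda>y. norm (\<phi> y * (g y * of_real (wt y)))) summable_on Ile x"
      by (rule summable_on_comparison_test[OF summable_on_cmult_right[OF sT] n\<phi>]) auto
    have a\<psi>: "(\<lambda>y. norm (\<psi> y * (g y * of_real (wt y)))) summable_on Igt x"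
      by (rule summable_on_comparison_test[OF summable_on_cmult_right[OF sT] n\<psi>]) auto
    have le\<alpha>: "norm (aL \<phi> g x) \<le> C * (1 / r) ^ nn x * infsum ?T II"
    proof -
      have "norm (aL \<phi> g x) \<le> (\<Sum>\<^sub>\<infinity>y\<in>Ile x. norm (\<phi> y * (g y * of_real (wt y))))"
        unfolding aL_def by (rule norm_infsum_bound[OF a\<phi>])
      also have "\<dots> \<le> (\<Sum>\<^sub>\<infinity>y\<in>Ile x. C * (1 / r) ^ nn x * ?T y)"
        by (intro infsum_mono a\<phi> summable_on_cmult_right sT n\<phi>) auto
      also have "\<dots> = C * (1 / r) ^ nn x * infsum ?T (Ile x)"
        by (intro infsum_cmult_right sT) auto
      also have "\<dots> \<le> C * (1 / r) ^ nn x * infsum ?T II"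
        using C r Tn by (intro mult_left_mono infsum_mono2 sT) auto
      finally show ?thesis .
    qed
    have le\<beta>: "norm (bR \<psi> g x) \<le> C * r ^ nn x * infsum ?T II"
    proof -
      have "norm (bR \<psi> g x) \<le> (\<Sum>\<^sub>\<infinity>y\<in>Igt x. norm (\<psi> y * (g y * of_real (wt y))))"
        unfolding bR_def by (rule norm_infsum_bound[OF a\<psi>])
      also have "\<dots> \<le> (\<Sum>\<^sub>\<infinity>y\<in>Igt x. C * r ^ nn x * ?T y)"
        by (intro infsum_mono a\<psi> summable_on_cmult_right sT n\<psi>) auto
      also have "\<dots> = C * r ^ nn x * infsum ?T (Igt x)"
        by (intro infsum_cmult_right sT) auto
      also have "\<dots> \<le> C * r ^ nn x * infsum ?T II"
        using C r Tn by (intro mult_left_mono infsum_mono2 sT) auto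
      finally show ?thesis .
    qed
    define I where "I = infsum ?T II"
    have I0: "0 \<le> I" unfolding I_def using Tn by (intro infsum_nonneg) auto
    have sw: "0 \<le> sqrt (wt x)" using wt_pos[OF x] by simp
    have cancel: "r ^ nn x * (1 / r) ^ nn x = 1" using r by (simp add: power_mult_distrib[symmetric])
    have "norm (green \<kappa> \<phi> \<psi> g x) * norm \<kappa> = norm (\<psi> x * aL \<phi> g x + \<phi> x * bR \<psi> g x)"
      using x \<kappa> by (simp add: green_def norm_divide)
    also have "\<dots> \<le> norm (\<psi> x) * norm (aL \<phi> g x) + norm (\<phi> x) * norm (bR \<psi> g x)"
      using norm_triangle_ineq[of "\<psi> x * aL \<phi> g x" "\<phi> x * bR \<psi> g x"] by (simp add: norm_mult)
    finally have "norm (green \<kappa> \<phi> \<psi> g x) * norm \<kappa> * sqrt (wt x)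
        \<le> (norm (\<psi> x) * norm (aL \<phi> g x) + norm (\<phi> x) * norm (bR \<psi> g x)) * sqrt (wt x)"
      using sw by (rule mult_right_mono)
    also have "\<dots> = (norm (\<psi> x) * sqrt (wt x)) * norm (aL \<phi> g x) + (norm (\<phi> x) * sqrt (wt x)) * norm (bR \<psi> g x)"
      by (simp add: algebra_simps)
    also have "\<dots> \<le> (C * pp x * r ^ nn x) * (C * (1 / r) ^ nn x * I) + (C * pp x * (1 / r) ^ nn x) * (C * r ^ nn x * I)"
    proof (rule add_mono)
      have pp0: "0 \<le> pp x" using ppp[OF x] by (metis abs_ge_zero ppp_def)
      show "(norm (\<psi> x) * sqrt (wt x)) * norm (aL \<phi> g x) \<le> (C * pp x * r ^ nn x) * (C * (1 / r) ^ nn x * I)"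
        unfolding I_def using pp0 C r by (intro mult_mono \<psi>[OF x] le\<alpha>) auto
      show "(norm (\<phi> x) * sqrt (wt x)) * norm (bR \<psi> g x) \<le> (C * pp x * (1 / r) ^ nn x) * (C * r ^ nn x * I)"
        unfolding I_def using pp0 C r by (intro mult_mono \<phi>[OF x] le\<beta>) auto
    qed
    also have "\<dots> = 2 * C\<^sup>2 * (ppp x * I) * (r ^ nn x * (1 / r) ^ nn x)"
      unfolding ppp[OF x] power2_eq_square by (simp only: mult_ac mult_2 distrib_left distrib_right)
    finally have "norm (green \<kappa> \<phi> \<psi> g x) * sqrt (wt x) * norm \<kappa> \<le> 2 * C\<^sup>2 * (ppp x * I)"
      unfolding cancel by (simp add: mult_ac)
    then have "norm (green \<kappa> \<phi> \<psi> g x) * sqrt (wt x) \<le> D * (ppp x * I)"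
      using \<kappa> by (simp add: D_def field_simps)
    then show ?thesis
      using abs_summable_summable[OF a\<phi>] abs_summable_summable[OF a\<psi>] unfolding I_def by blast
  qed
  have schur: "(\<forall>x\<in>II. (\<lambda>y. ppp y * \<rho> x y * (norm (g y) * sqrt \<bar>wt y\<bar>)) summable_on II)
    \<and> (\<lambda>x. (ppp x * (\<Sum>\<^sub>\<infinity>y\<in>II. ppp y * \<rho> x y * (norm (g y) * sqrt \<bar>wt y\<bar>)))\<^sup>2) summable_on II
    \<and> (\<Sum>\<^sub>\<infinity>x\<in>II. (ppp x * (\<Sum>\<^sub>\<infinity>y\<in>II. ppp y * \<rho> x y * (norm (g y) * sqrt \<bar>wt y\<bar>)))\<^sup>2)
       \<le> S\<^sup>2 * infsum (nsq g) II" if g: "g \<in> HH" for g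
  proof -
    have v: "(norm (g y) * sqrt \<bar>wt y\<bar>)\<^sup>2 = nsq g y" if "y \<in> II" for y
      using wt_pos[OF that] by (simp add: nsq_def power_mult_distrib)
    have sv: "(\<lambda>y. (norm (g y) * sqrt \<bar>wt y\<bar>)\<^sup>2) summable_on II"
      using g summable_on_cong[of II "\<lambda>y. (norm (g y) * sqrt \<bar>wt y\<bar>)\<^sup>2" "nsq g"] v by (simp add: HH_iff)
    have pp2: "(ppp y)\<^sup>2 * \<rho> x y = (pp y)\<^sup>2 * r ^ ((nn x - nn y) + (nn y - nn x))" for x y
      by (simp add: ppp_def \<rho>_def)
    have iv: "(\<Sum>\<^sub>\<infinity>x\<in>II. (norm (g x) * sqrt \<bar>wt x\<bar>)\<^sup>2) = infsum (nsq g) II"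
      by (rule infsum_cong[OF v])
    note sch = schur_test[of \<rho> ppp "\<lambda>y. norm (g y) * sqrt \<bar>wt y\<bar>" II S, OF _ _ _ _ _ sv, unfolded pp2 iv]
    have c1: "0 \<le> \<rho> x y" for x y using r by (simp add: \<rho>_def)
    have c2: "\<rho> x y \<le> 1" for x y using r by (simp add: \<rho>_def power_le_one)
    have c3: "\<rho> x y = \<rho> y x" for x y by (simp add: \<rho>_def add.commute)
    have c4: "0 \<le> ppp x" for x by (simp add: ppp_def)
    have c5: "0 \<le> norm (g y) * sqrt \<bar>wt y\<bar>" for y by simp
    show ?thesis using sch[OF c1 c2 c3 c4 c5 S(2) S(3) S(1)] by blast
  qed
  have nle: "nsq (green \<kappa> \<phi> \<psi> g) x \<le> D\<^sup>2 * (ppp x * (\<Sum>\<^sub>\<infinity>y\<in>II. ppp y * \<rho> x y * (norm (g y) * sqrt \<bar>wt y\<bar>)))\<^sup>2"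
    if g: "g \<in> HH" and x: "x \<in> II" for g x
  proof -
    have w: "0 < wt x" by (rule wt_pos[OF x])
    have "norm (green \<kappa> \<phi> \<psi> g x) * sqrt (wt x) \<le> D * (ppp x * (\<Sum>\<^sub>\<infinity>y\<in>II. ppp y * \<rho> x y * (norm (g y) * sqrt \<bar>wt y\<bar>)))"
      using main[OF g x] schur[OF g] x by blast
    then have "(norm (green \<kappa> \<phi> \<psi> g x) * sqrt (wt x))\<^sup>2 \<le> (D * (ppp x * (\<Sum>\<^sub>\<infinity>y\<in>II. ppp y * \<rho> x y * (norm (g y) * sqrt \<bar>wt y\<bar>))))\<^sup>2"
      using w by (intro power_mono) auto
    then show ?thesis using w by (simp add: nsq_def power_mult_distrib)
  qed
  have inH: "green \<kappa> \<phi> \<psi> g \<in> HH" if g: "g \<in> HH" for g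
  proof -
    have "nsq (green \<kappa> \<phi> \<psi> g) summable_on II"
      by (rule summable_on_comparison_test[OF summable_on_cmult_right nle[OF g]]) (use schur[OF g] in auto)
    then show ?thesis by (simp add: HH_iff green_def)
  qed
  have bound: "NN (green \<kappa> \<phi> \<psi> g) \<le> (D * S) * NN g" if g: "g \<in> HH" for g
  proof -
    let ?E = "\<lambda>x. (ppp x * (\<Sum>\<^sub>\<infinity>y\<in>II. ppp y * \<rho> x y * (norm (g y) * sqrt \<bar>wt y\<bar>)))\<^sup>2"
    have "infsum (nsq (green \<kappa> \<phi> \<psi> g)) II \<le> (\<Sum>\<^sub>\<infinity>x\<in>II. D\<^sup>2 * ?E x)"
      using inH[OF g] schur[OF g] nle[OF g] by (intro infsum_mono summable_on_cmult_right) (auto simp: HH_iff)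
    also have "\<dots> = D\<^sup>2 * infsum ?E II" using schur[OF g] by (intro infsum_cmult_right) auto
    also have "\<dots> \<le> D\<^sup>2 * (S\<^sup>2 * infsum (nsq g) II)" using schur[OF g] by (intro mult_left_mono) auto
    finally have "sqrt (infsum (nsq (green \<kappa> \<phi> \<psi> g)) II) \<le> sqrt ((D * S)\<^sup>2 * infsum (nsq g) II)"
      by (simp add: power_mult_distrib mult_ac)
    then show ?thesis unfolding NN_eq[OF g] NN_eq[OF inH[OF g]] using D0 S(1) by (simp add: real_sqrt_mult)
  qed
  show ?thesis
  proof (rule that[of "D * S"])
    fix g x assume gx: "g \<in> HH" "x \<in> II"
    show "(\<lambda>y. \<phi> y * (g y * of_real (wt y))) summable_on Ile x"
      "(\<lambda>y. \<psi> y * (g y * of_real (wt y))) summable_on Igt x"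
      using main[OF gx] schur[OF gx(1)] gx(2) by blast+
  qed (use inH bound in auto)
qed

section \<open>The spectrum\<close>

lemma shift_eqI:
  assumes "\<And>x. x \<in> II \<Longrightarrow> LL f x - lam * f x = g x" "\<And>x. x \<notin> II \<Longrightarrow> f x = 0" "\<And>x. x \<notin> II \<Longrightarrow> g x = 0"
  shows "shift_op LL lam f = g"
proof
  fix x
  show "shift_op LL lam f x = g x"
    using assms by (cases "x \<in> II") (simp_all add: shift_op_def LL_eq(3))
qed

lemma DD_of_shift:
  assumes "f \<in> HH" "shift_op LL lam f = g" "g \<in> HH" "data f l m"
  shows "f \<in> DD"
proof -
  have "LL f x - lam * f x = g x" for x using fun_cong[OF assms(2)] by (simp add: shift_op_def)
  then have "LL f = (\<lambda>x. 1 * g x + lam * f x)" by (simp add: fun_eq_iff diff_eq_eq)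
  then have "LL f \<in> HH" using HH_lin[OF assms(3,1), of 1 lam] by simp
  then show ?thesis using assms by (auto simp: DD_iff)
qed

lemma kernel_solution:
  assumes "f \<in> DD" "shift_op LL lam f = (\<lambda>x. 0)"
  obtains l m where "solves lam f" "bdry lam f" "data f l m"
proof -
  have "\<forall>x\<in>II. LL f x = lam * f x" using assms(2) by (simp add: shift_op_def fun_eq_iff)
  then show ?thesis using that assms(1) unfolding solution_iff DD_iff by blast
qed

lemma inj_shiftI:
  assumes "\<And>h. h \<in> DD \<Longrightarrow> shift_op LL lam h = (\<lambda>x. 0) \<Longrightarrow> \<forall>x\<in>II. h x = 0"
  shows "inj_on (shift_op LL lam) DD"
proof (rule inj_onI)
  fix f1 f2 assume f: "f1 \<in> DD" "f2 \<in> DD" "shift_op LL lam f1 = shift_op LL lam f2"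
  define h where "h = (\<lambda>x. 1 * f1 x + (- 1) * f2 x)"
  have "h \<in> DD" unfolding h_def by (rule DD_lin[OF f(1,2)])
  moreover have "shift_op LL lam h = (\<lambda>x. 0)" unfolding h_def shift_lin f(3) by simp
  ultimately have h0: "\<forall>x\<in>II. h x = 0" by (rule assms)
  have "f1 x = f2 x" for x
    using h0 f(1,2) by (cases "x \<in> II") (auto simp: h_def DD_iff HH_iff)
  then show "f1 = f2" by blast
qed

lemma data_nonzero_limit:
  assumes "solves lam \<Phi>" "data \<Phi> l m" "(\<lambda>k. \<Phi> (z / q ^ k) / s k) \<longlonglongrightarrow> 1"
  shows "l \<noteq> 0 \<or> m \<noteq> 0"
proof (rule ccontr)
  assume "\<not> ?thesis"
  then have "\<Phi> x = 0" if "x \<in> II" for x using solves_zero assms(1,2) that by simp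
  then show False using assms(3) by (simp add: LIMSEQ_const_iff)
qed

section \<open>Spectral parameters inside the unit disc\<close>

lemma disc_solutions:
  assumes g: "g \<noteq> 0" "norm g < 1" and b1: "b < 1"
  obtains \<phi> l m \<Phi> l' m' d where "solves (mu a g) \<phi>" "bdry (mu a g) \<phi>" "data \<phi> l m" "\<phi> (- 1) \<noteq> 0"
    "(\<lambda>k. \<phi> (z / q ^ k) / (of_real a * (1 / g)) ^ k) \<longlonglongrightarrow> d" "d = 0 \<longleftrightarrow> g \<in> of_real ` Sset q z a b c"
    "solves (mu a g) \<Phi>" "data \<Phi> l' m'" "(\<lambda>k. \<Phi> (z / q ^ k) / (of_real a * g) ^ k) \<longlonglongrightarrow> 1"
    "l * m' - m * l' = 0 \<longleftrightarrow> d = 0"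
proof -
  have bg: "norm (of_real b * g) < 1"
    using g b1 b_pos mult_strict_mono[of b 1 "norm g" 1] by (simp add: norm_mult)
  define \<phi> where "\<phi> x = Fn g (of_real x)" for x
  obtain l m where \<phi>: "solves (mu a g) \<phi>" "bdry (mu a g) \<phi>" "data \<phi> l m"
    using Fn_solves[OF g(1) bg] unfolding \<phi>_def[abs_def] by blast
  have \<phi>1: "\<phi> (- 1) \<noteq> 0" using Fn_minus_1[OF g(1) bg] by (simp add: \<phi>_def)
  define d where "d = thetaq g * (qp (of_real a * g) * qp (of_real c * g) / (qp (g\<^sup>2) * qp (of_real (a * c))))"
  have "(\<lambda>k. (g / of_real a) ^ k * \<phi> (z / q ^ k)) \<longlonglongrightarrow> d"
    using Fn_asymptotics[OF g b1] unfolding \<phi>_def d_def .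
  then have dl: "(\<lambda>k. \<phi> (z / q ^ k) / (of_real a * (1 / g)) ^ k) \<longlonglongrightarrow> d"
    by (simp add: power_divide mult.commute)
  have d0: "d = 0 \<longleftrightarrow> g \<in> of_real ` Sset q z a b c"
    unfolding d_def by (rule asymptotic_coefficient_eq_0_iff[OF g b1])
  obtain \<Phi> l' m' where \<Phi>: "solves (mu a g) \<Phi>" "data \<Phi> l' m'" "(\<lambda>k. \<Phi> (z / q ^ k) / (of_real a * g) ^ k) \<longlonglongrightarrow> 1"
    using exists_solution_infinity[OF g(1)] g(2) by auto
  obtain W where W: "0 < W" "(\<lambda>k. wt (z / q ^ k) * a ^ (2 * k)) \<longlonglongrightarrow> W" by (rule wt_asymptotics)
  \<comment> \<open>The same Casoratian is evaluated at infinity and by the data at the origin. This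
    identifies the determinant of the data with \<open>d\<close> up to nonzero constants.\<close>
  have "(\<lambda>k. Cas \<phi> \<Phi> (z / q ^ Suc k)) \<longlonglongrightarrow> of_real (a * W) * (g - 1 / g) * d * 1"
    using g by (intro Cas_infinity[OF _ dl \<Phi>(3) W(2)]) simp
  moreover have "Cas \<phi> \<Phi> (z / q ^ Suc k) = \<kappa>0 * (l * m' - m * l')" for k
    by (rule Cas_eq[OF \<phi>(1) \<Phi>(1) \<phi>(3) \<Phi>(2) pos_in_I_power(2)])
  ultimately have eq: "\<kappa>0 * (l * m' - m * l') = of_real (a * W) * (g - 1 / g) * d * 1"
    by (simp only: LIMSEQ_const_iff)
  have "g - 1 / g \<noteq> 0"
  proof
    assume "g - 1 / g = 0"
    then have "g * g = 1" using g by (simp add: field_simps)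
    then have "norm g * norm g = 1" by (simp flip: norm_mult)
    moreover have "norm g * norm g < 1 * 1" using g by (intro mult_strict_mono) auto
    ultimately show False by simp
  qed
  moreover have "complex_of_real (a * W) \<noteq> 0" using a_pos W(1) by simp
  moreover have "l * m' - m * l' = 0 \<longleftrightarrow> \<kappa>0 * (l * m' - m * l') = 0" by simp
  ultimately have "l * m' - m * l' = 0 \<longleftrightarrow> d = 0" unfolding eq by simp
  then show ?thesis by (rule that[OF \<phi> \<phi>1 dl d0 \<Phi>])
qed

lemma eigenvalue:
  assumes g: "g \<noteq> 0" "norm g < 1" and b1: "b < 1" and gS: "g \<in> of_real ` Sset q z a b c"
  shows "mu a g \<in> point_spectrum DD LL"
proof -
  obtain \<phi> l m \<Phi> l' m' d where \<phi>: "solves (mu a g) \<phi>" "bdry (mu a g) \<phi>" "data \<phi> l m" "\<phi> (- 1) \<noteq> 0"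
      "(\<lambda>k. \<phi> (z / q ^ k) / (of_real a * (1 / g)) ^ k) \<longlonglongrightarrow> d"
    and d: "d = 0 \<longleftrightarrow> g \<in> of_real ` Sset q z a b c"
    and \<Phi>: "solves (mu a g) \<Phi>" "data \<Phi> l' m'" "(\<lambda>k. \<Phi> (z / q ^ k) / (of_real a * g) ^ k) \<longlonglongrightarrow> 1"
    and D: "l * m' - m * l' = 0 \<longleftrightarrow> d = 0"
    by (rule disc_solutions[OF g b1])
  have "l * m' = m * l'" using d D gS by simp
  then obtain t where t: "\<And>x. x \<in> II \<Longrightarrow> \<phi> x = t * \<Phi> x"
    using solves_proportional[OF \<phi>(1,3) \<Phi>(1,2) data_nonzero_limit[OF \<Phi>]] by blast
  \<comment> \<open>Elements of the space vanish off \<open>II\<close>, so the solution is cut off;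
    equation, boundary condition and data involve points of \<open>II\<close> only.\<close>
  define f where "f x = (if x \<in> II then \<phi> x else 0)" for x
  have f: "f x = \<phi> x" if "x \<in> II" for x using that by (simp add: f_def)
  have df: "data f l m" using \<phi>(3) data_cong[of f \<phi>] f by blast
  have "(\<lambda>k. t * (\<Phi> (z / q ^ k) / (of_real a * g) ^ k)) \<longlonglongrightarrow> t * 1" by (intro tendsto_intros \<Phi>)
  then have "(\<lambda>k. f (z / q ^ k) / (of_real a * g) ^ k) \<longlonglongrightarrow> t * 1" by (simp add: f t)
  then have fH: "f \<in> HH" by (rule HH_of_asymptotics[OF g df]) (simp add: f_def)
  have "\<forall>x\<in>II. LL f x = mu a g * f x"
    unfolding solution_iff using \<phi>(1,2) solves_cong[of f \<phi>] bdry_cong[of f \<phi>] f by blast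
  then have s0: "shift_op LL (mu a g) f = (\<lambda>x. 0)" by (intro shift_eqI) (auto simp: f_def)
  have "(\<lambda>x. 0) \<in> HH" using HH_lin[OF fH fH, of 0 0] by simp
  then have "f \<in> DD" by (rule DD_of_shift[OF fH s0 _ df])
  moreover have "f \<noteq> (\<lambda>x. 0)" using \<phi>(4) f[OF minus_1_in_I] by metis
  moreover have "LL f = (\<lambda>x. mu a g * f x)" using s0 by (auto simp: shift_op_def fun_eq_iff)
  ultimately show ?thesis unfolding point_spectrum_def by blast
qed

lemma resolvent_point:
  assumes g: "g \<noteq> 0" "norm g < 1" and b1: "b < 1" and gS: "g \<notin> of_real ` Sset q z a b c"
  shows "mu a g \<in> resolvent_set HH NN DD LL"
proof -
  obtain \<phi> l m \<Phi> l' m' d where \<phi>: "solves (mu a g) \<phi>" "bdry (mu a g) \<phi>" "data \<phi> l m" "\<phi> (- 1) \<noteq> 0"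
      "(\<lambda>k. \<phi> (z / q ^ k) / (of_real a * (1 / g)) ^ k) \<longlonglongrightarrow> d"
    and d: "d = 0 \<longleftrightarrow> g \<in> of_real ` Sset q z a b c"
    and \<Phi>: "solves (mu a g) \<Phi>" "data \<Phi> l' m'" "(\<lambda>k. \<Phi> (z / q ^ k) / (of_real a * g) ^ k) \<longlonglongrightarrow> 1"
    and D: "l * m' - m * l' = 0 \<longleftrightarrow> d = 0"
    by (rule disc_solutions[OF g b1])
  have d0: "d \<noteq> 0" using d gS by simp
  define \<kappa> where "\<kappa> = \<kappa>0 * (l * m' - m * l')"
  have \<kappa>: "\<kappa> \<noteq> 0" using D d0 by (simp add: \<kappa>_def)
  have r: "0 < norm g" using g by simp
  have ig: "1 / g \<noteq> 0" using g by simp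
  obtain C1 where C1: "0 < C1" "\<And>x. x \<in> II \<Longrightarrow> norm (\<phi> x) * sqrt (wt x) \<le> C1 * pp x * norm (1 / g) ^ nn x"
    using asymptotic_bound[OF ig \<phi>(3,5)] by blast
  obtain C2 where C2: "0 < C2" "\<And>x. x \<in> II \<Longrightarrow> norm (\<Phi> x) * sqrt (wt x) \<le> C2 * pp x * norm g ^ nn x"
    using asymptotic_bound[OF g(1) \<Phi>(2,3)] by blast
  have pp0: "0 \<le> pp x" if "x \<in> II" for x using wt_pos[OF that] by (simp add: pp_def)
  define C where "C = max C1 C2"
  have C: "0 < C" using C1 by (simp add: C_def)
  have b\<phi>: "norm (\<phi> x) * sqrt (wt x) \<le> C * pp x * (1 / norm g) ^ nn x" if "x \<in> II" for x
  proof -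
    have "C1 * pp x * norm (1 / g) ^ nn x \<le> C * pp x * norm (1 / g) ^ nn x"
      using pp0[OF that] by (intro mult_right_mono) (auto simp: C_def)
    then show ?thesis using C1(2)[OF that] by (simp add: norm_divide)
  qed
  have b\<Phi>: "norm (\<Phi> x) * sqrt (wt x) \<le> C * pp x * norm g ^ nn x" if "x \<in> II" for x
  proof -
    have "C2 * pp x * norm g ^ nn x \<le> C * pp x * norm g ^ nn x"
      using pp0[OF that] by (intro mult_right_mono) (auto simp: C_def)
    then show ?thesis using C2(2)[OF that] by simp
  qed
  obtain M where M: "\<And>h x. h \<in> HH \<Longrightarrow> x \<in> II \<Longrightarrow> (\<lambda>y. \<phi> y * (h y * of_real (wt y))) summable_on Ile x"
    "\<And>h x. h \<in> HH \<Longrightarrow> x \<in> II \<Longrightarrow> (\<lambda>y. \<Phi> y * (h y * of_real (wt y))) summable_on Igt x"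
    "\<And>h. h \<in> HH \<Longrightarrow> green \<kappa> \<phi> \<Phi> h \<in> HH"
    "\<And>h. h \<in> HH \<Longrightarrow> NN (green \<kappa> \<phi> \<Phi> h) \<le> M * NN h"
    using green_bounded[OF r g(2) C b\<phi> b\<Phi> \<kappa>] by blast
  let ?G = "green \<kappa> \<phi> \<Phi>"
  let ?T = "shift_op LL (mu a g)"
  have G: "?T (?G h) = h \<and> ?G h \<in> DD" if h: "h \<in> HH" for h
  proof -
    note gs = green_solution[OF \<phi>(1-3) \<Phi>(1,2) \<kappa>_def \<kappa> h M(1)[OF h] M(2)[OF h]]
    have T: "?T (?G h) = h"
      using gs(1) h by (intro shift_eqI) (auto simp: green_def HH_iff)
    moreover obtain L' M' where "data (?G h) L' M'" using gs(2) by blast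
    ultimately show ?thesis using DD_of_shift[OF M(3)[OF h] T h] by blast
  qed
  \<comment> \<open>A kernel element equals t \<open>\<phi>\<close> and is o(a^k), whereas
    \<open>\<phi>\<close> behaves like d (a/g)^k with d nonzero and |g| < 1; so t = 0.\<close>
  have inj: "inj_on ?T DD"
  proof (rule inj_shiftI)
    fix h assume h: "h \<in> DD" "?T h = (\<lambda>x. 0)"
    obtain l1 m1 where hs: "solves (mu a g) h" "bdry (mu a g) h" "data h l1 m1"
      by (rule kernel_solution[OF h])
    obtain t where t: "\<And>x. x \<in> II \<Longrightarrow> h x = t * \<phi> x"
      using bdry_unique[OF hs \<phi>(1-3) data_nonzero[OF \<phi>(1,3) minus_1_in_I \<phi>(4)]] by blast
    have "(\<lambda>k. h (z / q ^ k) / of_real a ^ k) \<longlonglongrightarrow> 0"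
      using h(1) by (intro HH_infinity_tendsto_0) (simp add: DD_iff)
    moreover have "(\<lambda>k. g ^ k) \<longlonglongrightarrow> 0" using g by (intro LIMSEQ_power_zero)
    ultimately have "(\<lambda>k. h (z / q ^ k) / of_real a ^ k * g ^ k) \<longlonglongrightarrow> 0 * 0" by (rule tendsto_mult)
    moreover have "h (z / q ^ k) / of_real a ^ k * g ^ k = t * (\<phi> (z / q ^ k) / (of_real a * (1 / g)) ^ k)" for k
      using t[OF pos_in_I_power(2)] by (simp add: power_divide)
    moreover have "(\<lambda>k. t * (\<phi> (z / q ^ k) / (of_real a * (1 / g)) ^ k)) \<longlonglongrightarrow> t * d" by (intro tendsto_intros \<phi>)
    ultimately have "t * d = 0" using LIMSEQ_unique by fastforce
    then show "\<forall>x\<in>II. h x = 0" using t d0 by simp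
  qed
  have "bij_betw ?T DD HH"
    unfolding bij_betw_def
  proof (intro conjI inj set_eqI iffI)
    fix h assume "h \<in> ?T ` DD" then show "h \<in> HH" using shift_in_HH by blast
  next
    fix h assume "h \<in> HH" then show "h \<in> ?T ` DD" using G[of h] image_eqI[of h ?T "?G h" DD] by simp
  qed
  moreover have "NN f \<le> M * NN (?T f)" if f: "f \<in> DD" for f
  proof -
    have h: "?T f \<in> HH" by (rule shift_in_HH[OF f])
    \<comment> \<open>Injectivity turns the right inverse into a two-sided one, so the norm bound of
      the Green operator is the bound demanded in \<open>resolvent_set\<close>.\<close>
    have "?G (?T f) = f" using inj_onD[OF inj, of "?G (?T f)" f] G[OF h] f by blast
    then show ?thesis using M(4)[OF h] by simp
  qed
  ultimately show ?thesis unfolding resolvent_set_def by blast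
qed

text \<open>The Casoratian with \<open>\<Phi>\<close> tends to 0, so h is a multiple of
  \<open>\<Phi>\<close>, and the modulus of \<open>\<Phi> (z / q^k) / a^k\<close> tends to 1. Only
  one solution with known behaviour is used, so g = 1 and g = -1, where a g and a/g coincide, are no
  exceptions.\<close>

lemma vanishing_at_infinity:
  assumes g: "norm g = 1" and h: "solves (mu a g) h" "data h l m" "(\<lambda>k. h (z / q ^ k) / of_real a ^ k) \<longlonglongrightarrow> 0"
    and x: "x \<in> II"
  shows "h x = 0"
proof -
  have g0: "g \<noteq> 0" using g by auto
  obtain \<Phi> l' m' where \<Phi>: "solves (mu a g) \<Phi>" "data \<Phi> l' m'" "(\<lambda>k. \<Phi> (z / q ^ k) / (of_real a * g) ^ k) \<longlonglongrightarrow> 1"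
    using exists_solution_infinity[OF g0] g by auto
  obtain W where W: "0 < W" "(\<lambda>k. wt (z / q ^ k) * a ^ (2 * k)) \<longlonglongrightarrow> W" by (rule wt_asymptotics)
  have hs: "(\<lambda>k. h (z / q ^ k) / (of_real a * s) ^ k) \<longlonglongrightarrow> 0" if "norm s = 1" for s
  proof (rule tendsto_norm_zero_cancel)
    have "norm (h (z / q ^ k) / (of_real a * s) ^ k) = norm (h (z / q ^ k) / of_real a ^ k)" for k
      using that by (simp add: norm_divide norm_mult norm_power power_mult_distrib)
    then show "(\<lambda>k. norm (h (z / q ^ k) / (of_real a * s) ^ k)) \<longlonglongrightarrow> 0" using tendsto_norm_zero[OF h(3)] by simp
  qed
  have "norm (1 / g) = 1" using g by (simp add: norm_divide)
  then have "(\<lambda>k. Cas h \<Phi> (z / q ^ Suc k)) \<longlonglongrightarrow> of_real (a * W) * (g - 1 / g) * 0 * 1"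
    using g0 by (intro Cas_infinity[OF _ hs \<Phi>(3) W(2)]) simp_all
  moreover have "Cas h \<Phi> (z / q ^ Suc k) = \<kappa>0 * (l * m' - m * l')" for k
    by (rule Cas_eq[OF h(1) \<Phi>(1) h(2) \<Phi>(2) pos_in_I_power(2)])
  ultimately have "\<kappa>0 * (l * m' - m * l') = of_real (a * W) * (g - 1 / g) * 0 * 1"
    by (simp only: LIMSEQ_const_iff)
  then have "l * m' = m * l'" by simp
  then obtain t where t: "\<And>x. x \<in> II \<Longrightarrow> h x = t * \<Phi> x"
    using solves_proportional[OF h(1,2) \<Phi>(1,2) data_nonzero_limit[OF \<Phi>]] by blast
  have "(\<lambda>k. t * (\<Phi> (z / q ^ k) / (of_real a * g) ^ k)) \<longlonglongrightarrow> t * 1" by (intro tendsto_intros \<Phi>)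
  then have "(\<lambda>k. h (z / q ^ k) / (of_real a * g) ^ k) \<longlonglongrightarrow> t" by (simp add: t)
  then have "t = 0" using hs[OF g] LIMSEQ_unique by blast
  then show ?thesis using t[OF x] by simp
qed

lemma data_zero: "data (\<lambda>x. 0) 0 0"
  by (simp add: data_def Dq_def)

text \<open>The Green potential of \<open>h\<close> vanishes near infinity.\<close>
lemma finite_support_in_range:
  assumes \<phi>: "solves lam \<phi>" "bdry lam \<phi>" "data \<phi> l m" "l \<noteq> 0 \<or> m \<noteq> 0"
    and X: "finite X" "X \<subseteq> II" "\<And>x. x \<notin> X \<Longrightarrow> h x = 0"
    and orth: "(\<Sum>x\<in>X. \<phi> x * (h x * of_real (wt x))) = 0"
  shows "h \<in> HH" "h \<in> shift_op LL lam ` DD"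
proof -
  have sum: "(\<lambda>y. s y * (h y * of_real (wt y))) summable_on Y" for s :: "real \<Rightarrow> complex" and Y
    by (rule finite_nonzero_values_imp_summable_on) (rule finite_subset[OF _ X(1)], use X(3) in auto)
  have "nsq h summable_on II"
    by (rule finite_nonzero_values_imp_summable_on) (rule finite_subset[OF _ X(1)], use X(3) in \<open>auto simp: nsq_def\<close>)
  then show hH: "h \<in> HH" using X by (auto simp: HH_iff)
  \<comment> \<open>Any solution independent of \<open>\<phi>\<close> will do: its growth at
    infinity is irrelevant because the Green potential vanishes for large x.\<close>
  obtain l' m' where lm: "l * m' - m * l' \<noteq> 0"
    using \<phi>(4) that[of 1 0] that[of 0 1] by fastforce
  obtain \<psi> where \<psi>: "solves lam \<psi>" "data \<psi> l' m'" by (rule exists_solution_with_data)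
  define \<kappa> where "\<kappa> = \<kappa>0 * (l * m' - m * l')"
  have \<kappa>: "\<kappa> \<noteq> 0" using lm by (simp add: \<kappa>_def)
  define f where "f = green \<kappa> \<phi> \<psi> h"
  note gs = green_solution[OF \<phi>(1-3) \<psi> \<kappa>_def \<kappa> hH sum sum, folded f_def]
  have T: "shift_op LL lam f = h" using gs(1) X by (intro shift_eqI) (auto simp: f_def green_def)
  obtain L M where df: "data f L M" using gs(2) by blast
  \<comment> \<open>To the right of the support the second sum has only zero terms and the first is
    the full sum, which is 0 by \<open>orth\<close>.\<close>
  have vanish: "f x = 0" if x: "x \<in> II" "\<And>y. y \<in> X \<Longrightarrow> y \<le> x" for x
  proof -
    have "aL \<phi> h x = (\<Sum>\<^sub>\<infinity>y\<in>X. \<phi> y * (h y * of_real (wt y)))"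
      unfolding aL_def by (rule infsum_cong_neutral) (use X x in auto)
    then have "aL \<phi> h x = 0" using orth X(1) by simp
    moreover have "bR \<psi> h x = 0"
      unfolding bR_def by (rule infsum_0) (use X(3) x(2) in force)
    ultimately show ?thesis by (simp add: f_def green_def)
  qed
  have "f \<in> HH"
  proof (rule HH_of_data[OF df])
    show "f x = 0" if "x \<notin> II" for x using that by (simp add: f_def green_def)
    obtain B where B: "\<And>y. y \<in> X \<Longrightarrow> y \<le> B" using X(1) bdd_above_finite[of X] by (auto simp: bdd_above_def)
    have q1: "1 < inverse q" using q_pos q_less_1 by (simp add: one_less_inverse)
    obtain N where "B / z < inverse q ^ N" using real_arch_pow[OF q1] by blast
    then have "B \<le> z * inverse q ^ N" using z_pos by (simp add: field_simps)
    moreover have "z * inverse q ^ N \<le> z * inverse q ^ k" if "k \<ge> N" for k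
      using that q1 z_pos by (intro mult_left_mono power_increasing) auto
    ultimately have N: "\<And>k. k \<ge> N \<Longrightarrow> B \<le> z * inverse q ^ k" by (meson order_trans)
    have "f (z / q ^ Suc k) = 0" if "k \<ge> N" for k
    proof (rule vanish[OF pos_in_I_power(2)])
      fix y assume "y \<in> X"
      then show "y \<le> z / q ^ Suc k" using B[of y] N[of "Suc k"] that by (simp add: power_inverse divide_inverse)
    qed
    then show "summable (\<lambda>k. nsq f (z / q ^ Suc k))"
      by (intro summable_finite[of "{..<N}"]) (auto simp: nsq_def not_less simp del: power_Suc)
  qed
  then have "f \<in> DD" by (rule DD_of_shift[OF _ T hH df])
  then show "h \<in> shift_op LL lam ` DD" using T by blast
qed

text \<open>As \<open>\<phi>\<close> is not square summable, pairing with it is an unbounded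
  functional on finitely supported functions, and the kernel of an unbounded functional is dense.
  The proof carries this out by an explicit correction.\<close>

lemma dense_range:
  assumes g: "norm g = 1"
  shows "dense_in HH NN (shift_op LL (mu a g) ` DD)"
  unfolding dense_in_def
proof (intro conjI ballI allI impI)
  show "shift_op LL (mu a g) ` DD \<subseteq> HH" using shift_in_HH by blast
  fix f and e :: real assume f: "f \<in> HH" and e: "0 < e"
  obtain \<phi> l m where \<phi>: "solves (mu a g) \<phi>" "bdry (mu a g) \<phi>" "data \<phi> l m" "l \<noteq> 0 \<or> m \<noteq> 0"
    by (rule exists_bdry_solution)
  have sf: "nsq f summable_on II" using f by (simp add: HH_iff)
  \<comment> \<open>The squared error is at most 2 \<epsilon> + 2 \<epsilon>, from the tail of f and
    from the correction; dividing by 5 leaves a strict inequality.\<close>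
  define \<epsilon> where "\<epsilon> = e\<^sup>2 / 5"
  have \<epsilon>: "0 < \<epsilon>" using e by (simp add: \<epsilon>_def)
  obtain F where F: "finite F" "F \<subseteq> II" "dist (sum (nsq f) F) (infsum (nsq f) II) \<le> \<epsilon>"
    using infsum_finite_approximation[OF sf \<epsilon>] by blast
  define S where "S = (\<Sum>x\<in>F. \<phi> x * (f x * of_real (wt x)))"
  have "\<exists>X. finite X \<and> X \<subseteq> II \<and> (norm S)\<^sup>2 / \<epsilon> < sum (nsq \<phi>) X"
  proof (rule ccontr)
    assume "\<not> ?thesis"
    then have "\<And>X. finite X \<Longrightarrow> X \<subseteq> II \<Longrightarrow> sum (nsq \<phi>) X \<le> (norm S)\<^sup>2 / \<epsilon>" by (auto simp: not_less)
    then have s: "nsq \<phi> summable_on II" using nonneg_summable_infsum_le(1)[of II "nsq \<phi>" "(norm S)\<^sup>2 / \<epsilon>"] by simp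
    define \<phi>' where "\<phi>' x = (if x \<in> II then \<phi> x else 0)" for x
    have "nsq \<phi>' summable_on II" using s by (rule summable_on_cong[THEN iffD1, rotated]) (simp add: nsq_def \<phi>'_def)
    then have "\<phi>' \<in> HH" by (simp add: HH_iff \<phi>'_def)
    from HH_infinity_tendsto_0[OF this] have "(\<lambda>k. \<phi> (z / q ^ k) / of_real a ^ k) \<longlonglongrightarrow> 0"
      by (simp add: \<phi>'_def)
    then have "\<phi> x = 0" if "x \<in> II" for x using vanishing_at_infinity[OF g \<phi>(1,3)] that by blast
    then have "data \<phi> 0 0" using data_cong[of \<phi> "\<lambda>x. 0" 0 0] data_zero by blast
    then show False using data_unique[OF \<phi>(3)] \<phi>(4) by blast
  qed
  then obtain X where X: "finite X" "X \<subseteq> II" "(norm S)\<^sup>2 / \<epsilon> < sum (nsq \<phi>) X" by blast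
  define N where "N = sum (nsq \<phi>) X"
  have "0 \<le> (norm S)\<^sup>2 / \<epsilon>" using \<epsilon> by simp
  then have N: "0 < N" using X(3) unfolding N_def by linarith
  have NS: "(norm S)\<^sup>2 / N < \<epsilon>" using X(3) \<epsilon> N by (simp add: N_def[symmetric] field_simps)
  define f1 where "f1 x = (if x \<in> F then f x else 0)" for x
  \<comment> \<open>The correction cancels the sum of \<open>f1\<close> against
    \<open>\<phi>\<close>. Its squared norm is |S|^2 / N, which is small because N can be made
    large.\<close>
  define f2 where "f2 x = (if x \<in> X then S / of_real N * cnj (\<phi> x) else 0)" for x
  define h where "h x = f1 x - f2 x" for x
  have FX: "finite (F \<union> X)" "F \<union> X \<subseteq> II" using F X by auto
  have h0: "h x = 0" if "x \<notin> F \<union> X" for x using that by (simp add: h_def f1_def f2_def)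
  have "(\<Sum>x\<in>F \<union> X. \<phi> x * (h x * of_real (wt x)))
      = (\<Sum>x\<in>F \<union> X. \<phi> x * (f1 x * of_real (wt x))) - (\<Sum>x\<in>F \<union> X. \<phi> x * (f2 x * of_real (wt x)))"
    by (simp add: h_def algebra_simps sum_subtractf)
  also have "(\<Sum>x\<in>F \<union> X. \<phi> x * (f1 x * of_real (wt x))) = S"
    unfolding S_def using FX by (intro sum.mono_neutral_cong_right) (auto simp: f1_def)
  also have "(\<Sum>x\<in>F \<union> X. \<phi> x * (f2 x * of_real (wt x))) = (\<Sum>x\<in>X. S / of_real N * of_real (nsq \<phi> x))"
  proof (rule sum.mono_neutral_cong_right)
    fix x assume "x \<in> X"
    then have "\<phi> x * (f2 x * of_real (wt x)) = S / of_real N * ((\<phi> x * cnj (\<phi> x)) * of_real (wt x))"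
      by (simp add: f2_def mult_ac)
    then show "\<phi> x * (f2 x * of_real (wt x)) = S / of_real N * of_real (nsq \<phi> x)"
      by (simp only: nsq_def of_real_mult complex_norm_square)
  qed (use FX in \<open>auto simp: f2_def\<close>)
  also have "\<dots> = S / of_real N * of_real N" by (simp only: N_def of_real_sum sum_distrib_left)
  also have "\<dots> = S" using N by simp
  finally have orth: "(\<Sum>x\<in>F \<union> X. \<phi> x * (h x * of_real (wt x))) = 0" by simp
  note hr = finite_support_in_range[OF \<phi> FX h0 orth]
  have fh: "(\<lambda>x. f x - h x) \<in> HH" using HH_lin[OF f hr(1), of 1 "- 1"] by simp
  have "infsum (nsq (\<lambda>x. f x - h x)) II < e\<^sup>2"
  proof -
    define r where "r x = f x - f1 x" for x
    have nr: "nsq r x = (if x \<in> F then 0 else nsq f x)" for x by (simp add: r_def nsq_def f1_def)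
    have ir: "infsum (nsq r) II \<le> \<epsilon>" and sr: "nsq r summable_on II"
    proof -
      have s1: "nsq f summable_on (II - F)" by (rule summable_on_subset[OF sf]) auto
      have "infsum (nsq f) II = sum (nsq f) F + infsum (nsq f) (II - F)"
        using infsum_Un_disjoint[of "nsq f" F "II - F"] s1 F by (simp add: Un_absorb1)
      then have "infsum (nsq f) (II - F) \<le> \<epsilon>" using F(3) by (simp add: dist_real_def)
      moreover have "infsum (nsq r) II = infsum (nsq f) (II - F)"
        by (rule infsum_cong_neutral) (auto simp: nr)
      ultimately show "infsum (nsq r) II \<le> \<epsilon>" by simp
      show "nsq r summable_on II" using s1 by (rule summable_on_cong_neutral[THEN iffD1, rotated 3]) (auto simp: nr)
    qed
    have i2: "infsum (nsq f2) II < \<epsilon>" and s2: "nsq f2 summable_on II"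
    proof -
      have "infsum (nsq f2) II = infsum (nsq f2) X"
        by (rule infsum_cong_neutral) (use X(2) in \<open>auto simp: nsq_def f2_def\<close>)
      also have "\<dots> = (\<Sum>x\<in>X. (norm S)\<^sup>2 / N\<^sup>2 * nsq \<phi> x)"
        using X(1) N by (simp add: nsq_def f2_def norm_mult norm_divide power_mult_distrib power_divide mult_ac)
      also have "\<dots> = (norm S)\<^sup>2 / N"
        using N by (simp only: sum_distrib_left[symmetric] N_def[symmetric]) (simp add: power2_eq_square)
      finally show "infsum (nsq f2) II < \<epsilon>" using NS by simp
      show "nsq f2 summable_on II"
        by (rule finite_nonzero_values_imp_summable_on) (rule finite_subset[OF _ X(1)], auto simp: nsq_def f2_def)
    qed
    have "infsum (nsq (\<lambda>x. f x - h x)) II \<le> (\<Sum>\<^sub>\<infinity>x\<in>II. 2 * nsq r x + 2 * nsq f2 x)"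
    proof (rule infsum_mono)
      show "nsq (\<lambda>x. f x - h x) summable_on II" using fh by (simp add: HH_iff)
      show "(\<lambda>x. 2 * nsq r x + 2 * nsq f2 x) summable_on II"
        by (intro summable_on_add summable_on_cmult_right sr s2)
      fix x assume "x \<in> II"
      moreover have "(\<lambda>x. f x - h x) = (\<lambda>x. 1 * r x + 1 * f2 x)" by (simp add: r_def h_def fun_eq_iff)
      ultimately show "nsq (\<lambda>x. f x - h x) x \<le> 2 * nsq r x + 2 * nsq f2 x"
        using HH_bound[of x 1 r 1 f2] by (simp only:) simp
    qed
    also have "\<dots> = 2 * infsum (nsq r) II + 2 * infsum (nsq f2) II"
      using sr s2 by (simp add: infsum_add infsum_cmult_right summable_on_cmult_right)
    also have "\<dots> < 5 * \<epsilon>" using ir i2 \<epsilon> by linarith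
    also have "5 * \<epsilon> = e\<^sup>2" by (simp add: \<epsilon>_def)
    finally show ?thesis .
  qed
  then have "NN (\<lambda>x. f x - h x) < e"
    unfolding NN_eq[OF fh] using e real_sqrt_less_mono[of _ "e\<^sup>2"] by fastforce
  then show "\<exists>h\<in>shift_op LL (mu a g) ` DD. NN (\<lambda>x. f x - h x) < e" using hr(2) by blast
qed

text \<open>A slowly decaying multiple \<open>\<Phi>(z q\<^sup>-\<^sup>k) k\<^sup>-\<^sup>1\<^sup>/\<^sup>2\<close> of the solution at infinity is not
  square summable, but its image is.\<close>
lemma range_not_full:
  assumes g: "norm g = 1"
  shows "shift_op LL (mu a g) ` DD \<noteq> HH"
proof
  assume R: "shift_op LL (mu a g) ` DD = HH"
  have g0: "g \<noteq> 0" using g by auto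
  obtain \<Phi> l m where \<Phi>: "solves (mu a g) \<Phi>" "data \<Phi> l m" "(\<lambda>k. \<Phi> (z / q ^ k) / (of_real a * g) ^ k) \<longlonglongrightarrow> 1"
    using exists_solution_infinity[OF g0] g by auto
  obtain W where W: "0 < W" "(\<lambda>k. wt (z / q ^ k) * a ^ (2 * k)) \<longlonglongrightarrow> W" by (rule wt_asymptotics)
  define \<sigma> where "\<sigma> k = 1 / sqrt (real k)" for k
  \<comment> \<open>The cut at z makes f vanish near the origin, so that only the behaviour at
    infinity matters.\<close>
  define f where "f x = (if x \<in> II \<and> z < x then of_real (\<sigma> (nn x)) * \<Phi> x else 0)" for x
  have f_inf: "f (z / q ^ Suc k) = of_real (\<sigma> (Suc k)) * \<Phi> (z / q ^ Suc k)" for k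
    using div_power_greater[of k] nn_div_power[of "Suc k"] by (simp add: f_def del: power_Suc)
  have f_0: "f x = 0" if "x \<le> z" for x using that by (simp add: f_def)
  have f_off: "f x = 0" if "x \<notin> II" for x using that by (simp add: f_def)
  have near0: "data h 0 0" if "\<And>x. x \<in> II \<Longrightarrow> x < z \<Longrightarrow> h x = 0" for h
    using data_of_deriv[of "\<lambda>x. 0" 0 z h] that z_pos by auto
  define v where "v = shift_op LL (mu a g) f"
  have v_off: "v x = 0" if "x \<notin> II" for x using that by (simp add: v_def shift_op_def LL_eq f_off)
  have v_0: "v x = 0" if x: "x \<in> II" "x < z" for x
  proof -
    have "q * x \<le> z"
      using x mult_left_le_one_le[of x q] q_pos q_less_1 z_pos mult_pos_neg[of q x] by (cases "0 \<le> x") auto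
    moreover have "x / q \<le> z"
    proof (cases "0 < x")
      case True
      have "z \<in> II" using pos_in_I_power(1)[of 0] by simp
      from gap_pos[OF this x(1) z_pos x(2)] show ?thesis using q_pos by (simp add: divide_le_eq mult.commute)
    next
      case False
      then have "x / q \<le> 0" using q_pos by (simp add: divide_nonpos_pos)
      then show ?thesis using z_pos by linarith
    qed
    moreover have "- q \<le> z" using z_pos q_pos by linarith
    ultimately show ?thesis
      using x z_pos by (cases "x = - 1") (simp_all add: v_def shift_op_def LL_eq f_0)
  qed
  obtain C where C: "0 < C" "\<And>x. x \<in> II \<Longrightarrow> norm (\<Phi> x) * sqrt (wt x) \<le> C * pp x * norm g ^ nn x"
    using asymptotic_bound[OF g0 \<Phi>(2,3)] by blast
  have \<Phi>_bound: "\<exists>K. \<forall>k. norm (\<Phi> (z / q ^ (k + i)) * of_real (sqrt (wt (z / q ^ (k + j))))) \<le> K" for i j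
  proof -
    have "(\<lambda>k. norm (\<Phi> (z / q ^ (k + i)) / (of_real a * g) ^ (k + i)) * sqrt (wt (z / q ^ (k + j)) * a ^ (2 * (k + j))) * (a ^ i / a ^ j))
        \<longlonglongrightarrow> norm (1 :: complex) * sqrt W * (a ^ i / a ^ j)"
      by (intro tendsto_mult tendsto_norm tendsto_real_sqrt tendsto_const LIMSEQ_ignore_initial_segment[OF \<Phi>(3)]
          LIMSEQ_ignore_initial_segment[OF W(2)])
    moreover have "norm (\<Phi> (z / q ^ (k + i)) / (of_real a * g) ^ (k + i)) * sqrt (wt (z / q ^ (k + j)) * a ^ (2 * (k + j))) * (a ^ i / a ^ j)
        = norm (\<Phi> (z / q ^ (k + i)) * of_real (sqrt (wt (z / q ^ (k + j)))))" for k
    proof -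
      have "sqrt (a ^ (2 * (k + j))) = a ^ (k + j)"
      proof -
        have "a ^ (2 * (k + j)) = (a ^ (k + j))\<^sup>2" by (simp only: power_mult[symmetric] mult.commute)
        then show ?thesis using a_pos by (simp only: real_sqrt_abs) simp
      qed
      moreover have "0 \<le> sqrt (wt (z / q ^ (k + j)))" using wt_pos[OF pos_in_I_power(2)] by (simp add: less_imp_le)
      ultimately show ?thesis
        using a_pos g by (simp add: norm_mult norm_divide norm_power power_mult_distrib real_sqrt_mult power_add field_simps)
    qed
    ultimately have "Bseq (\<lambda>k. norm (\<Phi> (z / q ^ (k + i)) * of_real (sqrt (wt (z / q ^ (k + j))))))"
      using convergent_imp_Bseq convergentI by fastforce
    then show ?thesis by (auto simp: Bseq_def)
  qed
  obtain K1 where K1: "\<And>k. norm (\<Phi> (z / q ^ (k + 0)) * of_real (sqrt (wt (z / q ^ (k + 1))))) \<le> K1" using \<Phi>_bound[of 0 1] by blast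
  obtain K2 where K2: "\<And>k. norm (\<Phi> (z / q ^ (k + 2)) * of_real (sqrt (wt (z / q ^ (k + 1))))) \<le> K2" using \<Phi>_bound[of 2 1] by blast
  have "Bseq (\<lambda>k. Ac (z / q ^ Suc k))" "Bseq (\<lambda>k. Bc (z / q ^ Suc k))"
    using LIMSEQ_Suc[OF Ac_tendsto] LIMSEQ_Suc[OF Bc_tendsto] convergent_imp_Bseq convergentI by blast+
  then obtain A B where AB: "0 < A" "\<And>k. \<bar>Ac (z / q ^ Suc k)\<bar> \<le> A" "0 < B" "\<And>k. \<bar>Bc (z / q ^ Suc k)\<bar> \<le> B"
    by (auto simp: Bseq_def)
  \<comment> \<open>The crude bound 1 for the difference of the square roots already gives 1/k,
    which is square summable.\<close>
  have \<sigma>: "\<bar>\<sigma> j - \<sigma> (Suc j)\<bar> \<le> 1 / real k" if "1 \<le> k" "k \<le> j" for j k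
  proof -
    have sj: "0 < sqrt (real j)" "sqrt (real j) \<le> sqrt (real (Suc j))" using that by auto
    have "sqrt (real (Suc j)) - sqrt (real j) \<le> 1"
      using sqrt_add_le_add_sqrt[of "real j" 1] by (simp add: add.commute)
    moreover have "\<sigma> j - \<sigma> (Suc j) = (sqrt (real (Suc j)) - sqrt (real j)) / (sqrt (real j) * sqrt (real (Suc j)))"
      using sj by (simp add: \<sigma>_def field_simps)
    moreover have "0 \<le> sqrt (real (Suc j)) - sqrt (real j)" using sj by simp
    moreover have "real j \<le> sqrt (real j) * sqrt (real (Suc j))"
      using mult_left_mono[OF sj(2), of "sqrt (real j)"] by simp
    ultimately have "\<bar>\<sigma> j - \<sigma> (Suc j)\<bar> \<le> 1 / real j"
      using that by (simp add: frac_le)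
    also have "\<dots> \<le> 1 / real k" using that by (intro divide_left_mono) auto
    finally show ?thesis .
  qed
  have v_inf: "norm (v (z / q ^ Suc k)) * sqrt (wt (z / q ^ Suc k)) \<le> (A * K1 + B * K2) * (1 / real k)" if k: "1 \<le> k" for k
  proof -
    let ?x = "z / q ^ Suc k"
    have I: "?x \<in> II" by (rule pos_in_I_power(2))
    obtain j where j: "k = Suc j" using k by (cases k) auto
    have sh: "q * ?x = z / q ^ k" "?x / q = z / q ^ Suc (Suc k)" using q_pos by (simp_all add: mult_ac)
    have fk: "f (z / q ^ k) = of_real (\<sigma> k) * \<Phi> (z / q ^ k)" using f_inf[of j] unfolding j .
    have "v ?x = of_real (Ac ?x) * (f (z / q ^ k) - f ?x) + of_real (Bc ?x) * (f (z / q ^ Suc (Suc k)) - f ?x) - mu a g * f ?x"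
      unfolding v_def shift_op_def LL_eq(1)[OF I div_power_ne_minus_1] sh ..
    \<comment> \<open>By the equation for \<open>\<Phi>\<close> all terms with the common factor
      \<open>\<sigma> (Suc k)\<close> cancel; only differences of \<open>\<sigma>\<close> are
      left.\<close>
    also have "\<dots> = of_real (Ac ?x) * (of_real (\<sigma> k - \<sigma> (Suc k)) * \<Phi> (z / q ^ k))
        - of_real (Bc ?x) * (of_real (\<sigma> (Suc k) - \<sigma> (Suc (Suc k))) * \<Phi> (z / q ^ Suc (Suc k)))"
      unfolding fk f_inf of_real_diff using solves_infinity[OF \<Phi>(1), of k] by algebra
    finally have v: "v ?x = of_real (Ac ?x) * (of_real (\<sigma> k - \<sigma> (Suc k)) * \<Phi> (z / q ^ k))
        - of_real (Bc ?x) * (of_real (\<sigma> (Suc k) - \<sigma> (Suc (Suc k))) * \<Phi> (z / q ^ Suc (Suc k)))" .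
    have s0: "0 \<le> sqrt (wt ?x)" using wt_pos[OF I] by simp
    have "norm (v ?x) \<le> \<bar>Ac ?x\<bar> * (\<bar>\<sigma> k - \<sigma> (Suc k)\<bar> * norm (\<Phi> (z / q ^ k)))
        + \<bar>Bc ?x\<bar> * (\<bar>\<sigma> (Suc k) - \<sigma> (Suc (Suc k))\<bar> * norm (\<Phi> (z / q ^ Suc (Suc k))))"
      unfolding v by (rule order_trans[OF norm_triangle_ineq4]) (simp only: norm_mult norm_of_real order_refl)
    then have "norm (v ?x) * sqrt (wt ?x) \<le> (\<bar>Ac ?x\<bar> * (\<bar>\<sigma> k - \<sigma> (Suc k)\<bar> * norm (\<Phi> (z / q ^ k)))
        + \<bar>Bc ?x\<bar> * (\<bar>\<sigma> (Suc k) - \<sigma> (Suc (Suc k))\<bar> * norm (\<Phi> (z / q ^ Suc (Suc k))))) * sqrt (wt ?x)"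
      using s0 by (rule mult_right_mono)
    also have "\<dots> = \<bar>Ac ?x\<bar> * (\<bar>\<sigma> k - \<sigma> (Suc k)\<bar> * (norm (\<Phi> (z / q ^ k)) * sqrt (wt ?x)))
        + \<bar>Bc ?x\<bar> * (\<bar>\<sigma> (Suc k) - \<sigma> (Suc (Suc k))\<bar> * (norm (\<Phi> (z / q ^ Suc (Suc k))) * sqrt (wt ?x)))"
      by (simp only: distrib_right mult.assoc)
    also have "\<dots> \<le> A * (1 / real k * K1) + B * (1 / real k * K2)"
    proof (rule add_mono)
      have "norm (\<Phi> (z / q ^ k)) * sqrt (wt ?x) \<le> K1" using K1[of k] s0 by (simp add: norm_mult)
      then show "\<bar>Ac ?x\<bar> * (\<bar>\<sigma> k - \<sigma> (Suc k)\<bar> * (norm (\<Phi> (z / q ^ k)) * sqrt (wt ?x))) \<le> A * (1 / real k * K1)"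
        using AB s0 k by (intro mult_mono \<sigma>) auto
      have "norm (\<Phi> (z / q ^ Suc (Suc k))) * sqrt (wt ?x) \<le> K2" using K2[of k] s0 by (simp add: norm_mult)
      then show "\<bar>Bc ?x\<bar> * (\<bar>\<sigma> (Suc k) - \<sigma> (Suc (Suc k))\<bar> * (norm (\<Phi> (z / q ^ Suc (Suc k))) * sqrt (wt ?x))) \<le> B * (1 / real k * K2)"
        using AB s0 k by (intro mult_mono \<sigma>) auto
    qed
    also have "A * (1 / real k * K1) + B * (1 / real k * K2) = (A * K1 + B * K2) * (1 / real k)"
      by (simp add: algebra_simps)
    finally show ?thesis .
  qed
  have "v \<in> HH"
  proof (rule HH_of_data[OF near0[of v, OF v_0] v_off])
    show "summable (\<lambda>k. nsq v (z / q ^ Suc k))"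
    proof (rule summable_comparison_test'[of "\<lambda>k. (A * K1 + B * K2)\<^sup>2 * (1 / real k ^ 2)" 1])
      show "summable (\<lambda>k. (A * K1 + B * K2)\<^sup>2 * (1 / real k ^ 2))"
        using inverse_power_summable[of 2] by (intro summable_mult) (simp add: inverse_eq_divide)
      fix k :: nat assume k: "1 \<le> k"
      let ?x = "z / q ^ Suc k"
      have w: "0 < wt ?x" by (rule wt_pos[OF pos_in_I_power(2)])
      have "(norm (v ?x) * sqrt (wt ?x))\<^sup>2 \<le> ((A * K1 + B * K2) * (1 / real k))\<^sup>2"
        using w v_inf[OF k] by (intro power_mono) auto
      then show "norm (nsq v ?x) \<le> (A * K1 + B * K2)\<^sup>2 * (1 / real k ^ 2)"
        using w by (simp add: nsq_def power_mult_distrib abs_mult power_divide del: power_Suc)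
    qed
  qed
  \<comment> \<open>A preimage f' in the domain would differ from f by a solution of size o(a^k),
    which is 0 by \<open>vanishing_at_infinity\<close>; then f itself would lie in the
    space.\<close>
  then have "v \<in> shift_op LL (mu a g) ` DD" by (simp only: R)
  then obtain f' where f'v: "v = shift_op LL (mu a g) f'" and f'D: "f' \<in> DD" by (rule imageE)
  note f' = f'D f'v[symmetric]
  define h where "h = (\<lambda>x. 1 * f x + (- 1) * f' x)"
  have "shift_op LL (mu a g) h = (\<lambda>x. 0)"
    unfolding h_def shift_lin f'(2) v_def[symmetric] by simp
  then have "\<forall>x\<in>II. LL h x = mu a g * h x" by (simp add: shift_op_def fun_eq_iff)
  then have hs: "solves (mu a g) h" unfolding solution_iff by blast
  obtain l' m' where "data f' l' m'" using f'(1) by (auto simp: DD_iff)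
  then have hd: "data h (1 * 0 + (- 1) * l') (1 * 0 + (- 1) * m')"
    unfolding h_def by (intro data_lin near0) (simp_all add: f_0)
  have f'H: "f' \<in> HH" using f'(1) by (simp add: DD_iff)
  have \<sigma>0: "(\<lambda>k. \<sigma> k) \<longlonglongrightarrow> 0"
    unfolding \<sigma>_def
    by (intro tendsto_divide_0[OF tendsto_const] filterlim_at_top_imp_at_infinity
        filterlim_compose[OF sqrt_at_top filterlim_real_sequentially])
  have "(\<lambda>k. f (z / q ^ k) / of_real a ^ k) \<longlonglongrightarrow> 0"
  proof (rule tendsto_norm_zero_cancel)
    have "(\<lambda>k. \<sigma> (Suc k) * norm (\<Phi> (z / q ^ Suc k) / (of_real a * g) ^ Suc k)) \<longlonglongrightarrow> 0 * norm (1 :: complex)"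
      by (intro tendsto_intros LIMSEQ_Suc[OF \<sigma>0] LIMSEQ_Suc[OF \<Phi>(3)])
    moreover have "\<sigma> (Suc k) * norm (\<Phi> (z / q ^ Suc k) / (of_real a * g) ^ Suc k) = norm (f (z / q ^ Suc k) / of_real a ^ Suc k)" for k
      unfolding f_inf using g by (simp add: \<sigma>_def norm_mult norm_divide norm_power power_mult_distrib)
    ultimately have "(\<lambda>k. norm (f (z / q ^ Suc k) / of_real a ^ Suc k)) \<longlonglongrightarrow> 0" by simp
    then show "(\<lambda>k. norm (f (z / q ^ k) / of_real a ^ k)) \<longlonglongrightarrow> 0" by (rule LIMSEQ_imp_Suc)
  qed
  from tendsto_diff[OF this HH_infinity_tendsto_0[OF f'H]]
  have "(\<lambda>k. h (z / q ^ k) / of_real a ^ k) \<longlonglongrightarrow> 0" by (simp add: h_def diff_divide_distrib)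
  then have "h x = 0" if "x \<in> II" for x by (rule vanishing_at_infinity[OF g hs hd _ that])
  then have "f = f'" using f_off f'H by (fastforce simp: h_def HH_iff)
  then have "nsq f summable_on range (\<lambda>k::nat. z / q ^ Suc k)"
    using f'H unfolding HH_iff summable_on_II Ipos_split by (meson Un_upper2 summable_on_subset)
  then have summ: "summable (\<lambda>k. nsq f (z / q ^ Suc k))"
    unfolding summable_on_reindex[OF inj_div_power]
    by (auto simp: o_def intro: summable_on_imp_summable simp del: power_Suc)
  \<comment> \<open>The terms of the squared norm of f are asymptotic to W / (k + 1); comparison
    with the harmonic series gives the contradiction.\<close>
  have "(\<lambda>k. (norm (\<Phi> (z / q ^ Suc k) / (of_real a * g) ^ Suc k))\<^sup>2 * (wt (z / q ^ Suc k) * a ^ (2 * Suc k)))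
      \<longlonglongrightarrow> (norm (1 :: complex))\<^sup>2 * W"
    by (intro tendsto_intros LIMSEQ_Suc[OF \<Phi>(3)] LIMSEQ_Suc[OF W(2)])
  moreover have "(norm (\<Phi> (z / q ^ Suc k) / (of_real a * g) ^ Suc k))\<^sup>2 * (wt (z / q ^ Suc k) * a ^ (2 * Suc k))
      = nsq f (z / q ^ Suc k) * real (Suc k)" for k
  proof -
    have p: "a ^ (2 * Suc k) = (a ^ Suc k)\<^sup>2" by (simp only: power_mult[symmetric] mult.commute)
    have "norm ((of_real a * g) ^ Suc k) = a ^ Suc k" using a_pos g by (simp add: norm_mult norm_power power_mult_distrib)
    moreover have "(\<sigma> (Suc k))\<^sup>2 * real (Suc k) = 1" by (simp add: \<sigma>_def power_divide)
    ultimately show ?thesis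
      unfolding nsq_def f_inf p norm_divide using a_pos
      by (simp add: norm_mult power_mult_distrib power_divide del: power_Suc)
  qed
  ultimately have "(\<lambda>k. nsq f (z / q ^ Suc k) * real (Suc k)) \<longlonglongrightarrow> W" by simp
  then have "eventually (\<lambda>k. W / 2 < nsq f (z / q ^ Suc k) * real (Suc k)) sequentially"
    using W(1) by (intro order_tendstoD(1)) auto
  then obtain N where N: "\<And>k. N \<le> k \<Longrightarrow> W / 2 < nsq f (z / q ^ Suc k) * real (Suc k)" by (auto simp: eventually_sequentially)
  have "summable (\<lambda>k. inverse (real (Suc k)))"
  proof (rule summable_comparison_test'[OF summable_mult[OF summ, of "2 / W"]])
    fix k assume "N \<le> k"
    then show "norm (inverse (real (Suc k))) \<le> 2 / W * nsq f (z / q ^ Suc k)"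
      using N[of k] W(1) by (simp add: field_simps)
  qed
  then have "summable (\<lambda>k. inverse (real k))" by (subst (asm) summable_Suc_iff)
  then show False using not_summable_harmonic[where 'a = real] by blast
qed

lemma continuous_point:
  assumes g: "norm g = 1"
  shows "mu a g \<in> continuous_spectrum HH NN DD LL"
proof -
  have "inj_on (shift_op LL (mu a g)) DD"
  proof (rule inj_shiftI)
    fix h assume h: "h \<in> DD" "shift_op LL (mu a g) h = (\<lambda>x. 0)"
    obtain l m where "solves (mu a g) h" "data h l m" by (rule kernel_solution[OF h]) blast
    moreover have "(\<lambda>k. h (z / q ^ k) / of_real a ^ k) \<longlonglongrightarrow> 0"
      using h(1) by (intro HH_infinity_tendsto_0) (simp add: DD_iff)
    ultimately show "\<forall>x\<in>II. h x = 0" using vanishing_at_infinity[OF g] by blast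
  qed
  then show ?thesis
    unfolding continuous_spectrum_def using dense_range[OF g] range_not_full[OF g] by blast
qed

section \<open>Parametrisation of the plane by \<open>mu\<close>, and the three parts of the
  spectrum theorem\<close>

lemma mu_inverse: "mu a (inverse g) = mu a g"
  by (simp add: mu_def add.commute)

text \<open>The condition g + 1/g = s is a quadratic equation with roots g and 1/g, at least one of
  which lies in the closed unit disc.\<close>

lemma exists_mu:
  obtains g where "g \<noteq> 0" "norm g \<le> 1" "lam = mu a g"
proof -
  define s where "s = (lam + 1 + (of_real a)\<^sup>2) / of_real a"
  define g where "g = (s + csqrt (s\<^sup>2 - 4)) / 2"
  have eq: "g * g - s * g + 1 = 0"
    using power2_csqrt[of "s\<^sup>2 - 4"] unfolding g_def by (simp add: field_simps power2_eq_square) algebra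
  then have g0: "g \<noteq> 0" by auto
  have "g + inverse g = s" using eq g0 by (simp add: field_simps)
  then have lam: "lam = mu a g" using a_pos by (simp add: mu_def s_def field_simps)
  show ?thesis
  proof (cases "norm g \<le> 1")
    case True
    then show ?thesis using that[of g] g0 lam by blast
  next
    case False
    then have "norm (inverse g) \<le> 1" by (simp add: norm_inverse inverse_le_1_iff)
    then show ?thesis using that[of "inverse g"] g0 lam mu_inverse by simp
  qed
qed

text \<open>On the unit circle 1/g is the conjugate of g, so mu(g) = -1 - a^2 + 2 a Re g, where Re g
  runs through [-1, 1].\<close>

lemma mu_unit_circle: "mu a ` {g. norm g = 1} = of_real ` {- ((1 + a)\<^sup>2) .. - ((1 - a)\<^sup>2)}"
proof (intro equalityI subsetI)
  fix w assume "w \<in> mu a ` {g. norm g = 1}"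
  then obtain g where g: "norm g = 1" "w = mu a g" by blast
  have "g * cnj g = 1" using complex_norm_square[of g] g(1) by simp
  then have "inverse g = cnj g" by (rule inverse_unique)
  then have w: "w = of_real (- 1 - a\<^sup>2 + a * (2 * Re g))"
    using g(2) by (simp add: mu_def complex_add_cnj)
  have "\<bar>Re g\<bar> \<le> 1" using abs_Re_le_cmod[of g] g(1) by simp
  then have "a * (- 1) \<le> a * Re g" "a * Re g \<le> a * 1" using a_pos by (intro mult_left_mono; simp)+
  then have "- 1 - a\<^sup>2 + a * (2 * Re g) \<in> {- ((1 + a)\<^sup>2) .. - ((1 - a)\<^sup>2)}"
    by (simp add: power2_sum power2_diff)
  then show "w \<in> of_real ` {- ((1 + a)\<^sup>2) .. - ((1 - a)\<^sup>2)}" unfolding w by blast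
next
  fix w assume "w \<in> complex_of_real ` {- ((1 + a)\<^sup>2) .. - ((1 - a)\<^sup>2)}"
  then obtain t where t: "w = of_real t" "- ((1 + a)\<^sup>2) \<le> t" "t \<le> - ((1 - a)\<^sup>2)" by auto
  define x where "x = (t + 1 + a\<^sup>2) / (2 * a)"
  have x: "- 1 \<le> x" "x \<le> 1"
    using t(2,3) a_pos unfolding x_def by (simp_all add: divide_simps power2_sum power2_diff)
  define g where "g = Complex x (sqrt (1 - x\<^sup>2))"
  have "x\<^sup>2 \<le> 1" using x by (simp add: abs_square_le_1 abs_le_iff)
  then have n: "norm g = 1" by (simp add: g_def cmod_def)
  have "g * cnj g = 1" using complex_norm_square[of g] n by simp
  then have "inverse g = cnj g" by (rule inverse_unique)
  then have "mu a g = of_real (- 1 - a\<^sup>2 + a * (2 * Re g))" by (simp add: mu_def complex_add_cnj)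
  also have "- 1 - a\<^sup>2 + a * (2 * Re g) = t" using a_pos by (simp add: g_def x_def field_simps)
  finally show "w \<in> mu a ` {g. norm g = 1}" using t(1) n by force
qed

text \<open>Disjoint sets of which given subsets already cover everything coincide with these
  subsets. Upper bounds for the point and the continuous spectrum thus follow from placing each
  mu(g) in one of the three sets.\<close>

lemma partition_eqI:
  assumes "P0 \<subseteq> P" "C0 \<subseteq> C" "\<And>x. x \<in> C0 \<or> x \<in> P0 \<or> x \<in> R" "P \<inter> C = {}" "P \<inter> R = {}" "C \<inter> R = {}"
  shows "- R = C0 \<union> P0 \<and> C = C0 \<and> P = P0"
  using assms by blast

theorem spectrum_b_less_1:
  assumes b1: "b < 1"
  shows "spectrum HH NN DD LL = of_real ` {- ((1 + a)\<^sup>2) .. - ((1 - a)\<^sup>2)} \<union> (\<lambda>\<gamma>. mu a (of_real \<gamma>)) ` Sset q z a b c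
    \<and> continuous_spectrum HH NN DD LL = of_real ` {- ((1 + a)\<^sup>2) .. - ((1 - a)\<^sup>2)}
    \<and> point_spectrum DD LL = (\<lambda>\<gamma>. mu a (of_real \<gamma>)) ` Sset q z a b c"
proof -
  let ?P = "(\<lambda>\<gamma>. mu a (of_real \<gamma>)) ` Sset q z a b c"
  let ?C = "mu a ` {g. norm g = 1}"
  let ?R = "resolvent_set HH NN DD LL"
  have S: "\<gamma> \<noteq> 0 \<and> norm (complex_of_real \<gamma>) < 1" if "\<gamma> \<in> Sset q z a b c" for \<gamma>
    using that a_pos b_pos c_pos z_pos q_pos unfolding Sset_def by auto
  have P: "?P \<subseteq> point_spectrum DD LL"
    using S by (auto intro!: eigenvalue b1)
  have C: "?C \<subseteq> continuous_spectrum HH NN DD LL"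
    using continuous_point by blast
  have cover: "lam \<in> ?C \<or> lam \<in> ?P \<or> lam \<in> ?R" for lam
  proof -
    obtain g where g: "g \<noteq> 0" "norm g \<le> 1" "lam = mu a g" by (rule exists_mu)
    show ?thesis
    proof (cases "norm g = 1")
      case False
      then have "norm g < 1" using g by simp
      then show ?thesis using resolvent_point[OF g(1) _ b1] g(3) by blast
    qed (use g in blast)
  qed
  have zero: "shift_op LL lam (\<lambda>x. 0) = (\<lambda>x. 0)" for lam
    by (simp add: shift_op_def Lop_def fun_eq_iff)
  have not_inj: "\<not> inj_on (shift_op LL lam) DD" if ev: "lam \<in> point_spectrum DD LL" for lam
  proof
    assume inj: "inj_on (shift_op LL lam) DD"
    obtain f where f: "f \<in> DD" "f \<noteq> (\<lambda>x. 0)" "LL f = (\<lambda>x. lam * f x)"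
      using ev unfolding point_spectrum_def by blast
    have "shift_op LL lam f = (\<lambda>x. 0)" using f(3) by (simp add: shift_op_def)
    moreover have "(\<lambda>x. 0) \<in> DD" using DD_lin[OF f(1,1), of 0 0] by simp
    ultimately show False using inj_onD[OF inj, of f "\<lambda>x. 0"] f zero by simp
  qed
  have PC: "point_spectrum DD LL \<inter> continuous_spectrum HH NN DD LL = {}"
    using not_inj by (auto simp: continuous_spectrum_def)
  have PR: "point_spectrum DD LL \<inter> ?R = {}"
    using not_inj by (auto simp: resolvent_set_def bij_betw_def)
  have CR: "continuous_spectrum HH NN DD LL \<inter> ?R = {}"
    by (auto simp: continuous_spectrum_def resolvent_set_def bij_betw_def)
  show ?thesis
    unfolding spectrum_def mu_unit_circle[symmetric]
    by (rule partition_eqI[OF P C cover PC PR CR])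
qed

end

lemma symmetry_b_c:
  "Hspace q z a b c = Hspace q z a c b" "Hnorm q z a b c = Hnorm q z a c b"
  "Ddom q z a b c = Ddom q z a c b" "Lop q z a b c = Lop q z a c b" "Sset q z a b c = Sset q z a c b"
proof -
  have A: "Acoeff a b c = Acoeff a c b" by (simp add: Acoeff_def fun_eq_iff mult_ac)
  have B: "Bcoeff q b c = Bcoeff q c b" by (simp add: Bcoeff_def fun_eq_iff mult_ac)
  have p: "pfun q a b c = pfun q a c b" by (simp add: pfun_def fun_eq_iff mult_ac)
  have w: "wminus q a b c = wminus q a c b" "wplus q z a b c = wplus q z a c b"
    by (simp_all add: wminus_def wplus_def p fun_eq_iff)
  show L: "Lop q z a b c = Lop q z a c b" by (simp add: Lop_def A B fun_eq_iff)
  show H: "Hspace q z a b c = Hspace q z a c b" by (simp add: Hspace_def w)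
  show "Hnorm q z a b c = Hnorm q z a c b" by (simp add: Hnorm_def Hinner_def w fun_eq_iff)
  show "Ddom q z a b c = Ddom q z a c b" by (simp add: Ddom_def L H)
  have "{a, b, c} = {a, c, b}" "a * b * c * z = a * c * b * z" by auto
  then show "Sset q z a b c = Sset q z a c b" unfolding Sset_def by (simp only:)
qed

theorem corollary8p4:
  fixes q z a b c :: real
  assumes "0 < q" and "q < 1" and "0 < z" and "(a, b, c) \<in> Vgen q z"
  shows "spectrum (Hspace q z a b c) (Hnorm q z a b c) (Ddom q z a b c) (Lop q z a b c)
           = complex_of_real ` {- ((1 + a)\<^sup>2) .. - ((1 - a)\<^sup>2)}
             \<union> (\<lambda>\<gamma>. mu a (complex_of_real \<gamma>)) ` Sset q z a b c
       \<and> continuous_spectrum (Hspace q z a b c) (Hnorm q z a b c) (Ddom q z a b c) (Lop q z a b c)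
           = complex_of_real ` {- ((1 + a)\<^sup>2) .. - ((1 - a)\<^sup>2)}
       \<and> point_spectrum (Ddom q z a b c) (Lop q z a b c)
           = (\<lambda>\<gamma>. mu a (complex_of_real \<gamma>)) ` Sset q z a b c"
proof -
  have p: "0 < a" "0 < b" "0 < c" "a * b < 1" "a * c < 1" "b * c < 1"
    using assms(4) by (auto simp: Vgen_def Vset_def)
  show ?thesis
  proof (cases "b < 1")
    case True
    interpret big_q_Jacobi q z a b c by unfold_locales (use assms p in auto)
    show ?thesis by (rule spectrum_b_less_1[OF True])
  next
    case False
    have "c < 1"
    proof (rule ccontr)
      assume "\<not> c < 1"
      then have "1 * 1 \<le> b * c" using False by (intro mult_mono) auto
      then show False using p by simp
    qed
    interpret big_q_Jacobi q z a c b by unfold_locales (use assms p in \<open>auto simp: mult.commute\<close>)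
    show ?thesis unfolding symmetry_b_c[of q z a b c] by (rule spectrum_b_less_1[OF \<open>c < 1\<close>])
  qed
qed

end
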